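(* Let $k$ be a commutative ring, $H$ a Hopf algebra over $k$ with bijective antipode, $A$ a left $H$-module algebra and $\mathcal{C}$ an $(H,A)$-coring containing a fixed $H$-grouplike element $x$. Then $A$, with its natural right $A$-module and left $H$-module structures and coaction $\rho_A(a)=1_A\otimes_A(x\blacktriangleleft a)$, is an object of ${}_H\mathcal{M}^{\mathcal{C}}$, and $A$ is a cyclic left $({}'\mathcal{C})^{op}\#H$-module, where the right ${}'\mathcal{C}$-action on $A$ is $a\leftharpoonup f=f(x\blacktriangleleft a)$ for all $f\in{}'\mathcal{C}$ and $a\in A$.
   Context: Sweedler notation with summation suppressed is used: $\Delta_H(h)=h_1\otimes h_2$, $\Delta_{\mathcal C}(c)=c_1\otimes_Ac_2$; $\epsilon_H$ and $S_H$ are the counit and antipode of $H$. A left $H$-module algebra is a $k$-algebra $A$ with a left $H$-module structure such that $h.(aa')=(h_1.a)(h_2.a')$ and $h.1_A=\epsilon_H(h)1_A$. For a left $H$-module algebra $R$, a left-right $(H,R)$-module is a left $H$-module and right $R$-module $M$ with $h(mr)=(h_1m)(h_2.r)$. A left $(H,A)$-bimodule is an $A$-bimodule and left $H$-module $M$ with $h(am)=(h_1.a)(h_2m)$ and $h(ma)=(h_1m)(h_2.a)$. If $M$ is a left-right $(H,A)$-module and $N$ a left $(H,A)$-bimodule, $H$ acts on $M\otimes_AN$ diagonally. An $A$-coring is a coassociative counital coalgebra $(\mathcal C,\Delta_{\mathcal C},\epsilon_{\mathcal C})$ in the monoidal category of $A$-bimodules; its left and right $A$-actions are denoted $\blacktriangleright$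 and $\blacktriangleleft$. An $(H,A)$-coring is an $A$-coring $\mathcal C$ that is also a left $(H,A)$-bimodule (with the same $A$-bimodule structure) such that $\Delta_{\mathcal C}:\mathcal C\to\mathcal C\otimes_A\mathcal C$ and $\epsilon_{\mathcal C}:\mathcal C\to A$ are $H$-linear. A right $(H,\mathcal C)$-comodule is a right $\mathcal C$-comodule $M$ (right $A$-module with coassociative counital right $A$-linear coaction $\rho_M:M\to M\otimes_A\mathcal C$) that is also a left-right $(H,A)$-module such that $\rho_M$ is $H$-linear; ${}_H\mathcal M^{\mathcal C}$ is the category of these. An $H$-grouplike element of $\mathcal C$ is $x\in\mathcal C$ with $\Delta_{\mathcal C}(x)=x\otimes_Ax$, $\epsilon_{\mathcal C}(x)=1_A$ and $h.x=\epsilon_H(h)x$ for all $h\in H$. The left dual ring ${}'\mathcal C$ is the set of left $A$-linear maps $\mathcal C\to A$ with product $(f\#g)(c)=g(c_1\blacktriangleleft f(c_2))$ and unit $\epsilon_{\mathcal C}$; it is a left $H$-module algebra via $(hf)(c)=h_2.f(S_H^{-1}(h_1).c)$. For a left $H$-module algebra $R$, the algebra $R^{op}\#H$ is $R\otimes_kH$ with product $(r\#h)(r'\#h')=((h_2.r')r)\#(h_1h')$ (products of elements of $R$ taken in $R$); left $R^{op}\#H$-modules are the same as left-right $(H,R)$-modules via $(r\#h)m=(hm)r$. *)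

theory Defs
  imports "HOL-Algebra.Module" "HOL-Algebra.Free_Abelian_Groups"
begin

section \<open>Modules and algebras over possibly noncommutative rings\<close>

locale left_module = R?: ring R + M?: abelian_group M
  for R :: "('r, 'x) ring_scheme" and M :: "('m, 'y) ring_scheme"
  and l :: "'r \<Rightarrow> 'm \<Rightarrow> 'm" +
  assumes lact_closed: "\<lbrakk>r \<in> carrier R; m \<in> carrier M\<rbrakk> \<Longrightarrow> l r m \<in> carrier M"
    and lact_add_l: "\<lbrakk>r \<in> carrier R; s \<in> carrier R; m \<in> carrier M\<rbrakk>
      \<Longrightarrow> l (r \<oplus>\<^bsub>R\<^esub> s) m = l r m \<oplus>\<^bsub>M\<^esub> l s m"
    and lact_add_r: "\<lbrakk>r \<in> carrier R; m \<in> carrier M; n \<in> carrier M\<rbrakk>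
      \<Longrightarrow> l r (m \<oplus>\<^bsub>M\<^esub> n) = l r m \<oplus>\<^bsub>M\<^esub> l r n"
    and lact_mult: "\<lbrakk>r \<in> carrier R; s \<in> carrier R; m \<in> carrier M\<rbrakk>
      \<Longrightarrow> l (r \<otimes>\<^bsub>R\<^esub> s) m = l r (l s m)"
    and lact_one: "m \<in> carrier M \<Longrightarrow> l \<one>\<^bsub>R\<^esub> m = m"

locale right_module = R?: ring R + M?: abelian_group M
  for R :: "('r, 'x) ring_scheme" and M :: "('m, 'y) ring_scheme"
  and r :: "'m \<Rightarrow> 'r \<Rightarrow> 'm" +
  assumes ract_closed: "\<lbrakk>m \<in> carrier M; a \<in> carrier R\<rbrakk> \<Longrightarrow> r m a \<in> carrier M"
    and ract_add_r: "\<lbrakk>m \<in> carrier M; a \<in> carrier R; b \<in> carrier R\<rbrakk>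
      \<Longrightarrow> r m (a \<oplus>\<^bsub>R\<^esub> b) = r m a \<oplus>\<^bsub>M\<^esub> r m b"
    and ract_add_l: "\<lbrakk>m \<in> carrier M; n \<in> carrier M; a \<in> carrier R\<rbrakk>
      \<Longrightarrow> r (m \<oplus>\<^bsub>M\<^esub> n) a = r m a \<oplus>\<^bsub>M\<^esub> r n a"
    and ract_mult: "\<lbrakk>m \<in> carrier M; a \<in> carrier R; b \<in> carrier R\<rbrakk>
      \<Longrightarrow> r m (a \<otimes>\<^bsub>R\<^esub> b) = r (r m a) b"
    and ract_one: "m \<in> carrier M \<Longrightarrow> r m \<one>\<^bsub>R\<^esub> = m"

locale bimodule = left_module A M l + right_module A M r
  for A :: "('a, 'x) ring_scheme" and M :: "('m, 'y) ring_scheme"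
  and l :: "'a \<Rightarrow> 'm \<Rightarrow> 'm" and r :: "'m \<Rightarrow> 'a \<Rightarrow> 'm" +
  assumes bimodule_assoc: "\<lbrakk>a \<in> carrier A; m \<in> carrier M; b \<in> carrier A\<rbrakk>
      \<Longrightarrow> r (l a m) b = l a (r m b)"

text \<open>Unlike the library locale \<open>algebra\<close>, the algebra itself need not be commutative.\<close>

locale k_algebra = module k A + A?: ring A
  for k :: "('k, 'x) ring_scheme" and A :: "('k, 'a, 'y) module_scheme" +
  assumes smult_mult_l: "\<lbrakk>\<kappa> \<in> carrier k; a \<in> carrier A; b \<in> carrier A\<rbrakk>
      \<Longrightarrow> (\<kappa> \<odot>\<^bsub>A\<^esub> a) \<otimes>\<^bsub>A\<^esub> b = \<kappa> \<odot>\<^bsub>A\<^esub> (a \<otimes>\<^bsub>A\<^esub> b)"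
    and smult_mult_r: "\<lbrakk>\<kappa> \<in> carrier k; a \<in> carrier A; b \<in> carrier A\<rbrakk>
      \<Longrightarrow> a \<otimes>\<^bsub>A\<^esub> (\<kappa> \<odot>\<^bsub>A\<^esub> b) = \<kappa> \<odot>\<^bsub>A\<^esub> (a \<otimes>\<^bsub>A\<^esub> b)"

text \<open>Modules over a \<open>k\<close>-algebra carry the \<open>k\<close>-module structure induced by the unit of the
  algebra; bimodules are \<open>k\<close>-symmetric.\<close>

locale k_left_module = k_algebra k A + MM?: module k M + left_module A M l
  for k :: "('k, 'x) ring_scheme" and A :: "('k, 'a, 'y) module_scheme"
  and M :: "('k, 'm, 'z) module_scheme" and l :: "'a \<Rightarrow> 'm \<Rightarrow> 'm" +
  assumes lact_smult: "\<lbrakk>\<kappa> \<in> carrier k; a \<in> carrier A; m \<in> carrier M\<rbrakk>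
      \<Longrightarrow> l (\<kappa> \<odot>\<^bsub>A\<^esub> a) m = \<kappa> \<odot>\<^bsub>M\<^esub> l a m"

locale k_right_module = k_algebra k A + MM?: module k M + right_module A M r
  for k :: "('k, 'x) ring_scheme" and A :: "('k, 'a, 'y) module_scheme"
  and M :: "('k, 'm, 'z) module_scheme" and r :: "'m \<Rightarrow> 'a \<Rightarrow> 'm" +
  assumes ract_smult: "\<lbrakk>\<kappa> \<in> carrier k; m \<in> carrier M; a \<in> carrier A\<rbrakk>
      \<Longrightarrow> r m (\<kappa> \<odot>\<^bsub>A\<^esub> a) = \<kappa> \<odot>\<^bsub>M\<^esub> r m a"

locale k_bimodule = k_left_module k A M l + k_right_module k A M r + bimodule A M l r
  for k :: "('k, 'x) ring_scheme" and A :: "('k, 'a, 'y) module_scheme"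
  and M :: "('k, 'm, 'z) module_scheme"
  and l :: "'a \<Rightarrow> 'm \<Rightarrow> 'm" and r :: "'m \<Rightarrow> 'a \<Rightarrow> 'm"

definition cyclic_left_module ::
  "('k, 'x) ring_scheme \<Rightarrow> ('k, 'a, 'y) module_scheme \<Rightarrow> ('k, 'm, 'z) module_scheme
    \<Rightarrow> ('a \<Rightarrow> 'm \<Rightarrow> 'm) \<Rightarrow> bool" where
  "cyclic_left_module k A M l \<longleftrightarrow>
     k_left_module k A M l \<and> (\<exists>m\<in>carrier M. carrier M = {l a m | a. a \<in> carrier A})"


section \<open>Tensor products\<close>

text \<open>\<open>M \<otimes>\<^sub>A N\<close> for a right \<open>A\<close>-module \<open>(M, r)\<close> and a left \<open>A\<close>-module \<open>(N, l)\<close> is the free abelian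
  group on pairs modulo the subgroup generated by the usual relations, so its elements are cosets
  of formal integer combinations of pairs.\<close>

type_synonym ('m, 'n) tensor = "('m \<times> 'n \<Rightarrow>\<^sub>0 int) set"

definition tensor_relations ::
  "('a, 'x) ring_scheme \<Rightarrow> ('m, 'y) ring_scheme \<Rightarrow> ('m \<Rightarrow> 'a \<Rightarrow> 'm)
    \<Rightarrow> ('n, 'z) ring_scheme \<Rightarrow> ('a \<Rightarrow> 'n \<Rightarrow> 'n) \<Rightarrow> ('m \<times> 'n \<Rightarrow>\<^sub>0 int) set" where
  "tensor_relations A M r N l =
     {frag_of (m \<oplus>\<^bsub>M\<^esub> m', n) - frag_of (m, n) - frag_of (m', n) | m m' n.
        m \<in> carrier M \<and> m' \<in> carrier M \<and> n \<in> carrier N} \<union>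
     {frag_of (m, n \<oplus>\<^bsub>N\<^esub> n') - frag_of (m, n) - frag_of (m, n') | m n n'.
        m \<in> carrier M \<and> n \<in> carrier N \<and> n' \<in> carrier N} \<union>
     {frag_of (r m a, n) - frag_of (m, l a n) | m a n.
        m \<in> carrier M \<and> a \<in> carrier A \<and> n \<in> carrier N}"

definition tensor_kernel ::
  "('a, 'x) ring_scheme \<Rightarrow> ('m, 'y) ring_scheme \<Rightarrow> ('m \<Rightarrow> 'a \<Rightarrow> 'm)
    \<Rightarrow> ('n, 'z) ring_scheme \<Rightarrow> ('a \<Rightarrow> 'n \<Rightarrow> 'n) \<Rightarrow> ('m \<times> 'n \<Rightarrow>\<^sub>0 int) set" where
  "tensor_kernel A M r N l =
     generate (free_Abelian_group (carrier M \<times> carrier N)) (tensor_relations A M r N l)"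

text \<open>Abelian groups are encoded as \<open>ring\<close> records, as the library does for modules; the
  multiplicative fields are irrelevant.\<close>

definition tensor ::
  "('a, 'x) ring_scheme \<Rightarrow> ('m, 'y) ring_scheme \<Rightarrow> ('m \<Rightarrow> 'a \<Rightarrow> 'm)
    \<Rightarrow> ('n, 'z) ring_scheme \<Rightarrow> ('a \<Rightarrow> 'n \<Rightarrow> 'n) \<Rightarrow> ('m, 'n) tensor ring" where
  "tensor A M r N l =
    (let Q = free_Abelian_group (carrier M \<times> carrier N) Mod tensor_kernel A M r N l
     in \<lparr>carrier = carrier Q, monoid.mult = undefined, monoid.one = undefined,
         ring.zero = \<one>\<^bsub>Q\<^esub>, ring.add = (\<lambda>X Y. X \<otimes>\<^bsub>Q\<^esub> Y)\<rparr>)"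

definition pure_tensor ::
  "('a, 'x) ring_scheme \<Rightarrow> ('m, 'y) ring_scheme \<Rightarrow> ('m \<Rightarrow> 'a \<Rightarrow> 'm)
    \<Rightarrow> ('n, 'z) ring_scheme \<Rightarrow> ('a \<Rightarrow> 'n \<Rightarrow> 'n) \<Rightarrow> 'm \<Rightarrow> 'n \<Rightarrow> ('m, 'n) tensor" where
  "pure_tensor A M r N l m n =
     tensor_kernel A M r N l #>\<^bsub>free_Abelian_group (carrier M \<times> carrier N)\<^esub> frag_of (m, n)"

text \<open>The homomorphism into \<open>G\<close> induced by a balanced biadditive map \<open>f\<close>: for such \<open>f\<close> the sum
  below does not depend on the representative \<open>p\<close> of the coset \<open>X\<close>. In particular
  \<open>tensor_lift G f (\<Delta> h)\<close> is what Sweedler notation writes as \<open>f h\<^sub>1 h\<^sub>2\<close>.\<close>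

definition tensor_lift ::
  "('g, 'x) ring_scheme \<Rightarrow> ('m \<Rightarrow> 'n \<Rightarrow> 'g) \<Rightarrow> ('m, 'n) tensor \<Rightarrow> 'g" where
  "tensor_lift G f X =
     the_elem ((\<lambda>p. \<Oplus>\<^bsub>G\<^esub>q\<in>Poly_Mapping.keys p.
       [Poly_Mapping.lookup p q] \<cdot>\<^bsub>G\<^esub> f (fst q) (snd q)) ` X)"

definition tensor_assoc ::
  "('a, 'x) ring_scheme \<Rightarrow> ('m, 'y) ring_scheme \<Rightarrow> ('m \<Rightarrow> 'a \<Rightarrow> 'm)
    \<Rightarrow> ('n, 'z) ring_scheme \<Rightarrow> ('a \<Rightarrow> 'n \<Rightarrow> 'n) \<Rightarrow> ('n \<Rightarrow> 'a \<Rightarrow> 'n)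
    \<Rightarrow> ('p, 'w) ring_scheme \<Rightarrow> ('a \<Rightarrow> 'p \<Rightarrow> 'p)
    \<Rightarrow> (('m, 'n) tensor, 'p) tensor \<Rightarrow> ('m, ('n, 'p) tensor) tensor" where
  "tensor_assoc A M rM N lN rN P lP =
    (let NP = tensor A N rN P lP;
         lNP = (\<lambda>a. tensor_lift NP (\<lambda>n p. pure_tensor A N rN P lP (lN a n) p));
         T = tensor A M rM NP lNP
     in tensor_lift T (\<lambda>X p. tensor_lift T
          (\<lambda>m n. pure_tensor A M rM NP lNP m (pure_tensor A N rN P lP n p)) X))"

abbreviation k_tensor ::
  "('k, 'x) ring_scheme \<Rightarrow> ('k, 'm, 'y) module_scheme \<Rightarrow> ('k, 'n, 'z) module_scheme
    \<Rightarrow> ('m, 'n) tensor ring" where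
  "k_tensor k M N \<equiv> tensor k M (\<lambda>m \<kappa>. \<kappa> \<odot>\<^bsub>M\<^esub> m) N (\<lambda>\<kappa> n. \<kappa> \<odot>\<^bsub>N\<^esub> n)"

abbreviation k_pure_tensor ::
  "('k, 'x) ring_scheme \<Rightarrow> ('k, 'm, 'y) module_scheme \<Rightarrow> ('k, 'n, 'z) module_scheme
    \<Rightarrow> 'm \<Rightarrow> 'n \<Rightarrow> ('m, 'n) tensor" where
  "k_pure_tensor k M N \<equiv> pure_tensor k M (\<lambda>m \<kappa>. \<kappa> \<odot>\<^bsub>M\<^esub> m) N (\<lambda>\<kappa> n. \<kappa> \<odot>\<^bsub>N\<^esub> n)"


section \<open>Corings and comodules\<close>

locale coring = bimodule A C l r
  for A :: "('a, 'x) ring_scheme" and C :: "('c, 'y) ring_scheme"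
  and l :: "'a \<Rightarrow> 'c \<Rightarrow> 'c" and r :: "'c \<Rightarrow> 'a \<Rightarrow> 'c"
  and \<Delta> :: "'c \<Rightarrow> ('c, 'c) tensor" and \<epsilon> :: "'c \<Rightarrow> 'a" +
  assumes comult_closed: "c \<in> carrier C \<Longrightarrow> \<Delta> c \<in> carrier (tensor A C r C l)"
    and comult_add: "\<lbrakk>c \<in> carrier C; d \<in> carrier C\<rbrakk>
      \<Longrightarrow> \<Delta> (c \<oplus>\<^bsub>C\<^esub> d) = \<Delta> c \<oplus>\<^bsub>tensor A C r C l\<^esub> \<Delta> d"
    and comult_lact: "\<lbrakk>a \<in> carrier A; c \<in> carrier C\<rbrakk>
      \<Longrightarrow> \<Delta> (l a c) =
        tensor_lift (tensor A C r C l) (\<lambda>c\<^sub>1 c\<^sub>2. pure_tensor A C r C l (l a c\<^sub>1) c\<^sub>2) (\<Delta> c)"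
    and comult_ract: "\<lbrakk>c \<in> carrier C; a \<in> carrier A\<rbrakk>
      \<Longrightarrow> \<Delta> (r c a) =
        tensor_lift (tensor A C r C l) (\<lambda>c\<^sub>1 c\<^sub>2. pure_tensor A C r C l c\<^sub>1 (r c\<^sub>2 a)) (\<Delta> c)"
    and counit_closed: "c \<in> carrier C \<Longrightarrow> \<epsilon> c \<in> carrier A"
    and counit_add: "\<lbrakk>c \<in> carrier C; d \<in> carrier C\<rbrakk> \<Longrightarrow> \<epsilon> (c \<oplus>\<^bsub>C\<^esub> d) = \<epsilon> c \<oplus>\<^bsub>A\<^esub> \<epsilon> d"
    and counit_lact: "\<lbrakk>a \<in> carrier A; c \<in> carrier C\<rbrakk> \<Longrightarrow> \<epsilon> (l a c) = a \<otimes>\<^bsub>A\<^esub> \<epsilon> c"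
    and counit_ract: "\<lbrakk>c \<in> carrier C; a \<in> carrier A\<rbrakk> \<Longrightarrow> \<epsilon> (r c a) = \<epsilon> c \<otimes>\<^bsub>A\<^esub> a"
    and coassoc: "c \<in> carrier C \<Longrightarrow>
      (let CC = tensor A C r C l;
           lCC = (\<lambda>a. tensor_lift CC (\<lambda>c\<^sub>1 c\<^sub>2. pure_tensor A C r C l (l a c\<^sub>1) c\<^sub>2));
           rCC = (\<lambda>X a. tensor_lift CC (\<lambda>c\<^sub>1 c\<^sub>2. pure_tensor A C r C l c\<^sub>1 (r c\<^sub>2 a)) X)
       in tensor_assoc A C r C l r C l
            (tensor_lift (tensor A CC rCC C l)
              (\<lambda>c\<^sub>1 c\<^sub>2. pure_tensor A CC rCC C l (\<Delta> c\<^sub>1) c\<^sub>2) (\<Delta> c)) =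
          tensor_lift (tensor A C r CC lCC)
            (\<lambda>c\<^sub>1 c\<^sub>2. pure_tensor A C r CC lCC c\<^sub>1 (\<Delta> c\<^sub>2)) (\<Delta> c))"
    and counit_left: "c \<in> carrier C \<Longrightarrow> tensor_lift C (\<lambda>c\<^sub>1 c\<^sub>2. l (\<epsilon> c\<^sub>1) c\<^sub>2) (\<Delta> c) = c"
    and counit_right: "c \<in> carrier C \<Longrightarrow> tensor_lift C (\<lambda>c\<^sub>1 c\<^sub>2. r c\<^sub>1 (\<epsilon> c\<^sub>2)) (\<Delta> c) = c"

locale right_comodule = coring A C l r \<Delta> \<epsilon> + M?: right_module A M rM
  for A :: "('a, 'x) ring_scheme" and C :: "('c, 'y) ring_scheme"
  and l :: "'a \<Rightarrow> 'c \<Rightarrow> 'c" and r :: "'c \<Rightarrow> 'a \<Rightarrow> 'c"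
  and \<Delta> :: "'c \<Rightarrow> ('c, 'c) tensor" and \<epsilon> :: "'c \<Rightarrow> 'a"
  and M :: "('m, 'z) ring_scheme" and rM :: "'m \<Rightarrow> 'a \<Rightarrow> 'm"
  and \<rho> :: "'m \<Rightarrow> ('m, 'c) tensor" +
  assumes coact_closed: "m \<in> carrier M \<Longrightarrow> \<rho> m \<in> carrier (tensor A M rM C l)"
    and coact_add: "\<lbrakk>m \<in> carrier M; n \<in> carrier M\<rbrakk>
      \<Longrightarrow> \<rho> (m \<oplus>\<^bsub>M\<^esub> n) = \<rho> m \<oplus>\<^bsub>tensor A M rM C l\<^esub> \<rho> n"
    and coact_ract: "\<lbrakk>m \<in> carrier M; a \<in> carrier A\<rbrakk>
      \<Longrightarrow> \<rho> (rM m a) =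
        tensor_lift (tensor A M rM C l) (\<lambda>m\<^sub>0 m\<^sub>1. pure_tensor A M rM C l m\<^sub>0 (r m\<^sub>1 a)) (\<rho> m)"
    and coact_coassoc: "m \<in> carrier M \<Longrightarrow>
      (let CC = tensor A C r C l;
           lCC = (\<lambda>a. tensor_lift CC (\<lambda>c\<^sub>1 c\<^sub>2. pure_tensor A C r C l (l a c\<^sub>1) c\<^sub>2));
           MC = tensor A M rM C l;
           rMC = (\<lambda>X a. tensor_lift MC (\<lambda>m\<^sub>0 m\<^sub>1. pure_tensor A M rM C l m\<^sub>0 (r m\<^sub>1 a)) X)
       in tensor_assoc A M rM C l r C l
            (tensor_lift (tensor A MC rMC C l)
              (\<lambda>m\<^sub>0 m\<^sub>1. pure_tensor A MC rMC C l (\<rho> m\<^sub>0) m\<^sub>1) (\<rho> m)) =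
          tensor_lift (tensor A M rM CC lCC)
            (\<lambda>m\<^sub>0 m\<^sub>1. pure_tensor A M rM CC lCC m\<^sub>0 (\<Delta> m\<^sub>1)) (\<rho> m))"
    and coact_counit: "m \<in> carrier M \<Longrightarrow> tensor_lift M (\<lambda>m\<^sub>0 m\<^sub>1. rM m\<^sub>0 (\<epsilon> m\<^sub>1)) (\<rho> m) = m"


section \<open>Hopf algebras\<close>

record ('k, 'h) hopf = "('k, 'h) module" +
  comult :: "'h \<Rightarrow> ('h, 'h) tensor"
  counit :: "'h \<Rightarrow> 'k"
  antipode :: "'h \<Rightarrow> 'h"

text \<open>A \<open>k\<close>-coalgebra is a coring over \<open>k\<close> whose left and right \<open>k\<close>-actions coincide.\<close>

locale bialgebra = k_algebra k H +
  coring k H "\<lambda>\<kappa> h. \<kappa> \<odot>\<^bsub>H\<^esub> h" "\<lambda>h \<kappa>. \<kappa> \<odot>\<^bsub>H\<^esub> h" "comult H" "counit H"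
  for k :: "('k, 'x) ring_scheme" and H :: "('k, 'h, 'y) hopf_scheme" +
  assumes comult_mult: "\<lbrakk>g \<in> carrier H; h \<in> carrier H\<rbrakk> \<Longrightarrow> comult H (g \<otimes>\<^bsub>H\<^esub> h) =
      tensor_lift (k_tensor k H H) (\<lambda>g\<^sub>1 g\<^sub>2. tensor_lift (k_tensor k H H)
        (\<lambda>h\<^sub>1 h\<^sub>2. k_pure_tensor k H H (g\<^sub>1 \<otimes>\<^bsub>H\<^esub> h\<^sub>1) (g\<^sub>2 \<otimes>\<^bsub>H\<^esub> h\<^sub>2)) (comult H h)) (comult H g)"
    and comult_one: "comult H \<one>\<^bsub>H\<^esub> = k_pure_tensor k H H \<one>\<^bsub>H\<^esub> \<one>\<^bsub>H\<^esub>"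
    and counit_mult: "\<lbrakk>g \<in> carrier H; h \<in> carrier H\<rbrakk>
      \<Longrightarrow> counit H (g \<otimes>\<^bsub>H\<^esub> h) = counit H g \<otimes>\<^bsub>k\<^esub> counit H h"
    and counit_one: "counit H \<one>\<^bsub>H\<^esub> = \<one>\<^bsub>k\<^esub>"

locale hopf_algebra = bialgebra k H
  for k :: "('k, 'x) ring_scheme" and H :: "('k, 'h, 'y) hopf_scheme" +
  assumes antipode_closed: "h \<in> carrier H \<Longrightarrow> antipode H h \<in> carrier H"
    and antipode_add: "\<lbrakk>g \<in> carrier H; h \<in> carrier H\<rbrakk>
      \<Longrightarrow> antipode H (g \<oplus>\<^bsub>H\<^esub> h) = antipode H g \<oplus>\<^bsub>H\<^esub> antipode H h"
    and antipode_smult: "\<lbrakk>\<kappa> \<in> carrier k; h \<in> carrier H\<rbrakk>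
      \<Longrightarrow> antipode H (\<kappa> \<odot>\<^bsub>H\<^esub> h) = \<kappa> \<odot>\<^bsub>H\<^esub> antipode H h"
    and antipode_left: "h \<in> carrier H
      \<Longrightarrow> tensor_lift H (\<lambda>h\<^sub>1 h\<^sub>2. antipode H h\<^sub>1 \<otimes>\<^bsub>H\<^esub> h\<^sub>2) (comult H h) = counit H h \<odot>\<^bsub>H\<^esub> \<one>\<^bsub>H\<^esub>"
    and antipode_right: "h \<in> carrier H
      \<Longrightarrow> tensor_lift H (\<lambda>h\<^sub>1 h\<^sub>2. h\<^sub>1 \<otimes>\<^bsub>H\<^esub> antipode H h\<^sub>2) (comult H h) = counit H h \<odot>\<^bsub>H\<^esub> \<one>\<^bsub>H\<^esub>"


section \<open>Module algebras and \<open>H\<close>-equivariant structures\<close>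

locale module_algebra = hopf_algebra k H + A?: k_algebra k A + A?: k_left_module k H A hA
  for k :: "('k, 'x) ring_scheme" and H :: "('k, 'h, 'y) hopf_scheme"
  and A :: "('k, 'a, 'z) module_scheme" and hA :: "'h \<Rightarrow> 'a \<Rightarrow> 'a" +
  assumes hact_mult: "\<lbrakk>h \<in> carrier H; a \<in> carrier A; b \<in> carrier A\<rbrakk>
      \<Longrightarrow> hA h (a \<otimes>\<^bsub>A\<^esub> b) = tensor_lift A (\<lambda>h\<^sub>1 h\<^sub>2. hA h\<^sub>1 a \<otimes>\<^bsub>A\<^esub> hA h\<^sub>2 b) (comult H h)"
    and hact_one: "h \<in> carrier H \<Longrightarrow> hA h \<one>\<^bsub>A\<^esub> = counit H h \<odot>\<^bsub>A\<^esub> \<one>\<^bsub>A\<^esub>"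

locale left_right_module = module_algebra k H R hR + M?: k_left_module k H M hM +
  M?: k_right_module k R M rM
  for k :: "('k, 'x) ring_scheme" and H :: "('k, 'h, 'y) hopf_scheme"
  and R :: "('k, 'r, 'z) module_scheme" and hR :: "'h \<Rightarrow> 'r \<Rightarrow> 'r"
  and M :: "('k, 'm, 'w) module_scheme" and hM :: "'h \<Rightarrow> 'm \<Rightarrow> 'm"
  and rM :: "'m \<Rightarrow> 'r \<Rightarrow> 'm" +
  assumes hact_ract: "\<lbrakk>h \<in> carrier H; m \<in> carrier M; a \<in> carrier R\<rbrakk>
      \<Longrightarrow> hM h (rM m a) = tensor_lift M (\<lambda>h\<^sub>1 h\<^sub>2. rM (hM h\<^sub>1 m) (hR h\<^sub>2 a)) (comult H h)"

locale HA_bimodule = left_right_module k H A hA M hM r + M?: k_bimodule k A M l r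
  for k :: "('k, 'x) ring_scheme" and H :: "('k, 'h, 'y) hopf_scheme"
  and A :: "('k, 'a, 'z) module_scheme" and hA :: "'h \<Rightarrow> 'a \<Rightarrow> 'a"
  and M :: "('k, 'm, 'w) module_scheme" and hM :: "'h \<Rightarrow> 'm \<Rightarrow> 'm"
  and l :: "'a \<Rightarrow> 'm \<Rightarrow> 'm" and r :: "'m \<Rightarrow> 'a \<Rightarrow> 'm" +
  assumes hact_lact: "\<lbrakk>h \<in> carrier H; a \<in> carrier A; m \<in> carrier M\<rbrakk>
      \<Longrightarrow> hM h (l a m) = tensor_lift M (\<lambda>h\<^sub>1 h\<^sub>2. l (hA h\<^sub>1 a) (hM h\<^sub>2 m)) (comult H h)"

text \<open>The diagonal action of \<open>H\<close> on \<open>M \<otimes>\<^sub>A N\<close>.\<close>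

definition diagonal_action ::
  "('k, 'h, 'y) hopf_scheme \<Rightarrow> ('a, 'x) ring_scheme
    \<Rightarrow> ('m, 'z) ring_scheme \<Rightarrow> ('h \<Rightarrow> 'm \<Rightarrow> 'm) \<Rightarrow> ('m \<Rightarrow> 'a \<Rightarrow> 'm)
    \<Rightarrow> ('n, 'w) ring_scheme \<Rightarrow> ('h \<Rightarrow> 'n \<Rightarrow> 'n) \<Rightarrow> ('a \<Rightarrow> 'n \<Rightarrow> 'n)
    \<Rightarrow> 'h \<Rightarrow> ('m, 'n) tensor \<Rightarrow> ('m, 'n) tensor" where
  "diagonal_action H A M hM r N hN l h X =
     tensor_lift (tensor A M r N l) (\<lambda>m n. tensor_lift (tensor A M r N l)
       (\<lambda>h\<^sub>1 h\<^sub>2. pure_tensor A M r N l (hM h\<^sub>1 m) (hN h\<^sub>2 n)) (comult H h)) X"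

locale HA_coring = coring A C l r \<Delta> \<epsilon> + HA_bimodule k H A hA C hC l r
  for k :: "('k, 'x) ring_scheme" and H :: "('k, 'h, 'y) hopf_scheme"
  and A :: "('k, 'a, 'z) module_scheme" and hA :: "'h \<Rightarrow> 'a \<Rightarrow> 'a"
  and C :: "('k, 'c, 'w) module_scheme" and hC :: "'h \<Rightarrow> 'c \<Rightarrow> 'c"
  and l :: "'a \<Rightarrow> 'c \<Rightarrow> 'c" and r :: "'c \<Rightarrow> 'a \<Rightarrow> 'c"
  and \<Delta> :: "'c \<Rightarrow> ('c, 'c) tensor" and \<epsilon> :: "'c \<Rightarrow> 'a" +
  assumes comult_hact: "\<lbrakk>h \<in> carrier H; c \<in> carrier C\<rbrakk>
      \<Longrightarrow> \<Delta> (hC h c) = diagonal_action H A C hC r C hC l h (\<Delta> c)"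
    and counit_hact: "\<lbrakk>h \<in> carrier H; c \<in> carrier C\<rbrakk> \<Longrightarrow> \<epsilon> (hC h c) = hA h (\<epsilon> c)"

text \<open>The objects of the category of right \<open>(H, C)\<close>-comodules.\<close>

locale right_HC_comodule = HA_coring k H A hA C hC l r \<Delta> \<epsilon> +
  M?: right_comodule A C l r \<Delta> \<epsilon> M rM \<rho> + M?: left_right_module k H A hA M hM rM
  for k :: "('k, 'x) ring_scheme" and H :: "('k, 'h, 'y) hopf_scheme"
  and A :: "('k, 'a, 'z) module_scheme" and hA :: "'h \<Rightarrow> 'a \<Rightarrow> 'a"
  and C :: "('k, 'c, 'w) module_scheme" and hC :: "'h \<Rightarrow> 'c \<Rightarrow> 'c"
  and l :: "'a \<Rightarrow> 'c \<Rightarrow> 'c" and r :: "'c \<Rightarrow> 'a \<Rightarrow> 'c"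
  and \<Delta> :: "'c \<Rightarrow> ('c, 'c) tensor" and \<epsilon> :: "'c \<Rightarrow> 'a"
  and M :: "('k, 'm, 'v) module_scheme" and hM :: "'h \<Rightarrow> 'm \<Rightarrow> 'm"
  and rM :: "'m \<Rightarrow> 'a \<Rightarrow> 'm" and \<rho> :: "'m \<Rightarrow> ('m, 'c) tensor" +
  assumes coact_hact: "\<lbrakk>h \<in> carrier H; m \<in> carrier M\<rbrakk>
      \<Longrightarrow> \<rho> (hM h m) = diagonal_action H A M hM rM C hC l h (\<rho> m)"

locale H_grouplike = HA_coring k H A hA C hC l r \<Delta> \<epsilon>
  for k :: "('k, 'x) ring_scheme" and H :: "('k, 'h, 'y) hopf_scheme"
  and A :: "('k, 'a, 'z) module_scheme" and hA :: "'h \<Rightarrow> 'a \<Rightarrow> 'a"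
  and C :: "('k, 'c, 'w) module_scheme" and hC :: "'h \<Rightarrow> 'c \<Rightarrow> 'c"
  and l :: "'a \<Rightarrow> 'c \<Rightarrow> 'c" and r :: "'c \<Rightarrow> 'a \<Rightarrow> 'c"
  and \<Delta> :: "'c \<Rightarrow> ('c, 'c) tensor" and \<epsilon> :: "'c \<Rightarrow> 'a" and x :: 'c +
  assumes grouplike_closed: "x \<in> carrier C"
    and grouplike_comult: "\<Delta> x = pure_tensor A C r C l x x"
    and grouplike_counit: "\<epsilon> x = \<one>\<^bsub>A\<^esub>"
    and grouplike_hact: "h \<in> carrier H \<Longrightarrow> hC h x = counit H h \<odot>\<^bsub>C\<^esub> x"


section \<open>The left dual ring and the smash product\<close>

text \<open>Left \<open>A\<close>-linear maps are taken extensional on \<open>carrier C\<close>, so that equality of elements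
  of the dual is equality of maps on \<open>C\<close>.\<close>

definition left_dual ::
  "('k, 'a, 'z) module_scheme \<Rightarrow> ('k, 'c, 'w) module_scheme \<Rightarrow> ('a \<Rightarrow> 'c \<Rightarrow> 'c) \<Rightarrow> ('c \<Rightarrow> 'a \<Rightarrow> 'c)
    \<Rightarrow> ('c \<Rightarrow> ('c, 'c) tensor) \<Rightarrow> ('c \<Rightarrow> 'a) \<Rightarrow> ('k, 'c \<Rightarrow> 'a) module" where
  "left_dual A C l r \<Delta> \<epsilon> =
    \<lparr>carrier = {f \<in> carrier C \<rightarrow>\<^sub>E carrier A.
        (\<forall>c\<in>carrier C. \<forall>d\<in>carrier C. f (c \<oplus>\<^bsub>C\<^esub> d) = f c \<oplus>\<^bsub>A\<^esub> f d) \<and>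
        (\<forall>a\<in>carrier A. \<forall>c\<in>carrier C. f (l a c) = a \<otimes>\<^bsub>A\<^esub> f c)},
     monoid.mult = (\<lambda>f g. \<lambda>c\<in>carrier C. tensor_lift A (\<lambda>c\<^sub>1 c\<^sub>2. g (r c\<^sub>1 (f c\<^sub>2))) (\<Delta> c)),
     monoid.one = (\<lambda>c\<in>carrier C. \<epsilon> c),
     ring.zero = (\<lambda>c\<in>carrier C. \<zero>\<^bsub>A\<^esub>),
     ring.add = (\<lambda>f g. \<lambda>c\<in>carrier C. f c \<oplus>\<^bsub>A\<^esub> g c),
     smult = (\<lambda>\<kappa> f. \<lambda>c\<in>carrier C. \<kappa> \<odot>\<^bsub>A\<^esub> f c)\<rparr>"

definition left_dual_hact ::
  "('k, 'h, 'y) hopf_scheme \<Rightarrow> ('k, 'a, 'z) module_scheme \<Rightarrow> ('h \<Rightarrow> 'a \<Rightarrow> 'a)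
    \<Rightarrow> ('k, 'c, 'w) module_scheme \<Rightarrow> ('h \<Rightarrow> 'c \<Rightarrow> 'c) \<Rightarrow> 'h \<Rightarrow> ('c \<Rightarrow> 'a) \<Rightarrow> 'c \<Rightarrow> 'a" where
  "left_dual_hact H A hA C hC h f =
    (\<lambda>c\<in>carrier C. tensor_lift A
      (\<lambda>h\<^sub>1 h\<^sub>2. hA h\<^sub>2 (f (hC (inv_into (carrier H) (antipode H) h\<^sub>1) c))) (comult H h))"

text \<open>The algebra \<open>R\<^sup>o\<^sup>p # H\<close>, with product \<open>(r # h) (r' # h') = ((h\<^sub>2.r') r) # (h\<^sub>1 h')\<close>.\<close>

definition op_smash ::
  "('k, 'x) ring_scheme \<Rightarrow> ('k, 'h, 'y) hopf_scheme \<Rightarrow> ('k, 'r, 'z) module_scheme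
    \<Rightarrow> ('h \<Rightarrow> 'r \<Rightarrow> 'r) \<Rightarrow> ('k, ('r, 'h) tensor) module" where
  "op_smash k H R hR =
    (let T = k_tensor k R H; t = k_pure_tensor k R H
     in \<lparr>carrier = carrier T,
         monoid.mult = (\<lambda>X Y. tensor_lift T (\<lambda>r h. tensor_lift T (\<lambda>r' h'. tensor_lift T
           (\<lambda>h\<^sub>1 h\<^sub>2. t (hR h\<^sub>2 r' \<otimes>\<^bsub>R\<^esub> r) (h\<^sub>1 \<otimes>\<^bsub>H\<^esub> h')) (comult H h)) Y) X),
         monoid.one = t \<one>\<^bsub>R\<^esub> \<one>\<^bsub>H\<^esub>,
         ring.zero = \<zero>\<^bsub>T\<^esub>,
         ring.add = ring.add T,
         smult = (\<lambda>\<kappa>. tensor_lift T (\<lambda>r h. t (\<kappa> \<odot>\<^bsub>R\<^esub> r) h))\<rparr>)"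

text \<open>The left action \<open>(r # h) m = (h m) r\<close> of \<open>R\<^sup>o\<^sup>p # H\<close> on a left-right \<open>(H, R)\<close>-module.\<close>

definition op_smash_action ::
  "('m, 'w) ring_scheme \<Rightarrow> ('h \<Rightarrow> 'm \<Rightarrow> 'm) \<Rightarrow> ('m \<Rightarrow> 'r \<Rightarrow> 'm) \<Rightarrow> ('r, 'h) tensor \<Rightarrow> 'm \<Rightarrow> 'm" where
  "op_smash_action M hM rM X m = tensor_lift M (\<lambda>r h. rM (hM h m) r) X"

end

(* Every tensor is a finite sum of pure tensors, and a balanced map evaluated on a tensor is the
   corresponding finite sum; this turns Sweedler notation into nested finite sums, in which
   coassociativity may be applied to any map that is linear in each argument.

   With T the inverse antipode, h_2 T(h_1) = eps(h), so a family of maps F(h) on an H-module is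
   determined by the sums F(h_2)(h_1 v). The action of H on the left dual is characterised by
   (h_2 f)(h_1 c) = h.(f(c)), and cancellation yields that h f is A-linear and that
   h(f # g) = (h_1 f) # (h_2 g). Since x is H-invariant, h(x a) = x (h a), so the same identity
   for c = x a gives the compatibility of the right action a.f = f(x a) with H. The element 1 of A
   is a generator, because eps(-) a is left A-linear and takes the value a at x. *)

theory Submission
  imports Defs
begin

section \<open>Tensors as finite sums of pure tensors\<close>

text \<open>\<open>tensor_lift\<close> extracts the unique value on a coset, so it says nothing
  until the map is known to be balanced. \<open>tsum\<close> evaluates any map on one fixed list of
  pairs per coset: congruence, exchange of sums and additive maps pass through it freely, and
  balancedness enters only when representatives are compared. The price is that each axiom with
  nested lifts must be translated once, from the innermost lift outwards.

  Coassociativity in this form takes linearity in three slots and values in a k-module. Tensor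
  products are bare abelian groups here, so R \<otimes> H and M \<otimes> C receive scalars before
  Sweedler computations take place in them.

  A direct treatment of the dual action would use \<Delta>(T(h)) = T(h_2) \<otimes> T(h_1). With
  cancellation, what is used of T beyond linearity and T(1) = 1 is anti-multiplicativity: it gives
  the identities for h_2 T(h_1) and T(h_2) h_1 and makes the action on the dual associative. It is
  not an axiom of \<open>hopf_algebra\<close>; it is derived for S by uniqueness of convolution
  inverses and passed on to T.\<close>

definition lsum :: "('g, 'x) ring_scheme \<Rightarrow> ('p \<Rightarrow> 'g) \<Rightarrow> 'p list \<Rightarrow> 'g" where
  "lsum G f xs = foldr (\<lambda>p s. f p \<oplus>\<^bsub>G\<^esub> s) xs \<zero>\<^bsub>G\<^esub>"

lemma lsum_Nil [simp]: "lsum G f [] = \<zero>\<^bsub>G\<^esub>"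
  and lsum_Cons [simp]: "lsum G f (p # xs) = f p \<oplus>\<^bsub>G\<^esub> lsum G f xs"
  by (simp_all add: lsum_def)

lemma lsum_cong: "(\<And>p. p \<in> set xs \<Longrightarrow> f p = g p) \<Longrightarrow> lsum G f xs = lsum G g xs"
  by (induction xs) auto

text \<open>Only the additive fields are compared, since tensor products are \<open>ring\<close>
  records whose multiplication is undefined.\<close>

definition add_hom :: "('g, 'x) ring_scheme \<Rightarrow> ('h, 'y) ring_scheme \<Rightarrow> ('g \<Rightarrow> 'h) \<Rightarrow> bool" where
  "add_hom G H \<phi> \<longleftrightarrow> (\<forall>x\<in>carrier G. \<phi> x \<in> carrier H) \<and>
     (\<forall>x\<in>carrier G. \<forall>y\<in>carrier G. \<phi> (x \<oplus>\<^bsub>G\<^esub> y) = \<phi> x \<oplus>\<^bsub>H\<^esub> \<phi> y)"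

lemma add_homI:
  assumes "\<And>x. x \<in> carrier G \<Longrightarrow> \<phi> x \<in> carrier H"
    and "\<And>x y. \<lbrakk>x \<in> carrier G; y \<in> carrier G\<rbrakk> \<Longrightarrow> \<phi> (x \<oplus>\<^bsub>G\<^esub> y) = \<phi> x \<oplus>\<^bsub>H\<^esub> \<phi> y"
  shows "add_hom G H \<phi>"
  using assms by (simp add: add_hom_def)

lemma add_hom_closed: "\<lbrakk>add_hom G H \<phi>; x \<in> carrier G\<rbrakk> \<Longrightarrow> \<phi> x \<in> carrier H"
  and add_hom_add: "\<lbrakk>add_hom G H \<phi>; x \<in> carrier G; y \<in> carrier G\<rbrakk> \<Longrightarrow> \<phi> (x \<oplus>\<^bsub>G\<^esub> y) = \<phi> x \<oplus>\<^bsub>H\<^esub> \<phi> y"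
  by (simp_all add: add_hom_def)

lemma add_hom_zero:
  assumes "abelian_group G" "abelian_group H" "add_hom G H \<phi>"
  shows "\<phi> \<zero>\<^bsub>G\<^esub> = \<zero>\<^bsub>H\<^esub>"
proof -
  interpret G: abelian_group G by fact
  interpret H: abelian_group H by fact
  have "\<phi> \<zero>\<^bsub>G\<^esub> \<oplus>\<^bsub>H\<^esub> \<phi> \<zero>\<^bsub>G\<^esub> = \<phi> \<zero>\<^bsub>G\<^esub>"
    using add_hom_add[OF assms(3), of "\<zero>\<^bsub>G\<^esub>" "\<zero>\<^bsub>G\<^esub>"] by simp
  then show ?thesis
    using add_hom_closed[OF assms(3) G.zero_closed] by (metis H.add.r_cancel_one')
qed

text \<open>Both halves are proved together because the inductive step applies additivity of
  \<open>\<phi>\<close> to the partial sum, which has to lie in \<open>carrier G\<close>.\<close>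

lemma lsum_hom:
  assumes "abelian_group G" "abelian_group H" "add_hom G H \<phi>"
    and "\<And>p. p \<in> set xs \<Longrightarrow> f p \<in> carrier G"
  shows "\<phi> (lsum G f xs) = lsum H (\<lambda>p. \<phi> (f p)) xs \<and> lsum G f xs \<in> carrier G"
proof -
  interpret G: abelian_group G by fact
  show ?thesis using assms(4)
    by (induction xs) (simp_all add: add_hom_zero[OF assms(1-3)] add_hom_add[OF assms(3)])
qed

context abelian_group
begin

lemma lsum_closed: "(\<And>p. p \<in> set xs \<Longrightarrow> f p \<in> carrier G) \<Longrightarrow> lsum G f xs \<in> carrier G"
  by (induction xs) auto

lemma lsum_zero: "lsum G (\<lambda>p. \<zero>) xs = \<zero>"
  by (induction xs) auto

lemma lsum_add:
  assumes "\<And>p. p \<in> set xs \<Longrightarrow> f p \<in> carrier G" "\<And>p. p \<in> set xs \<Longrightarrow> g p \<in> carrier G"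
  shows "lsum G (\<lambda>p. f p \<oplus> g p) xs = lsum G f xs \<oplus> lsum G g xs"
  using assms
proof (induction xs)
  case (Cons p xs)
  then have "lsum G f xs \<in> carrier G" "lsum G g xs \<in> carrier G"
    by (auto intro: lsum_closed)
  with Cons show ?case by (simp add: a_ac)
qed simp

lemma lsum_swap:
  assumes "\<And>p q. \<lbrakk>p \<in> set xs; q \<in> set ys\<rbrakk> \<Longrightarrow> f p q \<in> carrier G"
  shows "lsum G (\<lambda>p. lsum G (f p) ys) xs = lsum G (\<lambda>q. lsum G (\<lambda>p. f p q) xs) ys"
  using assms
proof (induction xs)
  case Nil
  then show ?case by (simp add: lsum_zero)
next
  case (Cons p xs)
  then have "lsum G (\<lambda>p. lsum G (f p) ys) xs = lsum G (\<lambda>q. lsum G (\<lambda>p. f p q) xs) ys" by simp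
  then show ?case using Cons.prems
    by (simp add: lsum_add lsum_closed)
qed

end

text \<open>Every nonempty coset contains formal sums without cancellation; \<open>trep\<close> chooses one, so that
  an element of a tensor product becomes a list of pure tensors.\<close>

definition trep :: "('m, 'n) tensor \<Rightarrow> ('m \<times> 'n) list" where
  "trep X = (SOME xs. (\<Sum>p\<leftarrow>xs. frag_of p) \<in> X)"

definition tsum ::
  "('g, 'x) ring_scheme \<Rightarrow> ('m \<Rightarrow> 'n \<Rightarrow> 'g) \<Rightarrow> ('m, 'n) tensor \<Rightarrow> 'g" where
  "tsum G f X = lsum G (\<lambda>p. f (fst p) (snd p)) (trep X)"

text \<open>The coefficients of a sum of generators are nonnegative, so no list entry can cancel.
  This locates the entries of a list in the carriers once the support of its sum is known.\<close>

lemma keys_sum_list_frag_of: "Poly_Mapping.keys (\<Sum>p\<leftarrow>xs. frag_of p) = set xs"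
proof -
  have nonneg: "0 \<le> Poly_Mapping.lookup (\<Sum>p\<leftarrow>xs. frag_of p) q" for q :: 'a and xs
    by (induction xs) (simp_all add: lookup_add)
  have "Poly_Mapping.lookup (\<Sum>p\<leftarrow>xs. frag_of p) q \<noteq> 0 \<longleftrightarrow> q \<in> set xs" for q :: 'a and xs
  proof (induction xs)
    case (Cons p xs)
    then show ?case using nonneg[where xs=xs and q=q] by (auto simp: lookup_add lookup_single when_def)
  qed simp
  then show ?thesis by (auto simp: in_keys_iff)
qed

text \<open>Closure of the two actions is the whole interface, so that an iterated tensor product
  can be a factor as soon as its induced action is known to be closed; the sublocales
  \<open>L\<close> and \<open>R\<close> of \<open>tensor_triple\<close> are of this kind.\<close>

locale tensor_pair = M?: abelian_group M + N?: abelian_group N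
  for A :: "('a, 'x) ring_scheme" and M :: "('m, 'y) ring_scheme" and r :: "'m \<Rightarrow> 'a \<Rightarrow> 'm"
  and N :: "('n, 'z) ring_scheme" and l :: "'a \<Rightarrow> 'n \<Rightarrow> 'n" +
  assumes r_closed: "\<lbrakk>m \<in> carrier M; a \<in> carrier A\<rbrakk> \<Longrightarrow> r m a \<in> carrier M"
    and l_closed: "\<lbrakk>a \<in> carrier A; n \<in> carrier N\<rbrakk> \<Longrightarrow> l a n \<in> carrier N"
begin

abbreviation F where "F \<equiv> free_Abelian_group (carrier M \<times> carrier N)"
abbreviation K where "K \<equiv> tensor_kernel A M r N l"
abbreviation T where "T \<equiv> tensor A M r N l"
abbreviation pure where "pure \<equiv> pure_tensor A M r N l"

lemma relations_carrier: "tensor_relations A M r N l \<subseteq> carrier F"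
  by (auto simp: tensor_relations_def r_closed l_closed dest!: subsetD[OF keys_diff])

lemma kernel_normal: "K \<lhd> F"
  unfolding tensor_kernel_def
  by (simp add: comm_group.subgroup_imp_normal abelian_free_Abelian_group
      group.generate_is_subgroup relations_carrier[simplified])

lemma kernel_subgroup: "subgroup K F"
  using kernel_normal by (simp add: normal_def)

lemma kernel_add: "\<lbrakk>p \<in> K; q \<in> K\<rbrakk> \<Longrightarrow> p + q \<in> K"
  using subgroup.m_closed[OF kernel_subgroup] by simp

lemma kernel_carrier: "p \<in> K \<Longrightarrow> Poly_Mapping.keys p \<subseteq> carrier M \<times> carrier N"
  using subgroup.mem_carrier[OF kernel_subgroup] by simp

lemma kernel_uminus: "p \<in> K \<Longrightarrow> - p \<in> K"
  using subgroup.m_inv_closed[OF kernel_subgroup, of p] kernel_carrier[of p] by simp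

lemma kernel_diff: "\<lbrakk>p \<in> K; q \<in> K\<rbrakk> \<Longrightarrow> p - q \<in> K"
  using kernel_add[of p "- q"] kernel_uminus[of q] by simp

lemma kernel_zero: "0 \<in> K"
  using subgroup.one_closed[OF kernel_subgroup] by simp

lemma mem_coset_iff: "q \<in> K #>\<^bsub>F\<^esub> p \<longleftrightarrow> q - p \<in> K"
  by (auto simp: r_coset_def) (metis diff_add_cancel)

lemma coset_eq_iff:
  assumes "p \<in> carrier F" "q \<in> carrier F"
  shows "K #>\<^bsub>F\<^esub> p = K #>\<^bsub>F\<^esub> q \<longleftrightarrow> p - q \<in> K"
proof
  assume "K #>\<^bsub>F\<^esub> p = K #>\<^bsub>F\<^esub> q"
  then show "p - q \<in> K" using mem_coset_iff[of p q] mem_coset_iff[of p p] kernel_zero by simp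
next
  assume "p - q \<in> K"
  then have "p \<in> K #>\<^bsub>F\<^esub> q" by (simp add: mem_coset_iff)
  then show "K #>\<^bsub>F\<^esub> p = K #>\<^bsub>F\<^esub> q"
    using group.repr_independence[OF group_free_Abelian_group _ assms(2) kernel_subgroup] by simp
qed

lemma tensor_carrier: "carrier T = (\<lambda>p. K #>\<^bsub>F\<^esub> p) ` carrier F"
  by (simp add: tensor_def Let_def carrier_FactGroup)

lemma tensor_add:
  "\<lbrakk>p \<in> carrier F; q \<in> carrier F\<rbrakk> \<Longrightarrow> (K #>\<^bsub>F\<^esub> p) \<oplus>\<^bsub>T\<^esub> (K #>\<^bsub>F\<^esub> q) = K #>\<^bsub>F\<^esub> (p + q)"
  using normal.rcos_sum[OF kernel_normal, of p q] by (simp add: tensor_def Let_def)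

lemma tensor_zero: "\<zero>\<^bsub>T\<^esub> = K"
  by (simp add: tensor_def Let_def)

lemma tensor_group: "abelian_group T"
proof -
  interpret Q: comm_group "F Mod K"
    using comm_group.abelian_FactGroup[OF abelian_free_Abelian_group kernel_subgroup] .
  have "add_monoid T = F Mod K"
    by (simp add: tensor_def Let_def FactGroup_def)
  then show ?thesis
    by (intro abelian_group.intro abelian_monoid.intro abelian_group_axioms.intro)
      (simp_all add: Q.comm_monoid_axioms Q.comm_group_axioms)
qed

lemma pure_closed: "\<lbrakk>m \<in> carrier M; n \<in> carrier N\<rbrakk> \<Longrightarrow> pure m n \<in> carrier T"
  by (auto simp: pure_tensor_def tensor_carrier)

lemma relation_mem: "p \<in> tensor_relations A M r N l \<Longrightarrow> p \<in> K"
  by (simp add: tensor_kernel_def generate.incl)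

lemma pure_add_l:
  assumes "m \<in> carrier M" "m' \<in> carrier M" "n \<in> carrier N"
  shows "pure (m \<oplus>\<^bsub>M\<^esub> m') n = pure m n \<oplus>\<^bsub>T\<^esub> pure m' n"
proof -
  have "frag_of (m \<oplus>\<^bsub>M\<^esub> m', n) - frag_of (m, n) - frag_of (m', n) \<in> K"
    by (rule relation_mem) (use assms in \<open>auto simp: tensor_relations_def\<close>)
  moreover have "Poly_Mapping.keys (frag_of (m, n) + frag_of (m', n)) \<subseteq> carrier M \<times> carrier N"
    using keys_add[of "frag_of (m, n)" "frag_of (m', n)"] assms by auto
  ultimately show ?thesis
    using assms by (simp add: pure_tensor_def tensor_add coset_eq_iff diff_diff_eq)
qed

lemma pure_add_r:
  assumes "m \<in> carrier M" "n \<in> carrier N" "n' \<in> carrier N"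
  shows "pure m (n \<oplus>\<^bsub>N\<^esub> n') = pure m n \<oplus>\<^bsub>T\<^esub> pure m n'"
proof -
  have "frag_of (m, n \<oplus>\<^bsub>N\<^esub> n') - frag_of (m, n) - frag_of (m, n') \<in> K"
    by (rule relation_mem) (use assms in \<open>auto simp: tensor_relations_def\<close>)
  moreover have "Poly_Mapping.keys (frag_of (m, n) + frag_of (m, n')) \<subseteq> carrier M \<times> carrier N"
    using keys_add[of "frag_of (m, n)" "frag_of (m, n')"] assms by auto
  ultimately show ?thesis
    using assms by (simp add: pure_tensor_def tensor_add coset_eq_iff diff_diff_eq)
qed

lemma pure_balanced:
  assumes "m \<in> carrier M" "a \<in> carrier A" "n \<in> carrier N"
  shows "pure (r m a) n = pure m (l a n)"
proof -
  have "frag_of (r m a, n) - frag_of (m, l a n) \<in> K"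
    by (rule relation_mem) (use assms in \<open>auto simp: tensor_relations_def\<close>)
  then show ?thesis
    using assms by (simp add: pure_tensor_def coset_eq_iff r_closed l_closed)
qed

text \<open>Additivity in the first slot with both arguments zero puts (0, n) into the kernel. Hence
  (-m, n) is the negative of (m, n) modulo \<open>K\<close>, and signs can be moved into the first
  entry of a pair.\<close>

lemma frag_of_minus_mem:
  assumes "m \<in> carrier M" "n \<in> carrier N"
  shows "frag_of (\<ominus>\<^bsub>M\<^esub> m, n) + frag_of (m, n) \<in> K"
proof -
  have rel: "frag_of (m \<oplus>\<^bsub>M\<^esub> m', n) - frag_of (m, n) - frag_of (m', n) \<in> K"
    if "m \<in> carrier M" "m' \<in> carrier M" for m m'
    by (rule relation_mem) (use assms that in \<open>auto simp: tensor_relations_def\<close>)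
  have "- frag_of (\<zero>\<^bsub>M\<^esub>, n) \<in> K" using rel[of "\<zero>\<^bsub>M\<^esub>" "\<zero>\<^bsub>M\<^esub>"] by simp
  from kernel_add[OF rel[of "\<ominus>\<^bsub>M\<^esub> m" m] this]
  have "- frag_of (\<ominus>\<^bsub>M\<^esub> m, n) - frag_of (m, n) \<in> K"
    using assms by (simp add: M.l_neg)
  from kernel_uminus[OF this] show ?thesis by (simp add: add.commute)
qed

text \<open>Induction over formal differences: a subtracted list of generators becomes an appended
  one by negating the first entries.\<close>

lemma positive_representative:
  assumes "Poly_Mapping.keys p \<subseteq> carrier M \<times> carrier N"
  shows "\<exists>xs. set xs \<subseteq> carrier M \<times> carrier N \<and> (\<Sum>q\<leftarrow>xs. frag_of q) - p \<in> K"
  using assms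
proof (induction p rule: frag_induction)
  case zero
  show ?case by (rule exI[of _ "[]"]) (simp add: kernel_zero)
next
  case (diff p q)
  then obtain xs ys where xs: "set xs \<subseteq> carrier M \<times> carrier N" "(\<Sum>q\<leftarrow>xs. frag_of q) - p \<in> K"
    and ys: "set ys \<subseteq> carrier M \<times> carrier N" "(\<Sum>q\<leftarrow>ys. frag_of q) - q \<in> K" by blast
  \<comment> \<open>Modulo \<open>K\<close>, the list \<open>neg ys\<close> represents the negative
    of the sum over \<open>ys\<close>.\<close>
  define neg where "neg = map (\<lambda>(m, n). (\<ominus>\<^bsub>M\<^esub> m, n :: 'n))"
  have neg: "set (neg ys) \<subseteq> carrier M \<times> carrier N"
    "(\<Sum>q\<leftarrow>neg ys. frag_of q) + (\<Sum>q\<leftarrow>ys. frag_of q) \<in> K"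
    using ys(1)
  proof (induction ys)
    case (Cons y ys)
    {
      case 1
      with Cons show ?case by (auto simp: neg_def)
    next
      case 2
      then have "frag_of (\<ominus>\<^bsub>M\<^esub> fst y, snd y) + frag_of y \<in> K"
        using frag_of_minus_mem[of "fst y" "snd y"] by (cases y) auto
      from kernel_add[OF this Cons.IH(2)] 2 show ?case
        by (simp add: neg_def case_prod_beta algebra_simps)
    }
  qed (simp_all add: neg_def kernel_zero)
  from kernel_add[OF xs(2) kernel_diff[OF neg(2) ys(2)]]
  have "(\<Sum>q\<leftarrow>xs @ neg ys. frag_of q) - (p - q) \<in> K"
    by (simp add: algebra_simps)
  with xs(1) neg(1) show ?case
    by (intro exI[of _ "xs @ neg ys"]) auto
next
  case (one q)
  then show ?case
    by (intro exI[of _ "[q]"]) (simp add: kernel_zero)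
qed

text \<open>\<open>trep\<close> chooses among all lists, with no condition on the entries. Every
  member of the coset has its support in the product of the carriers, and
  \<open>keys_sum_list_frag_of\<close> transfers this to the chosen list.\<close>

lemma trep_coset:
  assumes "X \<in> carrier T"
  shows "set (trep X) \<subseteq> carrier M \<times> carrier N" "X = K #>\<^bsub>F\<^esub> (\<Sum>p\<leftarrow>trep X. frag_of p)"
proof -
  obtain p where p: "Poly_Mapping.keys p \<subseteq> carrier M \<times> carrier N" "X = K #>\<^bsub>F\<^esub> p"
    using assms by (auto simp: tensor_carrier)
  obtain xs where "(\<Sum>q\<leftarrow>xs. frag_of q) \<in> X"
    using positive_representative[OF p(1)] p(2) mem_coset_iff by blast
  then have mem: "(\<Sum>q\<leftarrow>trep X. frag_of q) - p \<in> K"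
    unfolding trep_def p(2) mem_coset_iff by (rule someI)
  have "Poly_Mapping.keys ((\<Sum>q\<leftarrow>trep X. frag_of q) - p + p) \<subseteq> carrier M \<times> carrier N"
    using keys_add[of "(\<Sum>q\<leftarrow>trep X. frag_of q) - p" p] kernel_carrier[OF mem] p(1) by blast
  then show "set (trep X) \<subseteq> carrier M \<times> carrier N"
    by (simp add: keys_sum_list_frag_of)
  then show "X = K #>\<^bsub>F\<^esub> (\<Sum>p\<leftarrow>trep X. frag_of p)"
    using kernel_uminus[OF mem] p coset_eq_iff[of p "\<Sum>q\<leftarrow>trep X. frag_of q"]
    by (simp add: keys_sum_list_frag_of)
qed

lemma trep_mem: "\<lbrakk>X \<in> carrier T; p \<in> set (trep X)\<rbrakk> \<Longrightarrow> fst p \<in> carrier M \<and> snd p \<in> carrier N"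
  using trep_coset(1) by fastforce

lemma tsum_pure:
  assumes "X \<in> carrier T"
  shows "tsum T pure X = X"
proof -
  interpret T: abelian_group T by (rule tensor_group)
  have "lsum T (\<lambda>p. pure (fst p) (snd p)) xs = K #>\<^bsub>F\<^esub> (\<Sum>p\<leftarrow>xs. frag_of p)"
    if "set xs \<subseteq> carrier M \<times> carrier N" for xs
    using that
  proof (induction xs)
    case Nil
    then show ?case
      using subgroup.rcos_const[OF kernel_subgroup group_free_Abelian_group kernel_zero]
      by (simp add: tensor_zero)
  next
    case (Cons p xs)
    then show ?case
      by (auto simp: pure_tensor_def tensor_add keys_sum_list_frag_of)
  qed
  then show ?thesis
    using trep_coset[OF assms] by (simp add: tsum_def)
qed

lemma tsum_closed:
  assumes "abelian_group G" "X \<in> carrier T"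
    "\<And>m n. \<lbrakk>m \<in> carrier M; n \<in> carrier N\<rbrakk> \<Longrightarrow> f m n \<in> carrier G"
  shows "tsum G f X \<in> carrier G"
  unfolding tsum_def using assms trep_mem by (intro abelian_group.lsum_closed) auto

lemma tsum_cong:
  assumes "X \<in> carrier T" "\<And>m n. \<lbrakk>m \<in> carrier M; n \<in> carrier N\<rbrakk> \<Longrightarrow> f m n = g m n"
  shows "tsum G f X = tsum G g X"
  unfolding tsum_def using assms trep_mem by (intro lsum_cong) auto

lemma tsum_hom:
  assumes "abelian_group G" "abelian_group H" "add_hom G H \<phi>" "X \<in> carrier T"
    "\<And>m n. \<lbrakk>m \<in> carrier M; n \<in> carrier N\<rbrakk> \<Longrightarrow> f m n \<in> carrier G"
  shows "\<phi> (tsum G f X) = tsum H (\<lambda>m n. \<phi> (f m n)) X"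
  unfolding tsum_def using assms trep_mem by (intro lsum_hom[THEN conjunct1]) auto

lemma tsum_add:
  assumes "abelian_group G" "X \<in> carrier T"
    "\<And>m n. \<lbrakk>m \<in> carrier M; n \<in> carrier N\<rbrakk> \<Longrightarrow> f m n \<in> carrier G"
    "\<And>m n. \<lbrakk>m \<in> carrier M; n \<in> carrier N\<rbrakk> \<Longrightarrow> g m n \<in> carrier G"
  shows "tsum G (\<lambda>m n. f m n \<oplus>\<^bsub>G\<^esub> g m n) X = tsum G f X \<oplus>\<^bsub>G\<^esub> tsum G g X"
  unfolding tsum_def using assms trep_mem by (intro abelian_group.lsum_add) auto

definition balanced :: "('g, 'v) ring_scheme \<Rightarrow> ('m \<Rightarrow> 'n \<Rightarrow> 'g) \<Rightarrow> bool" where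
  "balanced G f \<longleftrightarrow> (\<forall>m\<in>carrier M. add_hom N G (f m)) \<and>
     (\<forall>n\<in>carrier N. add_hom M G (\<lambda>m. f m n)) \<and>
     (\<forall>m\<in>carrier M. \<forall>a\<in>carrier A. \<forall>n\<in>carrier N. f (r m a) n = f m (l a n))"

lemma balancedI:
  assumes "\<And>m n. \<lbrakk>m \<in> carrier M; n \<in> carrier N\<rbrakk> \<Longrightarrow> f m n \<in> carrier G"
    "\<And>m m' n. \<lbrakk>m \<in> carrier M; m' \<in> carrier M; n \<in> carrier N\<rbrakk>
      \<Longrightarrow> f (m \<oplus>\<^bsub>M\<^esub> m') n = f m n \<oplus>\<^bsub>G\<^esub> f m' n"
    "\<And>m n n'. \<lbrakk>m \<in> carrier M; n \<in> carrier N; n' \<in> carrier N\<rbrakk>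
      \<Longrightarrow> f m (n \<oplus>\<^bsub>N\<^esub> n') = f m n \<oplus>\<^bsub>G\<^esub> f m n'"
    "\<And>m a n. \<lbrakk>m \<in> carrier M; a \<in> carrier A; n \<in> carrier N\<rbrakk> \<Longrightarrow> f (r m a) n = f m (l a n)"
  shows "balanced G f"
  using assms by (simp add: balanced_def add_hom_def)

lemma balancedD:
  assumes "balanced G f"
  shows "\<lbrakk>m \<in> carrier M; n \<in> carrier N\<rbrakk> \<Longrightarrow> f m n \<in> carrier G"
    and "\<lbrakk>m \<in> carrier M; m' \<in> carrier M; n \<in> carrier N\<rbrakk>
      \<Longrightarrow> f (m \<oplus>\<^bsub>M\<^esub> m') n = f m n \<oplus>\<^bsub>G\<^esub> f m' n"
    and "\<lbrakk>m \<in> carrier M; n \<in> carrier N; n' \<in> carrier N\<rbrakk>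
      \<Longrightarrow> f m (n \<oplus>\<^bsub>N\<^esub> n') = f m n \<oplus>\<^bsub>G\<^esub> f m n'"
    and "\<lbrakk>m \<in> carrier M; a \<in> carrier A; n \<in> carrier N\<rbrakk> \<Longrightarrow> f (r m a) n = f m (l a n)"
  using assms by (simp_all add: balanced_def add_hom_def)

end

text \<open>The additive extension of \<open>f\<close> to formal integer combinations;
  \<open>tensor_lift\<close> takes the common value of this map on a coset.\<close>

definition frag_sum :: "('g, 'x) ring_scheme \<Rightarrow> ('m \<Rightarrow> 'n \<Rightarrow> 'g) \<Rightarrow> ('m \<times> 'n \<Rightarrow>\<^sub>0 int) \<Rightarrow> 'g" where
  "frag_sum G f p = (\<Oplus>\<^bsub>G\<^esub>q\<in>Poly_Mapping.keys p. [Poly_Mapping.lookup p q] \<cdot>\<^bsub>G\<^esub> f (fst q) (snd q))"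

context abelian_group
begin

text \<open>Cancellation can shrink the support of p + p', so additivity is checked over a common
  finite index set, on which the extra terms have coefficient zero.\<close>

lemma frag_sum_superset:
  assumes "finite B" "Poly_Mapping.keys p \<subseteq> B" "\<And>q. q \<in> B \<Longrightarrow> f (fst q) (snd q) \<in> carrier G"
  shows "frag_sum G f p = (\<Oplus>q\<in>B. [Poly_Mapping.lookup p q] \<cdot> f (fst q) (snd q))"
  unfolding frag_sum_def using assms
  by (intro add.finprod_mono_neutral_cong_left) (auto simp: in_keys_iff intro!: add.int_pow_closed, simp add: add_pow_def)

lemma frag_sum_closed:
  assumes "\<And>q. q \<in> Poly_Mapping.keys p \<Longrightarrow> f (fst q) (snd q) \<in> carrier G"
  shows "frag_sum G f p \<in> carrier G"
  unfolding frag_sum_def using assms by (intro finsum_closed) auto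

lemma frag_sum_add:
  assumes "\<And>q. q \<in> Poly_Mapping.keys p \<union> Poly_Mapping.keys p' \<Longrightarrow> f (fst q) (snd q) \<in> carrier G"
  shows "frag_sum G f (p + p') = frag_sum G f p \<oplus> frag_sum G f p'"
proof -
  define B where "B = Poly_Mapping.keys p \<union> Poly_Mapping.keys p'"
  have B: "finite B" "Poly_Mapping.keys p \<subseteq> B" "Poly_Mapping.keys p' \<subseteq> B"
    "Poly_Mapping.keys (p + p') \<subseteq> B"
    using keys_add[of p p'] by (auto simp: B_def)
  have fB: "\<And>q. q \<in> B \<Longrightarrow> f (fst q) (snd q) \<in> carrier G" using assms by (simp add: B_def)
  have super: "frag_sum G f q = (\<Oplus>b\<in>B. [Poly_Mapping.lookup q b] \<cdot> f (fst b) (snd b))"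
    if "Poly_Mapping.keys q \<subseteq> B" for q
    using frag_sum_superset[OF B(1) that, of f] fB by blast
  have "frag_sum G f (p + p') = (\<Oplus>b\<in>B. [Poly_Mapping.lookup p b] \<cdot> f (fst b) (snd b)
      \<oplus> [Poly_Mapping.lookup p' b] \<cdot> f (fst b) (snd b))"
    unfolding super[OF B(4)] by (rule finsum_cong') (simp_all add: lookup_add add.int_pow_mult fB)
  also have "\<dots> = frag_sum G f p \<oplus> frag_sum G f p'"
    unfolding super[OF B(2)] super[OF B(3)] by (rule finsum_addf) (simp_all add: fB Pi_iff split_def)
  finally show ?thesis .
qed

lemma frag_sum_uminus:
  assumes "\<And>q. q \<in> Poly_Mapping.keys p \<Longrightarrow> f (fst q) (snd q) \<in> carrier G"
  shows "frag_sum G f (- p) = \<ominus> frag_sum G f p"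
proof -
  have "frag_sum G f (- p) \<oplus> frag_sum G f p = frag_sum G f (- p + p)"
    using assms by (subst frag_sum_add) (auto simp: keys_minus)
  also have "\<dots> = \<zero>" by (simp add: frag_sum_def)
  finally show ?thesis
    using assms by (intro minus_equality[symmetric]) (auto intro!: frag_sum_closed simp: keys_minus)
qed

lemma frag_sum_frag_of: "f (fst q) (snd q) \<in> carrier G \<Longrightarrow> frag_sum G f (frag_of q) = f (fst q) (snd q)"
  unfolding frag_sum_def by (simp add: lookup_single finsum_singleton)

lemma frag_sum_sum_list:
  assumes "\<And>q. q \<in> set xs \<Longrightarrow> f (fst q) (snd q) \<in> carrier G"
  shows "frag_sum G f (\<Sum>p\<leftarrow>xs. frag_of p) = lsum G (\<lambda>p. f (fst p) (snd p)) xs"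
  using assms
proof (induction xs)
  case Nil
  show ?case by (simp add: frag_sum_def)
next
  case (Cons p xs)
  then show ?case
    by (simp, subst frag_sum_add) (auto simp: keys_sum_list_frag_of frag_sum_frag_of)
qed

end

section \<open>The universal property: balanced maps descend to the tensor product\<close>

context tensor_pair
begin

text \<open>Well-definedness of the induced map: the extension kills each of the three kinds of
  relations, and additivity carries this to the subgroup that they generate.\<close>

lemma frag_sum_kernel:
  assumes "abelian_group G" "balanced G f" "p \<in> K"
  shows "frag_sum G f p = \<zero>\<^bsub>G\<^esub>"
proof -
  interpret G: abelian_group G by fact
  note f = balancedD[OF assms(2)]
  have fc: "f (fst q) (snd q) \<in> carrier G" if "q \<in> carrier M \<times> carrier N" for q
    using that f(1) by auto
  have d: "frag_sum G f (p - q) = frag_sum G f p \<ominus>\<^bsub>G\<^esub> frag_sum G f q"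
    if "Poly_Mapping.keys p \<subseteq> carrier M \<times> carrier N" "Poly_Mapping.keys q \<subseteq> carrier M \<times> carrier N"
    for p q
  proof -
    have "frag_sum G f (p + (- q)) = frag_sum G f p \<oplus>\<^bsub>G\<^esub> frag_sum G f (- q)"
      by (rule G.frag_sum_add) (use that fc in \<open>auto simp: keys_minus\<close>)
    moreover have "frag_sum G f (- q) = \<ominus>\<^bsub>G\<^esub> frag_sum G f q"
      by (rule G.frag_sum_uminus) (use that fc in auto)
    ultimately show ?thesis by (simp add: a_minus_def)
  qed
  have rel: "frag_sum G f p = \<zero>\<^bsub>G\<^esub>" if p: "p \<in> tensor_relations A M r N l" for p
  proof -
    have k: "Poly_Mapping.keys (frag_of u - frag_of v) \<subseteq> carrier M \<times> carrier N"
      if "u \<in> carrier M \<times> carrier N" "v \<in> carrier M \<times> carrier N" for u v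
      using keys_diff[of "frag_of u" "frag_of v"] that by auto
    consider (1) m m' n where "p = frag_of (m \<oplus>\<^bsub>M\<^esub> m', n) - frag_of (m, n) - frag_of (m', n)"
        "m \<in> carrier M" "m' \<in> carrier M" "n \<in> carrier N"
      | (2) m n n' where "p = frag_of (m, n \<oplus>\<^bsub>N\<^esub> n') - frag_of (m, n) - frag_of (m, n')"
        "m \<in> carrier M" "n' \<in> carrier N" "n \<in> carrier N"
      | (3) m a n where "p = frag_of (r m a, n) - frag_of (m, l a n)"
        "m \<in> carrier M" "a \<in> carrier A" "n \<in> carrier N"
      using p unfolding tensor_relations_def by blast
    then show ?thesis
    proof cases
      case 1
      then show ?thesis
        by (simp add: d k G.frag_sum_frag_of f a_minus_def G.minus_add G.add.m_ac)
          (metis f(1) G.a_comm G.a_inv_closed G.a_assoc G.r_neg1 G.r_neg)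
    next
      case 2
      then show ?thesis
        by (simp add: d k G.frag_sum_frag_of f a_minus_def G.minus_add G.add.m_ac)
          (metis f(1) G.a_comm G.a_inv_closed G.a_assoc G.r_neg1 G.r_neg)
    next
      case 3
      then show ?thesis
        by (simp add: d k G.frag_sum_frag_of f r_closed l_closed a_minus_def G.r_neg)
    qed
  qed
  show ?thesis
    using assms(3) unfolding tensor_kernel_def
  proof (induction p rule: generate.induct)
    case one
    show ?case by (simp add: frag_sum_def)
  next
    case (incl p)
    then show ?case by (rule rel)
  next
    case (inv p)
    then have k: "Poly_Mapping.keys p \<subseteq> carrier M \<times> carrier N"
      using kernel_carrier[OF relation_mem] by blast
    show ?case using G.frag_sum_uminus[of p f] rel[OF inv] fc k by (auto simp: subset_iff)
  next
    case (eng p q)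
    then have "Poly_Mapping.keys p \<subseteq> carrier M \<times> carrier N" "Poly_Mapping.keys q \<subseteq> carrier M \<times> carrier N"
      using kernel_carrier by (simp_all add: tensor_kernel_def)
    then have "frag_sum G f (p + q) = frag_sum G f p \<oplus>\<^bsub>G\<^esub> frag_sum G f q"
      by (intro G.frag_sum_add) (use fc in auto)
    then show ?case using eng.IH by simp
  qed
qed

text \<open>By \<open>frag_sum_kernel\<close> the extension is constant on the coset, so its image
  is a singleton and \<open>the_elem\<close> in \<open>tensor_lift\<close> returns a genuine
  value.\<close>

lemma tensor_lift_coset:
  assumes "abelian_group G" "balanced G f" "Poly_Mapping.keys p \<subseteq> carrier M \<times> carrier N"
  shows "tensor_lift G f (K #>\<^bsub>F\<^esub> p) = frag_sum G f p"
proof -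
  interpret G: abelian_group G by fact
  have fc: "f (fst q) (snd q) \<in> carrier G" if "q \<in> carrier M \<times> carrier N" for q
    using that balancedD(1)[OF assms(2)] by auto
  have "frag_sum G f (u + p) = frag_sum G f p" if "u \<in> K" for u
  proof -
    have "frag_sum G f (u + p) = frag_sum G f u \<oplus>\<^bsub>G\<^esub> frag_sum G f p"
      by (rule G.frag_sum_add) (use kernel_carrier[OF that] assms(3) fc in auto)
    moreover have "frag_sum G f p \<in> carrier G"
      by (rule G.frag_sum_closed) (use assms(3) fc in auto)
    ultimately show ?thesis by (simp add: frag_sum_kernel[OF assms(1,2) that])
  qed
  then have "frag_sum G f ` (K #>\<^bsub>F\<^esub> p) = {frag_sum G f p}"
    using kernel_zero by (auto simp: r_coset_def)
  then show ?thesis by (simp add: tensor_lift_def frag_sum_def)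
qed

lemma tensor_lift_tsum:
  assumes "abelian_group G" "balanced G f" "X \<in> carrier T"
  shows "tensor_lift G f X = tsum G f X"
proof -
  interpret G: abelian_group G by fact
  have "tensor_lift G f X = frag_sum G f (\<Sum>p\<leftarrow>trep X. frag_of p)"
    using trep_coset[OF assms(3)] assms(1,2)
    by (metis tensor_lift_coset keys_sum_list_frag_of)
  also have "\<dots> = tsum G f X"
    unfolding tsum_def using trep_mem[OF assms(3)] balancedD(1)[OF assms(2)]
    by (intro G.frag_sum_sum_list) auto
  finally show ?thesis .
qed

text \<open>The list chosen for \<open>pure m n\<close> may be any other representative of the
  coset; balancedness ensures that the value is still that of the pair itself.\<close>

lemma tsum_pure_tensor:
  assumes "abelian_group G" "balanced G f" "m \<in> carrier M" "n \<in> carrier N"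
  shows "tsum G f (pure m n) = f m n"
  using assms tensor_lift_coset[OF assms(1,2), of "frag_of (m, n)"]
    tensor_lift_tsum[OF assms(1,2) pure_closed[OF assms(3,4)]]
    abelian_group.frag_sum_frag_of[OF assms(1), of f "(m, n)"] balancedD(1)[OF assms(2)]
  by (simp add: pure_tensor_def)

text \<open>The lists chosen for X, Y and their sum are unrelated, so the comparison goes through
  \<open>tensor_lift\<close> and the additivity of \<open>frag_sum\<close> on arbitrary
  representatives.\<close>

lemma tsum_tensor_add:
  assumes "abelian_group G" "balanced G f" "X \<in> carrier T" "Y \<in> carrier T"
  shows "tsum G f (X \<oplus>\<^bsub>T\<^esub> Y) = tsum G f X \<oplus>\<^bsub>G\<^esub> tsum G f Y"
proof -
  interpret G: abelian_group G by fact
  interpret T: abelian_group T by (rule tensor_group)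
  obtain p q where pq: "Poly_Mapping.keys p \<subseteq> carrier M \<times> carrier N"
      "Poly_Mapping.keys q \<subseteq> carrier M \<times> carrier N" "X = K #>\<^bsub>F\<^esub> p" "Y = K #>\<^bsub>F\<^esub> q"
    using assms(3,4) by (auto simp: tensor_carrier)
  moreover have "Poly_Mapping.keys (p + q) \<subseteq> carrier M \<times> carrier N"
    using keys_add[of p q] pq by blast
  moreover have "frag_sum G f (p + q) = frag_sum G f p \<oplus>\<^bsub>G\<^esub> frag_sum G f q"
    by (rule G.frag_sum_add) (use pq balancedD(1)[OF assms(2)] in auto)
  ultimately show ?thesis
    using tensor_lift_tsum[OF assms(1,2)] assms(3,4) tensor_lift_coset[OF assms(1,2)]
    by (metis T.a_closed tensor_add carrier_free_Abelian_group_iff)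
qed

lemma tsum_add_hom:
  assumes "abelian_group G" "balanced G f"
  shows "add_hom T G (tsum G f)"
  using assms by (intro add_homI) (auto intro!: tsum_closed simp: balancedD tsum_tensor_add)

end

section \<open>Associativity of tensor products and coassociativity\<close>

text \<open>Only the middle factor carries actions on both sides. Their compatibility
  \<open>N_assoc\<close> makes the induced actions \<open>rMN\<close> on M \<otimes> N and
  \<open>lNP\<close> on N \<otimes> P respect the tensor relations.\<close>

locale tensor_triple = MN: tensor_pair A M rM N lN + NP: tensor_pair A N rN P lP
  for A :: "('a, 'x) ring_scheme" and M :: "('m, 'y) ring_scheme" and rM :: "'m \<Rightarrow> 'a \<Rightarrow> 'm"
  and N :: "('n, 'z) ring_scheme" and lN :: "'a \<Rightarrow> 'n \<Rightarrow> 'n" and rN :: "'n \<Rightarrow> 'a \<Rightarrow> 'n"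
  and P :: "('p, 'w) ring_scheme" and lP :: "'a \<Rightarrow> 'p \<Rightarrow> 'p" +
  assumes lN_add: "\<lbrakk>a \<in> carrier A; n \<in> carrier N; n' \<in> carrier N\<rbrakk>
      \<Longrightarrow> lN a (n \<oplus>\<^bsub>N\<^esub> n') = lN a n \<oplus>\<^bsub>N\<^esub> lN a n'"
    and rN_add: "\<lbrakk>a \<in> carrier A; n \<in> carrier N; n' \<in> carrier N\<rbrakk>
      \<Longrightarrow> rN (n \<oplus>\<^bsub>N\<^esub> n') a = rN n a \<oplus>\<^bsub>N\<^esub> rN n' a"
    and N_assoc: "\<lbrakk>a \<in> carrier A; n \<in> carrier N; b \<in> carrier A\<rbrakk> \<Longrightarrow> rN (lN a n) b = lN a (rN n b)"
begin

abbreviation lNP where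
  "lNP \<equiv> \<lambda>a. tensor_lift NP.T (\<lambda>n p. NP.pure (lN a n) p)"
abbreviation rMN where
  "rMN \<equiv> \<lambda>X a. tensor_lift MN.T (\<lambda>m n. MN.pure m (rN n a)) X"

lemma balanced_lN: "a \<in> carrier A \<Longrightarrow> NP.balanced NP.T (\<lambda>n p. NP.pure (lN a n) p)"
  by (intro NP.balancedI)
    (simp_all add: NP.pure_closed MN.l_closed lN_add NP.pure_add_l NP.pure_add_r
      NP.pure_balanced[symmetric] NP.r_closed N_assoc)

lemma balanced_rN: "a \<in> carrier A \<Longrightarrow> MN.balanced MN.T (\<lambda>m n. MN.pure m (rN n a))"
  by (intro MN.balancedI)
    (simp_all add: MN.pure_closed NP.r_closed rN_add MN.pure_add_l MN.pure_add_r
      MN.pure_balanced MN.l_closed N_assoc)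

lemma lNP_tsum: "\<lbrakk>a \<in> carrier A; Y \<in> carrier NP.T\<rbrakk> \<Longrightarrow> lNP a Y = tsum NP.T (\<lambda>n p. NP.pure (lN a n) p) Y"
  by (intro NP.tensor_lift_tsum NP.tensor_group balanced_lN)

lemma rMN_tsum: "\<lbrakk>a \<in> carrier A; X \<in> carrier MN.T\<rbrakk> \<Longrightarrow> rMN X a = tsum MN.T (\<lambda>m n. MN.pure m (rN n a)) X"
  by (intro MN.tensor_lift_tsum MN.tensor_group balanced_rN)

lemma lNP_closed: "\<lbrakk>a \<in> carrier A; Y \<in> carrier NP.T\<rbrakk> \<Longrightarrow> lNP a Y \<in> carrier NP.T"
  by (auto simp: lNP_tsum intro!: NP.tsum_closed NP.tensor_group NP.pure_closed MN.l_closed)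

lemma rMN_closed: "\<lbrakk>a \<in> carrier A; X \<in> carrier MN.T\<rbrakk> \<Longrightarrow> rMN X a \<in> carrier MN.T"
  by (auto simp: rMN_tsum intro!: MN.tsum_closed MN.tensor_group MN.pure_closed NP.r_closed)

lemma lNP_pure:
  "\<lbrakk>a \<in> carrier A; n \<in> carrier N; p \<in> carrier P\<rbrakk> \<Longrightarrow> lNP a (NP.pure n p) = NP.pure (lN a n) p"
  by (simp add: lNP_tsum NP.pure_closed NP.tsum_pure_tensor NP.tensor_group balanced_lN)

lemma rMN_pure:
  "\<lbrakk>m \<in> carrier M; n \<in> carrier N; a \<in> carrier A\<rbrakk> \<Longrightarrow> rMN (MN.pure m n) a = MN.pure m (rN n a)"
  by (simp add: rMN_tsum MN.pure_closed MN.tsum_pure_tensor MN.tensor_group balanced_rN)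

sublocale R: tensor_pair A M rM NP.T lNP
  by (intro tensor_pair.intro tensor_pair_axioms.intro MN.M.abelian_group_axioms NP.tensor_group
      MN.r_closed lNP_closed)

sublocale L: tensor_pair A MN.T rMN P lP
  by (intro tensor_pair.intro tensor_pair_axioms.intro NP.N.abelian_group_axioms MN.tensor_group
      rMN_closed NP.l_closed)

lemma balanced_assoc_inner:
  "p \<in> carrier P \<Longrightarrow> MN.balanced R.T (\<lambda>m n. R.pure m (NP.pure n p))"
  by (intro MN.balancedI)
    (simp_all add: R.pure_closed NP.pure_closed R.pure_add_l R.pure_add_r NP.pure_add_l
      R.pure_balanced lNP_pure)

abbreviation assoc_inner where
  "assoc_inner \<equiv> \<lambda>X p. tensor_lift R.T (\<lambda>m n. R.pure m (NP.pure n p)) X"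

lemma assoc_inner_tsum:
  "\<lbrakk>X \<in> carrier MN.T; p \<in> carrier P\<rbrakk>
    \<Longrightarrow> assoc_inner X p = tsum R.T (\<lambda>m n. R.pure m (NP.pure n p)) X"
  by (intro MN.tensor_lift_tsum R.tensor_group balanced_assoc_inner)

text \<open>This makes the associator well defined on the outer tensor product. Expanding X into
  pure tensors reduces the passage of a scalar from X to p to the relation n a \<otimes> p = n
  \<otimes> a p inside N \<otimes> P.\<close>

lemma balanced_assoc_outer: "L.balanced R.T assoc_inner"
proof (intro L.balancedI)
  fix X p assume "X \<in> carrier MN.T" "p \<in> carrier P"
  then show "assoc_inner X p \<in> carrier R.T"
    by (auto simp: assoc_inner_tsum intro!: MN.tsum_closed R.tensor_group R.pure_closed NP.pure_closed)
next
  interpret MNT: abelian_group MN.T by (rule MN.tensor_group)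
  fix X Y p assume "X \<in> carrier MN.T" "Y \<in> carrier MN.T" "p \<in> carrier P"
  then show "assoc_inner (X \<oplus>\<^bsub>MN.T\<^esub> Y) p = assoc_inner X p \<oplus>\<^bsub>R.T\<^esub> assoc_inner Y p"
    by (simp add: assoc_inner_tsum MN.tsum_tensor_add R.tensor_group balanced_assoc_inner)
next
  fix X p q assume *: "X \<in> carrier MN.T" "p \<in> carrier P" "q \<in> carrier P"
  have "tsum R.T (\<lambda>m n. R.pure m (NP.pure n (p \<oplus>\<^bsub>P\<^esub> q))) X
      = tsum R.T (\<lambda>m n. R.pure m (NP.pure n p) \<oplus>\<^bsub>R.T\<^esub> R.pure m (NP.pure n q)) X"
    using * by (intro MN.tsum_cong) (simp_all add: NP.pure_add_r R.pure_add_r NP.pure_closed)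
  with * show "assoc_inner X (p \<oplus>\<^bsub>P\<^esub> q) = assoc_inner X p \<oplus>\<^bsub>R.T\<^esub> assoc_inner X q"
    by (simp add: assoc_inner_tsum MN.tsum_add R.tensor_group R.pure_closed NP.pure_closed)
next
  fix X a p assume *: "X \<in> carrier MN.T" "a \<in> carrier A" "p \<in> carrier P"
  have "assoc_inner (rMN X a) p = tsum R.T (\<lambda>m n. R.pure m (NP.pure n p)) (tsum MN.T (\<lambda>m n. MN.pure m (rN n a)) X)"
    using * rMN_closed by (subst assoc_inner_tsum) (simp_all add: rMN_tsum)
  also have "\<dots> = tsum R.T (\<lambda>m n. tsum R.T (\<lambda>m n. R.pure m (NP.pure n p)) (MN.pure m (rN n a))) X"
    using * by (intro MN.tsum_hom MN.tensor_group R.tensor_group MN.tsum_add_hom balanced_assoc_inner)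
      (auto intro: MN.pure_closed NP.r_closed)
  also have "\<dots> = tsum R.T (\<lambda>m n. R.pure m (NP.pure n (lP a p))) X"
    using * by (intro MN.tsum_cong)
      (simp_all add: MN.tsum_pure_tensor R.tensor_group balanced_assoc_inner NP.r_closed NP.pure_balanced)
  also have "\<dots> = assoc_inner X (lP a p)"
    using * by (simp add: assoc_inner_tsum NP.l_closed)
  finally show "assoc_inner (rMN X a) p = assoc_inner X (lP a p)" .
qed

abbreviation assoc where "assoc \<equiv> tensor_assoc A M rM N lN rN P lP"

lemma assoc_tsum: "Z \<in> carrier L.T \<Longrightarrow> assoc Z = tsum R.T assoc_inner Z"
  unfolding tensor_assoc_def Let_def
  by (intro L.tensor_lift_tsum R.tensor_group balanced_assoc_outer)

lemma assoc_hom: "add_hom L.T R.T assoc"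
proof -
  interpret LT: abelian_group L.T by (rule L.tensor_group)
  show ?thesis
    using L.tsum_add_hom[OF R.tensor_group balanced_assoc_outer]
    by (simp add: add_hom_def assoc_tsum)
qed

lemma assoc_pure: "\<lbrakk>X \<in> carrier MN.T; p \<in> carrier P\<rbrakk> \<Longrightarrow> assoc (L.pure X p) = assoc_inner X p"
  by (simp add: assoc_tsum L.pure_closed L.tsum_pure_tensor R.tensor_group balanced_assoc_outer)

lemma assoc_pure_pure:
  "\<lbrakk>m \<in> carrier M; n \<in> carrier N; p \<in> carrier P\<rbrakk>
    \<Longrightarrow> assoc (L.pure (MN.pure m n) p) = R.pure m (NP.pure n p)"
  by (simp add: assoc_pure assoc_inner_tsum MN.pure_closed MN.tsum_pure_tensor R.tensor_group
      balanced_assoc_inner)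

text \<open>Balancedness on each pair of adjacent slots, which lets a map of three arguments factor
  through the triple tensor product.\<close>

definition tri_balanced :: "('g, 'v) ring_scheme \<Rightarrow> ('m \<Rightarrow> 'n \<Rightarrow> 'p \<Rightarrow> 'g) \<Rightarrow> bool" where
  "tri_balanced G f \<longleftrightarrow> (\<forall>m\<in>carrier M. NP.balanced G (f m)) \<and>
     (\<forall>p\<in>carrier P. MN.balanced G (\<lambda>m n. f m n p))"

lemma balanced_tri:
  assumes "abelian_group G" "tri_balanced G f"
  shows "R.balanced G (\<lambda>m Y. tsum G (f m) Y)"
proof -
  have N: "NP.balanced G (f m)" if "m \<in> carrier M" for m
    using assms(2) that by (simp add: tri_balanced_def)
  have M: "MN.balanced G (\<lambda>m n. f m n p)" if "p \<in> carrier P" for p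
    using assms(2) that by (simp add: tri_balanced_def)
  show ?thesis
  proof (intro R.balancedI)
    fix m Y assume "m \<in> carrier M" "Y \<in> carrier NP.T"
    then show "tsum G (f m) Y \<in> carrier G"
      using assms(1) NP.balancedD(1)[OF N] by (intro NP.tsum_closed)
  next
    fix m m' Y assume *: "m \<in> carrier M" "m' \<in> carrier M" "Y \<in> carrier NP.T"
    then have "tsum G (f (m \<oplus>\<^bsub>M\<^esub> m')) Y = tsum G (\<lambda>n p. f m n p \<oplus>\<^bsub>G\<^esub> f m' n p) Y"
      using MN.balancedD(2)[OF M] by (intro NP.tsum_cong) simp_all
    then show "tsum G (f (m \<oplus>\<^bsub>M\<^esub> m')) Y = tsum G (f m) Y \<oplus>\<^bsub>G\<^esub> tsum G (f m') Y"
      using * assms(1) NP.balancedD(1)[OF N] by (simp add: NP.tsum_add)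
  next
    fix m Y Z assume "m \<in> carrier M" "Y \<in> carrier NP.T" "Z \<in> carrier NP.T"
    then show "tsum G (f m) (Y \<oplus>\<^bsub>NP.T\<^esub> Z) = tsum G (f m) Y \<oplus>\<^bsub>G\<^esub> tsum G (f m) Z"
      using assms(1) N by (simp add: NP.tsum_tensor_add)
  next
    fix m a Y assume *: "m \<in> carrier M" "a \<in> carrier A" "Y \<in> carrier NP.T"
    have "tsum G (f m) (lNP a Y) = tsum G (\<lambda>n p. tsum G (f m) (NP.pure (lN a n) p)) Y"
      using * assms(1) N unfolding lNP_tsum[OF *(2,3)]
      by (intro NP.tsum_hom NP.tensor_group NP.tsum_add_hom) (auto intro: NP.pure_closed MN.l_closed)
    also have "\<dots> = tsum G (f (rM m a)) Y"
      using * assms(1) N MN.balancedD(4)[OF M] by (intro NP.tsum_cong) (simp_all add: NP.tsum_pure_tensor MN.l_closed)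
    finally show "tsum G (f (rM m a)) Y = tsum G (f m) (lNP a Y)" by simp
  qed
qed

text \<open>Evaluates f on a re-bracketed tensor: after expanding X into pure tensors, the
  associator is known on each term and f meets only pure arguments.\<close>

lemma tri_assoc_pure:
  assumes "abelian_group G" "tri_balanced G f" "X \<in> carrier MN.T" "p \<in> carrier P"
  shows "tsum G (\<lambda>m Y. tsum G (f m) Y) (assoc (L.pure X p)) = tsum G (\<lambda>m n. f m n p) X"
proof -
  have N: "NP.balanced G (f m)" if "m \<in> carrier M" for m
    using assms(2) that by (simp add: tri_balanced_def)
  have "tsum G (\<lambda>m Y. tsum G (f m) Y) (assoc (L.pure X p))
      = tsum G (\<lambda>m n. tsum G (\<lambda>m Y. tsum G (f m) Y) (R.pure m (NP.pure n p))) X"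
    unfolding assoc_pure[OF assms(3,4)] assoc_inner_tsum[OF assms(3,4)]
    using assms by (intro MN.tsum_hom R.tensor_group R.tsum_add_hom balanced_tri)
      (auto intro: R.pure_closed NP.pure_closed)
  also have "\<dots> = tsum G (\<lambda>m n. f m n p) X"
    using assms N by (intro MN.tsum_cong)
      (simp_all add: R.tsum_pure_tensor balanced_tri NP.pure_closed NP.tsum_pure_tensor)
  finally show ?thesis .
qed

end

section \<open>Comultiplication and counit of a coring in finite-sum form\<close>

context coring
begin

lemma tensor_pair_coring: "tensor_pair A C r C l"
  by (intro tensor_pair.intro tensor_pair_axioms.intro M.abelian_group_axioms lact_closed ract_closed)

lemma tensor_triple_coring: "tensor_triple A C r C l r C l"
  by (intro tensor_triple.intro tensor_triple_axioms.intro tensor_pair_coring lact_add_r ract_add_l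
      bimodule_assoc)

text \<open>The functional induced by f on C \<otimes> (C \<otimes> C) is applied to both sides of
  the coassociativity axiom. Both sides then become nested sums, the associator being absorbed by
  \<open>tri_assoc_pure\<close>.\<close>

lemma coassoc_tsum:
  assumes "abelian_group G" "tensor_triple.tri_balanced A C r C l r C l G f" "c \<in> carrier C"
  shows "tsum G (\<lambda>a b. tsum G (\<lambda>p q. f p q b) (\<Delta> a)) (\<Delta> c) = tsum G (\<lambda>a b. tsum G (f a) (\<Delta> b)) (\<Delta> c)"
proof -
  interpret T3: tensor_triple A C r C l r C l by (rule tensor_triple_coring)
  let ?F = "tsum G (\<lambda>a Y. tsum G (f a) Y)"
  have \<Delta>: "\<Delta> c \<in> carrier T3.MN.T" if "c \<in> carrier C" for c by (rule comult_closed[OF that])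
  have hom: "add_hom T3.R.T G ?F"
    using assms by (intro T3.R.tsum_add_hom T3.balanced_tri)
  have hom': "add_hom T3.L.T G (\<lambda>Z. ?F (T3.assoc Z))"
    using hom T3.assoc_hom
    by (auto simp: add_hom_def)
  \<comment> \<open>Right A-linearity of \<Delta> lets an element of A cross the outer tensor sign;
    \<open>br\<close> uses left A-linearity in the same way.\<close>
  have bl: "T3.MN.balanced T3.L.T (\<lambda>a b. T3.L.pure (\<Delta> a) b)"
    by (intro T3.MN.balancedI)
      (simp_all add: T3.L.pure_closed \<Delta> comult_add T3.L.pure_add_l T3.L.pure_add_r comult_ract
        T3.L.pure_balanced[symmetric])
  have br: "T3.MN.balanced T3.R.T (\<lambda>a b. T3.R.pure a (\<Delta> b))"
    by (intro T3.MN.balancedI)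
      (simp_all add: T3.R.pure_closed \<Delta> comult_add T3.R.pure_add_l T3.R.pure_add_r comult_lact
        T3.R.pure_balanced)
  have "T3.assoc (tensor_lift T3.L.T (\<lambda>a b. T3.L.pure (\<Delta> a) b) (\<Delta> c))
      = tensor_lift T3.R.T (\<lambda>a b. T3.R.pure a (\<Delta> b)) (\<Delta> c)"
    using coassoc[OF assms(3)] unfolding Let_def .
  then have eq: "?F (T3.assoc (tsum T3.L.T (\<lambda>a b. T3.L.pure (\<Delta> a) b) (\<Delta> c)))
      = ?F (tsum T3.R.T (\<lambda>a b. T3.R.pure a (\<Delta> b)) (\<Delta> c))"
    using T3.MN.tensor_lift_tsum[OF T3.L.tensor_group bl \<Delta>[OF assms(3)]]
      T3.MN.tensor_lift_tsum[OF T3.R.tensor_group br \<Delta>[OF assms(3)]] by simp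
  have "?F (T3.assoc (tsum T3.L.T (\<lambda>a b. T3.L.pure (\<Delta> a) b) (\<Delta> c)))
      = tsum G (\<lambda>a b. ?F (T3.assoc (T3.L.pure (\<Delta> a) b))) (\<Delta> c)"
    using assms by (intro T3.MN.tsum_hom[OF _ _ hom'] T3.L.tensor_group \<Delta> T3.L.pure_closed)
  also have "\<dots> = tsum G (\<lambda>a b. tsum G (\<lambda>p q. f p q b) (\<Delta> a)) (\<Delta> c)"
    using assms by (intro T3.MN.tsum_cong \<Delta>) (simp_all add: T3.tri_assoc_pure \<Delta>)
  finally have l: "?F (T3.assoc (tsum T3.L.T (\<lambda>a b. T3.L.pure (\<Delta> a) b) (\<Delta> c)))
    = tsum G (\<lambda>a b. tsum G (\<lambda>p q. f p q b) (\<Delta> a)) (\<Delta> c)" .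
  have "?F (tsum T3.R.T (\<lambda>a b. T3.R.pure a (\<Delta> b)) (\<Delta> c))
      = tsum G (\<lambda>a b. ?F (T3.R.pure a (\<Delta> b))) (\<Delta> c)"
    using assms by (intro T3.MN.tsum_hom[OF _ _ hom] T3.R.tensor_group \<Delta> T3.R.pure_closed)
  also have "\<dots> = tsum G (\<lambda>a b. tsum G (f a) (\<Delta> b)) (\<Delta> c)"
    using assms by (intro T3.MN.tsum_cong \<Delta>) (simp_all add: T3.R.tsum_pure_tensor T3.balanced_tri \<Delta>)
  finally show ?thesis using eq l by simp
qed

lemma tsum_comult_add:
  assumes "abelian_group G" "tensor_pair.balanced A C r C l G f" "c \<in> carrier C" "d \<in> carrier C"
  shows "tsum G f (\<Delta> (c \<oplus>\<^bsub>C\<^esub> d)) = tsum G f (\<Delta> c) \<oplus>\<^bsub>G\<^esub> tsum G f (\<Delta> d)"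
  using assms by (simp add: comult_add comult_closed tensor_pair.tsum_tensor_add[OF tensor_pair_coring])

lemma tsum_comult_lact:
  assumes "abelian_group G" "tensor_pair.balanced A C r C l G f" "a \<in> carrier A" "c \<in> carrier C"
  shows "tsum G f (\<Delta> (l a c)) = tsum G (\<lambda>c\<^sub>1 c\<^sub>2. f (l a c\<^sub>1) c\<^sub>2) (\<Delta> c)"
proof -
  interpret T3: tensor_triple A C r C l r C l by (rule tensor_triple_coring)
  have "tsum G f (\<Delta> (l a c)) = tsum G (\<lambda>c\<^sub>1 c\<^sub>2. tsum G f (T3.MN.pure (l a c\<^sub>1) c\<^sub>2)) (\<Delta> c)"
    unfolding comult_lact[OF assms(3,4)] T3.lNP_tsum[OF assms(3) comult_closed[OF assms(4)]]
    using assms by (intro T3.MN.tsum_hom T3.MN.tensor_group T3.MN.tsum_add_hom comult_closed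
        T3.MN.pure_closed lact_closed)
  also have "\<dots> = tsum G (\<lambda>c\<^sub>1 c\<^sub>2. f (l a c\<^sub>1) c\<^sub>2) (\<Delta> c)"
    using assms by (intro T3.MN.tsum_cong comult_closed)
      (simp_all add: T3.MN.tsum_pure_tensor lact_closed)
  finally show ?thesis .
qed

lemma tsum_comult_ract:
  assumes "abelian_group G" "tensor_pair.balanced A C r C l G f" "c \<in> carrier C" "a \<in> carrier A"
  shows "tsum G f (\<Delta> (r c a)) = tsum G (\<lambda>c\<^sub>1 c\<^sub>2. f c\<^sub>1 (r c\<^sub>2 a)) (\<Delta> c)"
proof -
  interpret T3: tensor_triple A C r C l r C l by (rule tensor_triple_coring)
  have "tsum G f (\<Delta> (r c a)) = tsum G (\<lambda>c\<^sub>1 c\<^sub>2. tsum G f (T3.MN.pure c\<^sub>1 (r c\<^sub>2 a))) (\<Delta> c)"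
    unfolding comult_ract[OF assms(3,4)] T3.rMN_tsum[OF assms(4) comult_closed[OF assms(3)]]
    using assms by (intro T3.MN.tsum_hom T3.MN.tensor_group T3.MN.tsum_add_hom comult_closed
        T3.MN.pure_closed ract_closed)
  also have "\<dots> = tsum G (\<lambda>c\<^sub>1 c\<^sub>2. f c\<^sub>1 (r c\<^sub>2 a)) (\<Delta> c)"
    using assms by (intro T3.MN.tsum_cong comult_closed)
      (simp_all add: T3.MN.tsum_pure_tensor ract_closed)
  finally show ?thesis .
qed

lemma balanced_counit_left: "tensor_pair.balanced A C r C l C (\<lambda>c\<^sub>1 c\<^sub>2. l (\<epsilon> c\<^sub>1) c\<^sub>2)"
  by (intro tensor_pair.balancedI[OF tensor_pair_coring])
    (simp_all add: lact_closed counit_closed counit_add lact_add_l lact_add_r counit_ract lact_mult)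

lemma balanced_counit_right: "tensor_pair.balanced A C r C l C (\<lambda>c\<^sub>1 c\<^sub>2. r c\<^sub>1 (\<epsilon> c\<^sub>2))"
  by (intro tensor_pair.balancedI[OF tensor_pair_coring])
    (simp_all add: ract_closed counit_closed counit_add ract_add_l ract_add_r counit_lact ract_mult)

lemma tsum_counit_left: "c \<in> carrier C \<Longrightarrow> tsum C (\<lambda>c\<^sub>1 c\<^sub>2. l (\<epsilon> c\<^sub>1) c\<^sub>2) (\<Delta> c) = c"
  using counit_left tensor_pair.tensor_lift_tsum[OF tensor_pair_coring M.abelian_group_axioms
      balanced_counit_left comult_closed] by metis

lemma tsum_counit_right: "c \<in> carrier C \<Longrightarrow> tsum C (\<lambda>c\<^sub>1 c\<^sub>2. r c\<^sub>1 (\<epsilon> c\<^sub>2)) (\<Delta> c) = c"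
  using counit_right tensor_pair.tensor_lift_tsum[OF tensor_pair_coring M.abelian_group_axioms
      balanced_counit_right comult_closed] by metis

end

section \<open>Linear maps\<close>

definition lin ::
  "('k, 'x) ring_scheme \<Rightarrow> ('k, 'm, 'y) module_scheme \<Rightarrow> ('k, 'n, 'z) module_scheme
    \<Rightarrow> ('m \<Rightarrow> 'n) \<Rightarrow> bool" where
  "lin k M N \<phi> \<longleftrightarrow> add_hom M N \<phi> \<and>
     (\<forall>\<kappa>\<in>carrier k. \<forall>m\<in>carrier M. \<phi> (\<kappa> \<odot>\<^bsub>M\<^esub> m) = \<kappa> \<odot>\<^bsub>N\<^esub> \<phi> m)"

lemma linI:
  assumes "\<And>m. m \<in> carrier M \<Longrightarrow> \<phi> m \<in> carrier N"
    and "\<And>m n. \<lbrakk>m \<in> carrier M; n \<in> carrier M\<rbrakk> \<Longrightarrow> \<phi> (m \<oplus>\<^bsub>M\<^esub> n) = \<phi> m \<oplus>\<^bsub>N\<^esub> \<phi> n"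
    and "\<And>\<kappa> m. \<lbrakk>\<kappa> \<in> carrier k; m \<in> carrier M\<rbrakk> \<Longrightarrow> \<phi> (\<kappa> \<odot>\<^bsub>M\<^esub> m) = \<kappa> \<odot>\<^bsub>N\<^esub> \<phi> m"
  shows "lin k M N \<phi>"
  using assms by (simp add: lin_def add_hom_def)

lemma linD:
  assumes "lin k M N \<phi>"
  shows "m \<in> carrier M \<Longrightarrow> \<phi> m \<in> carrier N"
    and "\<lbrakk>m \<in> carrier M; n \<in> carrier M\<rbrakk> \<Longrightarrow> \<phi> (m \<oplus>\<^bsub>M\<^esub> n) = \<phi> m \<oplus>\<^bsub>N\<^esub> \<phi> n"
    and "\<lbrakk>\<kappa> \<in> carrier k; m \<in> carrier M\<rbrakk> \<Longrightarrow> \<phi> (\<kappa> \<odot>\<^bsub>M\<^esub> m) = \<kappa> \<odot>\<^bsub>N\<^esub> \<phi> m"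
    and "add_hom M N \<phi>"
  using assms by (simp_all add: lin_def add_hom_def)

lemma lin_cong:
  assumes "module k M" "\<And>m. m \<in> carrier M \<Longrightarrow> \<phi> m = \<psi> m" "lin k M N \<psi>"
  shows "lin k M N \<phi>"
proof -
  interpret module k M by fact
  show ?thesis using assms(2,3) by (simp add: lin_def add_hom_def)
qed

lemma lin_id: "lin k M M (\<lambda>x. x)"
  by (simp add: lin_def add_hom_def)

lemma lin_comp: "\<lbrakk>lin k N P \<psi>; lin k M N \<phi>\<rbrakk> \<Longrightarrow> lin k M P (\<lambda>x. \<psi> (\<phi> x))"
  by (simp add: lin_def add_hom_def)

definition bil ::
  "('k, 'x) ring_scheme \<Rightarrow> ('k, 'm, 'y) module_scheme \<Rightarrow> ('k, 'n, 'z) module_scheme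
    \<Rightarrow> ('k, 'p, 'w) module_scheme \<Rightarrow> ('m \<Rightarrow> 'n \<Rightarrow> 'p) \<Rightarrow> bool" where
  "bil k M N P f \<longleftrightarrow> (\<forall>m\<in>carrier M. lin k N P (f m)) \<and> (\<forall>n\<in>carrier N. lin k M P (\<lambda>m. f m n))"

lemma bilI:
  assumes "\<And>m. m \<in> carrier M \<Longrightarrow> lin k N P (\<lambda>n. f m n)"
    and "\<And>n. n \<in> carrier N \<Longrightarrow> lin k M P (\<lambda>m. f m n)"
  shows "bil k M N P f"
  using assms by (simp add: bil_def)

lemma bilD:
  assumes "bil k M N P f"
  shows "m \<in> carrier M \<Longrightarrow> lin k N P (\<lambda>n. f m n)"
    and "n \<in> carrier N \<Longrightarrow> lin k M P (\<lambda>m. f m n)"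
    and "\<lbrakk>m \<in> carrier M; n \<in> carrier N\<rbrakk> \<Longrightarrow> f m n \<in> carrier P"
  using assms by (auto simp: bil_def lin_def add_hom_def)

lemma tensor_pair_module:
  assumes "module k M" "module k N"
  shows "tensor_pair k M (\<lambda>m \<kappa>. \<kappa> \<odot>\<^bsub>M\<^esub> m) N (\<lambda>\<kappa> n. \<kappa> \<odot>\<^bsub>N\<^esub> n)"
proof -
  interpret M: module k M by fact
  interpret N: module k N by fact
  show ?thesis
    by (intro tensor_pair.intro tensor_pair_axioms.intro M.M.abelian_group_axioms N.M.abelian_group_axioms) auto
qed

text \<open>Over the commutative ring k both actions in the tensor product are scalar
  multiplication, so the balancing condition follows from homogeneity in the two slots.\<close>

lemma bil_balanced:
  assumes "module k M" "module k N" "bil k M N P f"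
  shows "tensor_pair.balanced k M (\<lambda>m \<kappa>. \<kappa> \<odot>\<^bsub>M\<^esub> m) N (\<lambda>\<kappa> n. \<kappa> \<odot>\<^bsub>N\<^esub> n) P f"
  by (intro tensor_pair.balancedI[OF tensor_pair_module[OF assms(1,2)]])
    (use assms(3) in \<open>simp_all add: bil_def lin_def add_hom_def\<close>)

text \<open>Sums see only addition and zero, so a tensor product can be exchanged for a k-module
  record with the same additive structure.\<close>

lemma tsum_record_cong:
  fixes f :: "'m \<Rightarrow> 'n \<Rightarrow> 'g"
  assumes "ring.add G = ring.add H" "ring.zero G = ring.zero H"
  shows "tsum G f X = tsum H f X"
proof -
  have "lsum G g xs = lsum H g xs" for g :: "'m \<times> 'n \<Rightarrow> 'g" and xs
    by (induction xs) (simp_all add: assms)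
  then show ?thesis by (simp add: tsum_def)
qed

text \<open>Scalars act through the first factor; \<open>comm\<close> makes this respect the
  relation m a \<otimes> n = m \<otimes> a n. The record \<open>M'\<close> supplies scalars on
  \<open>M\<close>, which the locale knows only as an abelian group, and \<open>P\<close> is a
  record on the carrier of \<open>T\<close> that can hold a scalar multiplication.\<close>

lemma (in tensor_pair) tensor_module:
  fixes P :: "('k, ('m, 'n) tensor, 'v) module_scheme" and sc :: "'k \<Rightarrow> 'm \<Rightarrow> 'm"
    and k :: "('k, 'u) ring_scheme" and M' :: "('k, 'm, 't) module_scheme"
  assumes "module k M'"
    and M': "carrier M' = carrier M" "ring.add M' = ring.add M"
    and comm: "\<And>\<kappa> m a. \<lbrakk>\<kappa> \<in> carrier k; m \<in> carrier M; a \<in> carrier A\<rbrakk>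
      \<Longrightarrow> r (\<kappa> \<odot>\<^bsub>M'\<^esub> m) a = \<kappa> \<odot>\<^bsub>M'\<^esub> r m a"
    and P: "carrier P = carrier T" "ring.add P = ring.add T" "ring.zero P = ring.zero T"
    and sc: "\<And>\<kappa>. smult P \<kappa> = tensor_lift T (\<lambda>m n. pure (\<kappa> \<odot>\<^bsub>M'\<^esub> m) n)"
  shows "module k P"
    and "\<lbrakk>\<kappa> \<in> carrier k; m \<in> carrier M; n \<in> carrier N\<rbrakk> \<Longrightarrow> \<kappa> \<odot>\<^bsub>P\<^esub> pure m n = pure (\<kappa> \<odot>\<^bsub>M'\<^esub> m) n"
proof -
  interpret M': module k M' by fact
  interpret T: abelian_group T by (rule tensor_group)
  have M'c: "\<kappa> \<odot>\<^bsub>M'\<^esub> m \<in> carrier M" if "\<kappa> \<in> carrier k" "m \<in> carrier M" for \<kappa> m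
    using that M'.smult_closed M' by simp
  have M'add: "\<kappa> \<odot>\<^bsub>M'\<^esub> (m \<oplus>\<^bsub>M\<^esub> m') = \<kappa> \<odot>\<^bsub>M'\<^esub> m \<oplus>\<^bsub>M\<^esub> \<kappa> \<odot>\<^bsub>M'\<^esub> m'"
    if "\<kappa> \<in> carrier k" "m \<in> carrier M" "m' \<in> carrier M" for \<kappa> m m'
    using that M'.smult_r_distr[of \<kappa> m m'] M' by simp
  have bal: "balanced T (\<lambda>m n. pure (\<kappa> \<odot>\<^bsub>M'\<^esub> m) n)" if "\<kappa> \<in> carrier k" for \<kappa>
    by (intro balancedI)
      (simp_all add: that M'c M'add pure_closed pure_add_l pure_add_r comm[symmetric] pure_balanced)
  have sct: "smult P \<kappa> X = tsum T (\<lambda>m n. pure (\<kappa> \<odot>\<^bsub>M'\<^esub> m) n) X"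
    if "\<kappa> \<in> carrier k" "X \<in> carrier T" for \<kappa> X
    using that sc by (simp add: tensor_lift_tsum tensor_group bal)
  have pure: "\<kappa> \<odot>\<^bsub>P\<^esub> pure m n = pure (\<kappa> \<odot>\<^bsub>M'\<^esub> m) n"
    if "\<kappa> \<in> carrier k" "m \<in> carrier M" "n \<in> carrier N" for \<kappa> m n
    using that by (simp add: sct pure_closed tsum_pure_tensor bal tensor_group)
  then show "\<lbrakk>\<kappa> \<in> carrier k; m \<in> carrier M; n \<in> carrier N\<rbrakk> \<Longrightarrow> \<kappa> \<odot>\<^bsub>P\<^esub> pure m n = pure (\<kappa> \<odot>\<^bsub>M'\<^esub> m) n" .
  have sc_add: "smult P \<kappa> (X \<oplus>\<^bsub>T\<^esub> Y) = smult P \<kappa> X \<oplus>\<^bsub>T\<^esub> smult P \<kappa> Y"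
    if "\<kappa> \<in> carrier k" "X \<in> carrier T" "Y \<in> carrier T" for \<kappa> X Y
    using that by (simp add: sct tsum_tensor_add tensor_group bal)
  have sc_closed: "smult P \<kappa> X \<in> carrier T" if "\<kappa> \<in> carrier k" "X \<in> carrier T" for \<kappa> X
    using that by (simp add: sct) (intro tsum_closed tensor_group pure_closed M'c)
  have sc_hom: "add_hom T T (smult P \<kappa>)" if "\<kappa> \<in> carrier k" for \<kappa>
    using that by (simp add: add_homI sc_add sc_closed)
  show "module k P"
  proof (rule moduleI)
    show "cring k" by (rule M'.R.is_cring)
    show "abelian_group P"
    proof (rule abelian_groupI)
      show "\<exists>Y\<in>carrier P. Y \<oplus>\<^bsub>P\<^esub> X = \<zero>\<^bsub>P\<^esub>" if "X \<in> carrier P" for X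
        using that T.l_neg[of X] T.a_inv_closed[of X] P by auto
    qed (simp_all add: P T.a_ac)
    show "\<kappa> \<odot>\<^bsub>P\<^esub> X \<in> carrier P" if "\<kappa> \<in> carrier k" "X \<in> carrier P" for \<kappa> X
      using that sc_closed P by simp
    show "\<kappa> \<odot>\<^bsub>P\<^esub> (X \<oplus>\<^bsub>P\<^esub> Y) = \<kappa> \<odot>\<^bsub>P\<^esub> X \<oplus>\<^bsub>P\<^esub> \<kappa> \<odot>\<^bsub>P\<^esub> Y"
      if "\<kappa> \<in> carrier k" "X \<in> carrier P" "Y \<in> carrier P" for \<kappa> X Y
      using that sc_add P by simp
    show "(\<kappa> \<oplus>\<^bsub>k\<^esub> \<kappa>') \<odot>\<^bsub>P\<^esub> X = \<kappa> \<odot>\<^bsub>P\<^esub> X \<oplus>\<^bsub>P\<^esub> \<kappa>' \<odot>\<^bsub>P\<^esub> X"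
      if "\<kappa> \<in> carrier k" "\<kappa>' \<in> carrier k" "X \<in> carrier P" for \<kappa> \<kappa>' X
    proof -
      have X: "X \<in> carrier T" using that P by simp
      have "tsum T (\<lambda>m n. pure ((\<kappa> \<oplus>\<^bsub>k\<^esub> \<kappa>') \<odot>\<^bsub>M'\<^esub> m) n) X
          = tsum T (\<lambda>m n. pure (\<kappa> \<odot>\<^bsub>M'\<^esub> m) n \<oplus>\<^bsub>T\<^esub> pure (\<kappa>' \<odot>\<^bsub>M'\<^esub> m) n) X"
        using that M'.smult_l_distr[of \<kappa> \<kappa>'] M'
        by (intro tsum_cong X) (simp_all add: pure_add_l M'c)
      then show ?thesis
        using that X by (simp add: sct P tsum_add tensor_group pure_closed M'c)
    qed
    show "(\<kappa> \<otimes>\<^bsub>k\<^esub> \<kappa>') \<odot>\<^bsub>P\<^esub> X = \<kappa> \<odot>\<^bsub>P\<^esub> (\<kappa>' \<odot>\<^bsub>P\<^esub> X)"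
      if "\<kappa> \<in> carrier k" "\<kappa>' \<in> carrier k" "X \<in> carrier P" for \<kappa> \<kappa>' X
    proof -
      have X: "X \<in> carrier T" using that P by simp
      have "\<kappa> \<odot>\<^bsub>P\<^esub> (\<kappa>' \<odot>\<^bsub>P\<^esub> X) = tsum T (\<lambda>m n. \<kappa> \<odot>\<^bsub>P\<^esub> pure (\<kappa>' \<odot>\<^bsub>M'\<^esub> m) n) X"
        unfolding sct[OF that(2) X]
        by (intro tsum_hom[OF _ _ sc_hom] tensor_group pure_closed M'c that X)
      also have "\<dots> = tsum T (\<lambda>m n. pure ((\<kappa> \<otimes>\<^bsub>k\<^esub> \<kappa>') \<odot>\<^bsub>M'\<^esub> m) n) X"
        using that X M'.smult_assoc1[of \<kappa> \<kappa>'] M' by (intro tsum_cong X) (simp add: pure M'c)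
      finally show ?thesis using that X by (simp add: sct)
    qed
    show "\<one>\<^bsub>k\<^esub> \<odot>\<^bsub>P\<^esub> X = X" if "X \<in> carrier P" for X
    proof -
      have X: "X \<in> carrier T" using that P by simp
      have "tsum T (\<lambda>m n. pure (\<one>\<^bsub>k\<^esub> \<odot>\<^bsub>M'\<^esub> m) n) X = tsum T pure X"
        using M'.smult_one M' by (intro tsum_cong X) simp
      then show ?thesis using X by (simp add: sct tsum_pure)
    qed
  qed
qed

context tensor_pair
begin

lemma tensor_ext:
  assumes "abelian_group G" "add_hom T G \<phi>" "add_hom T G \<psi>"
    and "\<And>m n. \<lbrakk>m \<in> carrier M; n \<in> carrier N\<rbrakk> \<Longrightarrow> \<phi> (pure m n) = \<psi> (pure m n)"
    and "X \<in> carrier T"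
  shows "\<phi> X = \<psi> X"
proof -
  have "\<phi> X = tsum G (\<lambda>m n. \<phi> (pure m n)) X"
    using tsum_hom[OF tensor_group assms(1,2,5), of pure] pure_closed tsum_pure[OF assms(5)] by simp
  also have "\<dots> = tsum G (\<lambda>m n. \<psi> (pure m n)) X"
    by (intro tsum_cong assms(4,5))
  also have "\<dots> = \<psi> X"
    using tsum_hom[OF tensor_group assms(1,3,5), of pure] pure_closed tsum_pure[OF assms(5)] by simp
  finally show ?thesis .
qed

text \<open>The tensor is fixed and the parameter sits in the summand, so linearity holds term by
  term. Linearity in the tensor itself, as in \<open>lin_sw\<close>, rests on balancedness
  instead.\<close>

lemma lin_tsum_param:
  assumes "module k G" "X \<in> carrier T"
    "\<And>m n. \<lbrakk>m \<in> carrier M; n \<in> carrier N\<rbrakk> \<Longrightarrow> lin k V G (\<lambda>x. f x m n)"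
  shows "lin k V G (\<lambda>x. tsum G (\<lambda>m n. f x m n) X)"
proof (rule linI)
  interpret G: module k G by fact
  note G = G.M.abelian_group_axioms
  note f = linD[OF assms(3)]
  show "tsum G (f x) X \<in> carrier G" if "x \<in> carrier V" for x
    using that f(1) by (intro tsum_closed G assms(2)) auto
  show "tsum G (f (x \<oplus>\<^bsub>V\<^esub> y)) X = tsum G (f x) X \<oplus>\<^bsub>G\<^esub> tsum G (f y) X"
    if "x \<in> carrier V" "y \<in> carrier V" for x y
  proof -
    have "tsum G (f (x \<oplus>\<^bsub>V\<^esub> y)) X = tsum G (\<lambda>m n. f x m n \<oplus>\<^bsub>G\<^esub> f y m n) X"
      using f(2) that by (intro tsum_cong assms(2)) auto
    also have "\<dots> = tsum G (f x) X \<oplus>\<^bsub>G\<^esub> tsum G (f y) X"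
      using that f(1) by (intro tsum_add G assms(2)) auto
    finally show ?thesis .
  qed
  show "tsum G (f (\<kappa> \<odot>\<^bsub>V\<^esub> x)) X = \<kappa> \<odot>\<^bsub>G\<^esub> tsum G (f x) X" if "\<kappa> \<in> carrier k" "x \<in> carrier V" for \<kappa> x
  proof -
    have "tsum G (f (\<kappa> \<odot>\<^bsub>V\<^esub> x)) X = tsum G (\<lambda>m n. \<kappa> \<odot>\<^bsub>G\<^esub> f x m n) X"
      using f(3) that by (intro tsum_cong assms(2)) auto
    also have "\<dots> = \<kappa> \<odot>\<^bsub>G\<^esub> tsum G (f x) X"
      using that f(1) by (intro tsum_hom[symmetric] G assms(2) add_homI) (auto simp: G.smult_r_distr)
    finally show ?thesis .
  qed
qed

end

section \<open>Linearity of actions, products and scalar multiplication\<close>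

lemma lin_module_l:
  assumes "k_left_module k H V act" "lin k M H \<phi>" "v \<in> carrier V"
  shows "lin k M V (\<lambda>x. act (\<phi> x) v)"
proof -
  interpret k_left_module k H V act by fact
  show ?thesis using assms(2,3)
    by (auto simp: lin_def add_hom_def lact_closed lact_add_l lact_smult)
qed

text \<open>The axioms mention scalars only on the acting algebra. Writing \<kappa> v as the action
  of \<kappa> 1, which is central, gives homogeneity in the vector.\<close>

lemma k_left_module_smult:
  assumes "k_left_module k H V act" "\<kappa> \<in> carrier k" "h \<in> carrier H" "v \<in> carrier V"
  shows "act h (\<kappa> \<odot>\<^bsub>V\<^esub> v) = \<kappa> \<odot>\<^bsub>V\<^esub> act h v"
proof -
  interpret k_left_module k H V act by fact
  have "act h (\<kappa> \<odot>\<^bsub>V\<^esub> v) = act h (act (\<kappa> \<odot>\<^bsub>H\<^esub> \<one>\<^bsub>H\<^esub>) v)"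
    using assms by (simp add: lact_smult lact_one)
  also have "\<dots> = act (h \<otimes>\<^bsub>H\<^esub> (\<kappa> \<odot>\<^bsub>H\<^esub> \<one>\<^bsub>H\<^esub>)) v"
    using assms by (subst lact_mult) auto
  also have "\<dots> = \<kappa> \<odot>\<^bsub>V\<^esub> act h v"
    using assms by (simp add: smult_mult_r lact_smult)
  finally show ?thesis .
qed

lemma lin_module_r:
  assumes "k_left_module k H V act" "h \<in> carrier H" "lin k M V \<phi>"
  shows "lin k M V (\<lambda>x. act h (\<phi> x))"
proof -
  interpret k_left_module k H V act by fact
  show ?thesis using assms(2,3)
    by (auto simp: lin_def add_hom_def lact_closed lact_add_r k_left_module_smult[OF assms(1)])
qed

lemma k_right_module_smult:
  assumes "k_right_module k R V ract" "\<kappa> \<in> carrier k" "a \<in> carrier R" "v \<in> carrier V"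
  shows "ract (\<kappa> \<odot>\<^bsub>V\<^esub> v) a = \<kappa> \<odot>\<^bsub>V\<^esub> ract v a"
proof -
  interpret k_right_module k R V ract by fact
  have "ract (\<kappa> \<odot>\<^bsub>V\<^esub> v) a = ract (ract v (\<kappa> \<odot>\<^bsub>R\<^esub> \<one>\<^bsub>R\<^esub>)) a"
    using assms by (simp add: ract_smult ract_one)
  also have "\<dots> = ract v ((\<kappa> \<odot>\<^bsub>R\<^esub> \<one>\<^bsub>R\<^esub>) \<otimes>\<^bsub>R\<^esub> a)"
    using assms by (subst ract_mult) auto
  also have "\<dots> = \<kappa> \<odot>\<^bsub>V\<^esub> ract v a"
    using assms by (simp add: smult_mult_l ract_smult)
  finally show ?thesis .
qed

lemma lin_right_module_l:
  assumes "k_right_module k R V ract" "a \<in> carrier R" "lin k M V \<phi>"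
  shows "lin k M V (\<lambda>x. ract (\<phi> x) a)"
proof -
  interpret k_right_module k R V ract by fact
  show ?thesis using assms(2,3)
    by (auto simp: lin_def add_hom_def ract_closed ract_add_l k_right_module_smult[OF assms(1)])
qed

lemma lin_right_module_r:
  assumes "k_right_module k R V ract" "v \<in> carrier V" "lin k M R \<phi>"
  shows "lin k M V (\<lambda>x. ract v (\<phi> x))"
proof -
  interpret k_right_module k R V ract by fact
  show ?thesis using assms(2,3)
    by (auto simp: lin_def add_hom_def ract_closed ract_add_r ract_smult)
qed

lemma lin_mult_l:
  assumes "k_algebra k R" "lin k M R \<phi>" "a \<in> carrier R"
  shows "lin k M R (\<lambda>x. \<phi> x \<otimes>\<^bsub>R\<^esub> a)"
proof -
  interpret k_algebra k R by fact
  show ?thesis using assms(2,3)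
    by (auto simp: lin_def add_hom_def A.l_distr smult_mult_l)
qed

lemma lin_mult_r:
  assumes "k_algebra k R" "a \<in> carrier R" "lin k M R \<phi>"
  shows "lin k M R (\<lambda>x. a \<otimes>\<^bsub>R\<^esub> \<phi> x)"
proof -
  interpret k_algebra k R by fact
  show ?thesis using assms(2,3)
    by (auto simp: lin_def add_hom_def A.r_distr smult_mult_r)
qed

lemma lin_smult:
  assumes "module k N" "\<kappa> \<in> carrier k" "lin k M N \<phi>"
  shows "lin k M N (\<lambda>x. \<kappa> \<odot>\<^bsub>N\<^esub> \<phi> x)"
proof -
  interpret module k N by fact
  show ?thesis using assms(2,3)
    by (auto simp: lin_def add_hom_def smult_r_distr smult_assoc1[symmetric] R.m_comm)
qed

section \<open>Sweedler calculus in Hopf algebras\<close>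

context hopf_algebra
begin

abbreviation sw where "sw G f h \<equiv> tsum G f (comult H h)"

lemma module_H: "module k H"
  by (rule module_axioms)

lemma k_algebra_H: "k_algebra k H"
  by (rule k_algebra_axioms)

lemma tensor_pair_H: "tensor_pair k H (\<lambda>h \<kappa>. \<kappa> \<odot>\<^bsub>H\<^esub> h) H (\<lambda>\<kappa> h. \<kappa> \<odot>\<^bsub>H\<^esub> h)"
  by (rule tensor_pair_module[OF module_H module_H])

lemma module_abelian_group: "module k G \<Longrightarrow> abelian_group G"
  by (simp add: module_def)

lemma sw_closed:
  "\<lbrakk>module k G; h \<in> carrier H; \<And>a b. \<lbrakk>a \<in> carrier H; b \<in> carrier H\<rbrakk> \<Longrightarrow> f a b \<in> carrier G\<rbrakk>
    \<Longrightarrow> sw G f h \<in> carrier G"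
  by (intro tensor_pair.tsum_closed[OF tensor_pair_H] comult_closed module_abelian_group)

lemma sw_cong:
  "\<lbrakk>h \<in> carrier H; \<And>a b. \<lbrakk>a \<in> carrier H; b \<in> carrier H\<rbrakk> \<Longrightarrow> f a b = g a b\<rbrakk>
    \<Longrightarrow> sw G f h = sw G g h"
  by (intro tensor_pair.tsum_cong[OF tensor_pair_H] comult_closed)

lemma sw_hom:
  "\<lbrakk>module k G; module k G'; lin k G G' \<phi>; h \<in> carrier H;
     \<And>a b. \<lbrakk>a \<in> carrier H; b \<in> carrier H\<rbrakk> \<Longrightarrow> f a b \<in> carrier G\<rbrakk>
    \<Longrightarrow> \<phi> (sw G f h) = sw G' (\<lambda>a b. \<phi> (f a b)) h"
  by (intro tensor_pair.tsum_hom[OF tensor_pair_H] comult_closed module_abelian_group linD(4))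

text \<open>Both sides run over the same two chosen lists, so this is an interchange of finite
  sums.\<close>

lemma sw_swap:
  assumes "module k G" "g \<in> carrier H" "h \<in> carrier H"
    "\<And>a b c d. \<lbrakk>a \<in> carrier H; b \<in> carrier H; c \<in> carrier H; d \<in> carrier H\<rbrakk> \<Longrightarrow> f a b c d \<in> carrier G"
  shows "sw G (\<lambda>a b. sw G (f a b) h) g = sw G (\<lambda>c d. sw G (\<lambda>a b. f a b c d) g) h"
  unfolding tsum_def
  using assms tensor_pair.trep_mem[OF tensor_pair_H comult_closed]
  by (intro abelian_group.lsum_swap[OF module_abelian_group]) auto

lemma lin_sw_param:
  "\<lbrakk>module k G; h \<in> carrier H;
     \<And>a b. \<lbrakk>a \<in> carrier H; b \<in> carrier H\<rbrakk> \<Longrightarrow> lin k M G (\<lambda>x. f x a b)\<rbrakk>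
    \<Longrightarrow> lin k M G (\<lambda>x. sw G (\<lambda>a b. f x a b) h)"
  by (intro tensor_pair.lin_tsum_param[OF tensor_pair_H] comult_closed)

lemma bil_balanced_H: "bil k H H G f \<Longrightarrow>
    tensor_pair.balanced k H (\<lambda>h \<kappa>. \<kappa> \<odot>\<^bsub>H\<^esub> h) H (\<lambda>\<kappa> h. \<kappa> \<odot>\<^bsub>H\<^esub> h) G f"
  by (rule bil_balanced[OF module_H module_H])

lemma sw_tensor_lift: "\<lbrakk>module k G; h \<in> carrier H; bil k H H G f\<rbrakk>
    \<Longrightarrow> tensor_lift G f (comult H h) = sw G f h"
  by (intro tensor_pair.tensor_lift_tsum[OF tensor_pair_H] bil_balanced_H module_abelian_group comult_closed)

lemma lin_sw:
  assumes "module k G" "bil k H H G f"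
  shows "lin k H G (sw G f)"
proof (rule linI)
  show "sw G f h \<in> carrier G" if "h \<in> carrier H" for h
    using assms that bilD(3)[OF assms(2)] by (intro sw_closed)
  show "sw G f (g \<oplus>\<^bsub>H\<^esub> h) = sw G f g \<oplus>\<^bsub>G\<^esub> sw G f h" if "g \<in> carrier H" "h \<in> carrier H" for g h
    using assms that by (intro tsum_comult_add module_abelian_group bil_balanced_H)
  show "sw G f (\<kappa> \<odot>\<^bsub>H\<^esub> h) = \<kappa> \<odot>\<^bsub>G\<^esub> sw G f h" if "\<kappa> \<in> carrier k" "h \<in> carrier H" for \<kappa> h
  proof -
    have "sw G f (\<kappa> \<odot>\<^bsub>H\<^esub> h) = sw G (\<lambda>a b. f (\<kappa> \<odot>\<^bsub>H\<^esub> a) b) h"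
      using assms that by (intro tsum_comult_lact module_abelian_group bil_balanced_H)
    also have "\<dots> = sw G (\<lambda>a b. \<kappa> \<odot>\<^bsub>G\<^esub> f a b) h"
      using that linD(3)[OF bilD(2)[OF assms(2)]] by (intro sw_cong) auto
    also have "\<dots> = \<kappa> \<odot>\<^bsub>G\<^esub> sw G f h"
      using assms that bilD(3)[OF assms(2)] by (intro sw_hom[symmetric] lin_smult lin_id) auto
    finally show ?thesis .
  qed
qed

lemma lin_sw_arg: "\<lbrakk>module k G; lin k M H \<phi>; bil k H H G f\<rbrakk> \<Longrightarrow> lin k M G (\<lambda>x. sw G f (\<phi> x))"
  by (rule lin_comp[OF lin_sw])

text \<open>Sweedler renumbering: over k, linearity in each slot gives the tri-balancedness that
  \<open>coassoc_tsum\<close> asks for.\<close>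

lemma sw_coassoc:
  assumes "module k G" "h \<in> carrier H"
    "\<And>b c. \<lbrakk>b \<in> carrier H; c \<in> carrier H\<rbrakk> \<Longrightarrow> lin k H G (\<lambda>a. f a b c)"
    "\<And>a c. \<lbrakk>a \<in> carrier H; c \<in> carrier H\<rbrakk> \<Longrightarrow> lin k H G (\<lambda>b. f a b c)"
    "\<And>a b. \<lbrakk>a \<in> carrier H; b \<in> carrier H\<rbrakk> \<Longrightarrow> lin k H G (\<lambda>c. f a b c)"
  shows "sw G (\<lambda>a c. sw G (\<lambda>p q. f p q c) a) h = sw G (\<lambda>a c. sw G (\<lambda>p q. f a p q) c) h"
proof (rule coassoc_tsum[OF module_abelian_group[OF assms(1)] _ assms(2)])
  show "tensor_triple.tri_balanced k H (\<lambda>h \<kappa>. \<kappa> \<odot>\<^bsub>H\<^esub> h) H (\<lambda>\<kappa> h. \<kappa> \<odot>\<^bsub>H\<^esub> h) (\<lambda>h \<kappa>. \<kappa> \<odot>\<^bsub>H\<^esub> h)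
      H (\<lambda>\<kappa> h. \<kappa> \<odot>\<^bsub>H\<^esub> h) G f"
    unfolding tensor_triple.tri_balanced_def[OF tensor_triple_coring]
    using assms(3-) by (auto intro!: bil_balanced_H bilI)
qed

lemma sw_counit_left:
  assumes "module k G" "lin k H G \<phi>" "h \<in> carrier H"
  shows "sw G (\<lambda>a b. counit H a \<odot>\<^bsub>G\<^esub> \<phi> b) h = \<phi> h"
proof -
  have "\<phi> (sw H (\<lambda>a b. counit H a \<odot>\<^bsub>H\<^esub> b) h) = sw G (\<lambda>a b. \<phi> (counit H a \<odot>\<^bsub>H\<^esub> b)) h"
    using assms by (intro sw_hom module_H) (auto simp: counit_closed)
  also have "\<dots> = sw G (\<lambda>a b. counit H a \<odot>\<^bsub>G\<^esub> \<phi> b) h"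
    using assms linD(3)[OF assms(2)] by (intro sw_cong) (auto simp: counit_closed)
  finally show ?thesis using tsum_counit_left[OF assms(3)] by simp
qed

lemma sw_counit_right:
  assumes "module k G" "lin k H G \<phi>" "h \<in> carrier H"
  shows "sw G (\<lambda>a b. counit H b \<odot>\<^bsub>G\<^esub> \<phi> a) h = \<phi> h"
proof -
  have "\<phi> (sw H (\<lambda>a b. counit H b \<odot>\<^bsub>H\<^esub> a) h) = sw G (\<lambda>a b. \<phi> (counit H b \<odot>\<^bsub>H\<^esub> a)) h"
    using assms by (intro sw_hom module_H) (auto simp: counit_closed)
  also have "\<dots> = sw G (\<lambda>a b. counit H b \<odot>\<^bsub>G\<^esub> \<phi> a) h"
    using assms linD(3)[OF assms(2)] by (intro sw_cong) (auto simp: counit_closed)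
  finally show ?thesis using tsum_counit_right[OF assms(3)] by simp
qed

lemma bil_mult_pure:
  assumes "g\<^sub>1 \<in> carrier H" "g\<^sub>2 \<in> carrier H"
  shows "tensor_pair.balanced k H (\<lambda>h \<kappa>. \<kappa> \<odot>\<^bsub>H\<^esub> h) H (\<lambda>\<kappa> h. \<kappa> \<odot>\<^bsub>H\<^esub> h) (k_tensor k H H)
    (\<lambda>h\<^sub>1 h\<^sub>2. k_pure_tensor k H H (g\<^sub>1 \<otimes>\<^bsub>H\<^esub> h\<^sub>1) (g\<^sub>2 \<otimes>\<^bsub>H\<^esub> h\<^sub>2))"
proof -
  interpret T: tensor_pair k H "\<lambda>h \<kappa>. \<kappa> \<odot>\<^bsub>H\<^esub> h" H "\<lambda>\<kappa> h. \<kappa> \<odot>\<^bsub>H\<^esub> h" by (rule tensor_pair_H)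
  show ?thesis
    by (intro T.balancedI)
      (simp_all add: assms T.pure_closed A.r_distr T.pure_add_l T.pure_add_r smult_mult_r T.pure_balanced)
qed

text \<open>In \<open>comult_mult\<close> the inner lift has to be balanced in the two parts of g
  before the outer lift becomes a finite sum; after that, f is evaluated on pure tensors.\<close>

lemma sw_mult:
  assumes "module k G" "bil k H H G f" "g \<in> carrier H" "h \<in> carrier H"
  shows "sw G f (g \<otimes>\<^bsub>H\<^esub> h) = sw G (\<lambda>a b. sw G (\<lambda>c d. f (a \<otimes>\<^bsub>H\<^esub> c) (b \<otimes>\<^bsub>H\<^esub> d)) h) g"
proof -
  interpret T: tensor_pair k H "\<lambda>h \<kappa>. \<kappa> \<odot>\<^bsub>H\<^esub> h" H "\<lambda>\<kappa> h. \<kappa> \<odot>\<^bsub>H\<^esub> h" by (rule tensor_pair_H)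
  interpret TT: abelian_group T.T by (rule T.tensor_group)
  interpret G: module k G by fact
  let ?p = "\<lambda>a b c d. T.pure (a \<otimes>\<^bsub>H\<^esub> c) (b \<otimes>\<^bsub>H\<^esub> d)"
  have inner: "tensor_lift T.T (?p a b) (comult H h) = tsum T.T (?p a b) (comult H h)"
    if "a \<in> carrier H" "b \<in> carrier H" for a b
    using that assms by (intro T.tensor_lift_tsum T.tensor_group bil_mult_pure comult_closed)
  have ic: "tsum T.T (?p a b) (comult H h) \<in> carrier T.T"
    if "a \<in> carrier H" "b \<in> carrier H" for a b
    using that assms by (intro T.tsum_closed T.tensor_group comult_closed T.pure_closed) auto
  have hc: "comult H h \<in> carrier T.T" using assms(4) by (rule comult_closed)
  have outer: "T.balanced T.T (\<lambda>a b. tensor_lift T.T (?p a b) (comult H h))"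
  proof (intro T.balancedI)
    fix a a' b assume *: "a \<in> carrier H" "a' \<in> carrier H" "b \<in> carrier H"
    have "tsum T.T (?p (a \<oplus>\<^bsub>H\<^esub> a') b) (comult H h)
        = tsum T.T (\<lambda>c d. ?p a b c d \<oplus>\<^bsub>T.T\<^esub> ?p a' b c d) (comult H h)"
      using * by (intro T.tsum_cong hc) (simp add: A.l_distr T.pure_add_l)
    with * show "tensor_lift T.T (?p (a \<oplus>\<^bsub>H\<^esub> a') b) (comult H h)
        = tensor_lift T.T (?p a b) (comult H h) \<oplus>\<^bsub>T.T\<^esub> tensor_lift T.T (?p a' b) (comult H h)"
      by (simp add: inner T.tsum_add T.tensor_group hc T.pure_closed)
  next
    fix a b b' assume *: "a \<in> carrier H" "b \<in> carrier H" "b' \<in> carrier H"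
    have "tsum T.T (?p a (b \<oplus>\<^bsub>H\<^esub> b')) (comult H h)
        = tsum T.T (\<lambda>c d. ?p a b c d \<oplus>\<^bsub>T.T\<^esub> ?p a b' c d) (comult H h)"
      using * by (intro T.tsum_cong hc) (simp add: A.l_distr T.pure_add_r)
    with * show "tensor_lift T.T (?p a (b \<oplus>\<^bsub>H\<^esub> b')) (comult H h)
        = tensor_lift T.T (?p a b) (comult H h) \<oplus>\<^bsub>T.T\<^esub> tensor_lift T.T (?p a b') (comult H h)"
      by (simp add: inner T.tsum_add T.tensor_group hc T.pure_closed)
  next
    fix a \<kappa> b assume *: "a \<in> carrier H" "\<kappa> \<in> carrier k" "b \<in> carrier H"
    then show "tensor_lift T.T (?p (\<kappa> \<odot>\<^bsub>H\<^esub> a) b) (comult H h)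
        = tensor_lift T.T (?p a (\<kappa> \<odot>\<^bsub>H\<^esub> b)) (comult H h)"
      by (simp add: inner) (intro T.tsum_cong hc, simp add: smult_mult_l T.pure_balanced)
  qed (simp_all add: inner ic)
  have eq: "comult H (g \<otimes>\<^bsub>H\<^esub> h)
      = tsum T.T (\<lambda>a b. tensor_lift T.T (?p a b) (comult H h)) (comult H g)"
    unfolding comult_mult[OF assms(3,4)]
    by (intro T.tensor_lift_tsum T.tensor_group outer comult_closed assms)
  note hom = T.tsum_add_hom[OF G.M.abelian_group_axioms bil_balanced_H[OF assms(2)]]
  have "sw G f (g \<otimes>\<^bsub>H\<^esub> h) = sw G (\<lambda>a b. tsum G f (tensor_lift T.T (?p a b) (comult H h))) g"
    unfolding eq using assms by (intro T.tsum_hom[OF _ _ hom] T.tensor_group comult_closed G.M.abelian_group_axioms)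
      (simp_all add: inner ic)
  also have "\<dots> = sw G (\<lambda>a b. sw G (\<lambda>c d. f (a \<otimes>\<^bsub>H\<^esub> c) (b \<otimes>\<^bsub>H\<^esub> d)) h) g"
  proof (intro sw_cong assms)
    fix a b assume *: "a \<in> carrier H" "b \<in> carrier H"
    have "tsum G f (tsum T.T (?p a b) (comult H h)) = sw G (\<lambda>c d. tsum G f (?p a b c d)) h"
      using * by (intro T.tsum_hom[OF _ _ hom] T.tensor_group hc G.M.abelian_group_axioms T.pure_closed) auto
    also have "\<dots> = sw G (\<lambda>c d. f (a \<otimes>\<^bsub>H\<^esub> c) (b \<otimes>\<^bsub>H\<^esub> d)) h"
      using * by (intro sw_cong assms T.tsum_pure_tensor G.M.abelian_group_axioms bil_balanced_H) auto
    finally show "tsum G f (tensor_lift T.T (?p a b) (comult H h)) = sw G (\<lambda>c d. f (a \<otimes>\<^bsub>H\<^esub> c) (b \<otimes>\<^bsub>H\<^esub> d)) h"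
      using * by (simp add: inner)
  qed
  finally show ?thesis .
qed

lemma sw_one:
  "\<lbrakk>module k G; bil k H H G f\<rbrakk> \<Longrightarrow> sw G f \<one>\<^bsub>H\<^esub> = f \<one>\<^bsub>H\<^esub> \<one>\<^bsub>H\<^esub>"
  unfolding comult_one
  by (intro tensor_pair.tsum_pure_tensor[OF tensor_pair_H] bil_balanced_H module_abelian_group) auto

end

section \<open>Anti-multiplicativity of the antipode by convolution cancellation\<close>

context hopf_algebra
begin

lemma lin_antipode: "lin k M H \<phi> \<Longrightarrow> lin k M H (\<lambda>x. antipode H (\<phi> x))"
  by (auto simp: lin_def add_hom_def antipode_closed antipode_add antipode_smult)

lemmas lin_H = lin_id lin_mult_l[OF k_algebra_H] lin_mult_r[OF k_algebra_H] lin_antipode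

lemma sw_antipode_left:
  "h \<in> carrier H \<Longrightarrow> sw H (\<lambda>a b. antipode H a \<otimes>\<^bsub>H\<^esub> b) h = counit H h \<odot>\<^bsub>H\<^esub> \<one>\<^bsub>H\<^esub>"
  by (subst antipode_left[symmetric], assumption, intro sw_tensor_lift[symmetric] module_H bilI lin_H)
    (simp_all add: antipode_closed)

lemma sw_antipode_right:
  "h \<in> carrier H \<Longrightarrow> sw H (\<lambda>a b. a \<otimes>\<^bsub>H\<^esub> antipode H b) h = counit H h \<odot>\<^bsub>H\<^esub> \<one>\<^bsub>H\<^esub>"
  by (subst antipode_right[symmetric], assumption, intro sw_tensor_lift[symmetric] module_H bilI lin_H)
    (simp_all add: antipode_closed)

text \<open>The left antipode identity at 1, where \<Delta>(1) = 1 \<otimes> 1 and \<epsilon>(1) =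
  1.\<close>

lemma antipode_one: "antipode H \<one>\<^bsub>H\<^esub> = \<one>\<^bsub>H\<^esub>"
proof -
  have "sw H (\<lambda>a b. antipode H a \<otimes>\<^bsub>H\<^esub> b) \<one>\<^bsub>H\<^esub> = antipode H \<one>\<^bsub>H\<^esub> \<otimes>\<^bsub>H\<^esub> \<one>\<^bsub>H\<^esub>"
    by (intro sw_one module_H bilI lin_H) (simp_all add: antipode_closed)
  then show ?thesis
    using sw_antipode_left[of "\<one>\<^bsub>H\<^esub>"] by (simp add: counit_one antipode_closed)
qed

text \<open>This is F(h) = F(h_1) h_2 S(h_3): the antipode is a right convolution inverse of the
  identity map, so F is recovered from its convolution with the identity.\<close>

lemma cancel_right_expand:
  assumes F: "lin k H H F" and h: "h \<in> carrier H"
  shows "F h = sw H (\<lambda>a b. sw H (\<lambda>c d. F c \<otimes>\<^bsub>H\<^esub> d) a \<otimes>\<^bsub>H\<^esub> antipode H b) h"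
proof -
  note [simp] = linD(1)[OF F] antipode_closed counit_closed
  note lin = lin_H lin_comp[OF F]
  have "F h = sw H (\<lambda>a b. counit H b \<odot>\<^bsub>H\<^esub> F a) h"
    by (rule sw_counit_right[OF module_H F h, symmetric])
  also have "\<dots> = sw H (\<lambda>a b. F a \<otimes>\<^bsub>H\<^esub> sw H (\<lambda>p q. p \<otimes>\<^bsub>H\<^esub> antipode H q) b) h"
    by (intro sw_cong h) (simp add: sw_antipode_right smult_mult_r)
  also have "\<dots> = sw H (\<lambda>a b. sw H (\<lambda>p q. F a \<otimes>\<^bsub>H\<^esub> (p \<otimes>\<^bsub>H\<^esub> antipode H q)) b) h"
    by (intro sw_cong h sw_hom module_H lin) simp_all
  also have "\<dots> = sw H (\<lambda>a b. sw H (\<lambda>p q. F p \<otimes>\<^bsub>H\<^esub> (q \<otimes>\<^bsub>H\<^esub> antipode H b)) a) h"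
    by (intro sw_coassoc[symmetric] h module_H lin) simp_all
  also have "\<dots> = sw H (\<lambda>a b. sw H (\<lambda>p q. F p \<otimes>\<^bsub>H\<^esub> q \<otimes>\<^bsub>H\<^esub> antipode H b) a) h"
    by (intro sw_cong h) (simp_all add: A.m_assoc)
  also have "\<dots> = sw H (\<lambda>a b. sw H (\<lambda>c d. F c \<otimes>\<^bsub>H\<^esub> d) a \<otimes>\<^bsub>H\<^esub> antipode H b) h"
    by (intro sw_cong h sw_hom[symmetric] module_H lin) simp_all
  finally show ?thesis .
qed

lemma cancel_right:
  assumes "lin k H H F" "lin k H H F'" "h \<in> carrier H"
    and "\<And>h. h \<in> carrier H \<Longrightarrow> sw H (\<lambda>a b. F a \<otimes>\<^bsub>H\<^esub> b) h = sw H (\<lambda>a b. F' a \<otimes>\<^bsub>H\<^esub> b) h"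
  shows "F h = F' h"
  unfolding cancel_right_expand[OF assms(1,3)] cancel_right_expand[OF assms(2,3)]
  by (intro sw_cong assms(3)) (simp add: assms(4))

text \<open>As functions of g, both S(gh) and S(h) S(g) become \<epsilon>(g) S(h) when convolved
  with the identity. For S(h) S(g) this is the antipode identity (\<open>right\<close>); for S(gh)
  it takes a further cancellation in h (\<open>left\<close>). Cancelling one variable at a time
  spares a convolution algebra on H \<otimes> H.\<close>

lemma antipode_mult:
  assumes "g \<in> carrier H" "h \<in> carrier H"
  shows "antipode H (g \<otimes>\<^bsub>H\<^esub> h) = antipode H h \<otimes>\<^bsub>H\<^esub> antipode H g"
proof -
  note [simp] = antipode_closed counit_closed
  have right: "sw H (\<lambda>a b. antipode H h \<otimes>\<^bsub>H\<^esub> antipode H a \<otimes>\<^bsub>H\<^esub> b) g = counit H g \<odot>\<^bsub>H\<^esub> antipode H h"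
    if "g \<in> carrier H" "h \<in> carrier H" for g h
  proof -
    have "sw H (\<lambda>a b. antipode H h \<otimes>\<^bsub>H\<^esub> antipode H a \<otimes>\<^bsub>H\<^esub> b) g
        = antipode H h \<otimes>\<^bsub>H\<^esub> sw H (\<lambda>a b. antipode H a \<otimes>\<^bsub>H\<^esub> b) g"
      by (subst sw_hom[OF module_H module_H lin_mult_r[OF k_algebra_H _ lin_id]])
        (simp_all add: that A.m_assoc cong: sw_cong)
    then show ?thesis by (simp add: that sw_antipode_left smult_mult_r)
  qed
  have left: "sw H (\<lambda>a b. antipode H (a \<otimes>\<^bsub>H\<^esub> h) \<otimes>\<^bsub>H\<^esub> b) g = counit H g \<odot>\<^bsub>H\<^esub> antipode H h"
    if gh: "g \<in> carrier H" "h \<in> carrier H" for g h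
  proof (rule cancel_right[of "\<lambda>h. sw H (\<lambda>a b. antipode H (a \<otimes>\<^bsub>H\<^esub> h) \<otimes>\<^bsub>H\<^esub> b) g"])
    \<comment> \<open>With g fixed, multiplying by h_2 turns the sum into S((gh)_1) (gh)_2 =
      \<epsilon>(g) \<epsilon>(h), which is also the value of \<epsilon>(g) S(h_1) h_2.\<close>
    fix h assume h: "h \<in> carrier H"
    have "sw H (\<lambda>c d. sw H (\<lambda>a b. antipode H (a \<otimes>\<^bsub>H\<^esub> c) \<otimes>\<^bsub>H\<^esub> b) g \<otimes>\<^bsub>H\<^esub> d) h
        = sw H (\<lambda>c d. sw H (\<lambda>a b. antipode H (a \<otimes>\<^bsub>H\<^esub> c) \<otimes>\<^bsub>H\<^esub> (b \<otimes>\<^bsub>H\<^esub> d)) g) h"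
      by (intro sw_cong h, subst sw_hom[OF module_H module_H lin_mult_l[OF k_algebra_H lin_id]])
        (simp_all add: gh A.m_assoc cong: sw_cong)
    also have "\<dots> = sw H (\<lambda>a b. sw H (\<lambda>c d. antipode H (a \<otimes>\<^bsub>H\<^esub> c) \<otimes>\<^bsub>H\<^esub> (b \<otimes>\<^bsub>H\<^esub> d)) h) g"
      by (intro sw_swap module_H) (simp_all add: gh h)
    also have "\<dots> = sw H (\<lambda>a b. antipode H a \<otimes>\<^bsub>H\<^esub> b) (g \<otimes>\<^bsub>H\<^esub> h)"
      by (intro sw_mult[symmetric] module_H bilI lin_H) (simp_all add: gh h)
    also have "\<dots> = counit H g \<odot>\<^bsub>H\<^esub> sw H (\<lambda>c d. antipode H c \<otimes>\<^bsub>H\<^esub> d) h"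
      by (simp add: gh h sw_antipode_left counit_mult smult_assoc1)
    also have "\<dots> = sw H (\<lambda>c d. counit H g \<odot>\<^bsub>H\<^esub> antipode H c \<otimes>\<^bsub>H\<^esub> d) h"
      by (subst sw_hom[OF module_H module_H lin_smult[OF module_H _ lin_id]])
        (simp_all add: gh h smult_mult_l cong: sw_cong)
    finally show "sw H (\<lambda>c d. sw H (\<lambda>a b. antipode H (a \<otimes>\<^bsub>H\<^esub> c) \<otimes>\<^bsub>H\<^esub> b) g \<otimes>\<^bsub>H\<^esub> d) h
      = sw H (\<lambda>c d. counit H g \<odot>\<^bsub>H\<^esub> antipode H c \<otimes>\<^bsub>H\<^esub> d) h" .
  qed ((intro lin_sw_param module_H lin_H lin_smult; simp add: gh)+, rule gh)
  show ?thesis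
  proof (rule cancel_right[of "\<lambda>g. antipode H (g \<otimes>\<^bsub>H\<^esub> h)"])
    fix g assume "g \<in> carrier H"
    then show "sw H (\<lambda>a b. antipode H (a \<otimes>\<^bsub>H\<^esub> h) \<otimes>\<^bsub>H\<^esub> b) g
      = sw H (\<lambda>a b. antipode H h \<otimes>\<^bsub>H\<^esub> antipode H a \<otimes>\<^bsub>H\<^esub> b) g"
      using assms by (simp add: left right)
  qed ((intro lin_H; simp add: assms)+, rule assms)
qed

end

section \<open>The inverse antipode and the cancellation of H-actions\<close>

locale bij_hopf_algebra = hopf_algebra k H
  for k :: "('k, 'x) ring_scheme" and H :: "('k, 'h, 'y) hopf_scheme" +
  assumes antipode_bij: "bij_betw (antipode H) (carrier H) (carrier H)"
begin

abbreviation S' where "S' \<equiv> inv_into (carrier H) (antipode H)"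

lemma S'_closed: "h \<in> carrier H \<Longrightarrow> S' h \<in> carrier H"
  using antipode_bij by (metis bij_betw_def inv_into_into)

lemma antipode_S': "h \<in> carrier H \<Longrightarrow> antipode H (S' h) = h"
  using antipode_bij by (metis bij_betw_def f_inv_into_f)

lemma antipode_inj: "\<lbrakk>antipode H g = antipode H h; g \<in> carrier H; h \<in> carrier H\<rbrakk> \<Longrightarrow> g = h"
  using antipode_bij by (meson bij_betw_def inj_onD)

lemma S'_add: "\<lbrakk>g \<in> carrier H; h \<in> carrier H\<rbrakk> \<Longrightarrow> S' (g \<oplus>\<^bsub>H\<^esub> h) = S' g \<oplus>\<^bsub>H\<^esub> S' h"
  by (rule antipode_inj) (simp_all add: antipode_S' S'_closed antipode_add)

lemma S'_smult: "\<lbrakk>\<kappa> \<in> carrier k; h \<in> carrier H\<rbrakk> \<Longrightarrow> S' (\<kappa> \<odot>\<^bsub>H\<^esub> h) = \<kappa> \<odot>\<^bsub>H\<^esub> S' h"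
  by (rule antipode_inj) (simp_all add: antipode_S' S'_closed antipode_smult)

lemma S'_mult: "\<lbrakk>g \<in> carrier H; h \<in> carrier H\<rbrakk> \<Longrightarrow> S' (g \<otimes>\<^bsub>H\<^esub> h) = S' h \<otimes>\<^bsub>H\<^esub> S' g"
  by (rule antipode_inj) (simp_all add: antipode_S' S'_closed antipode_mult)

lemma S'_one: "S' \<one>\<^bsub>H\<^esub> = \<one>\<^bsub>H\<^esub>"
  by (rule antipode_inj) (simp_all add: antipode_S' S'_closed antipode_one)

lemma lin_S': "lin k M H \<phi> \<Longrightarrow> lin k M H (\<lambda>x. S' (\<phi> x))"
  by (auto simp: lin_def add_hom_def S'_closed S'_add S'_smult)

text \<open>Injectivity of S allows comparing images under S, where anti-multiplicativity turns h_2
  \<open>S'\<close>(h_1) into h_1 S(h_2). The companion \<open>sw_S'_right\<close> reduces to S(h_1)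
  h_2 in the same way.\<close>

lemma sw_S'_left:
  assumes h: "h \<in> carrier H"
  shows "sw H (\<lambda>a b. b \<otimes>\<^bsub>H\<^esub> S' a) h = counit H h \<odot>\<^bsub>H\<^esub> \<one>\<^bsub>H\<^esub>"
proof (rule antipode_inj)
  have "antipode H (sw H (\<lambda>a b. b \<otimes>\<^bsub>H\<^esub> S' a) h) = sw H (\<lambda>a b. antipode H (b \<otimes>\<^bsub>H\<^esub> S' a)) h"
    by (intro sw_hom module_H lin_H h) (simp add: S'_closed)
  also have "\<dots> = sw H (\<lambda>a b. a \<otimes>\<^bsub>H\<^esub> antipode H b) h"
    by (intro sw_cong h) (simp add: antipode_mult antipode_S' S'_closed)
  finally show "antipode H (sw H (\<lambda>a b. b \<otimes>\<^bsub>H\<^esub> S' a) h) = antipode H (counit H h \<odot>\<^bsub>H\<^esub> \<one>\<^bsub>H\<^esub>)"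
    by (simp add: h sw_antipode_right antipode_smult antipode_one counit_closed)
qed (simp_all add: h counit_closed sw_closed module_H S'_closed)

lemma sw_S'_right:
  assumes h: "h \<in> carrier H"
  shows "sw H (\<lambda>a b. S' b \<otimes>\<^bsub>H\<^esub> a) h = counit H h \<odot>\<^bsub>H\<^esub> \<one>\<^bsub>H\<^esub>"
proof (rule antipode_inj)
  have "antipode H (sw H (\<lambda>a b. S' b \<otimes>\<^bsub>H\<^esub> a) h) = sw H (\<lambda>a b. antipode H (S' b \<otimes>\<^bsub>H\<^esub> a)) h"
    by (intro sw_hom module_H lin_H h) (simp add: S'_closed)
  also have "\<dots> = sw H (\<lambda>a b. antipode H a \<otimes>\<^bsub>H\<^esub> b) h"
    by (intro sw_cong h) (simp add: antipode_mult antipode_S' S'_closed)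
  finally show "antipode H (sw H (\<lambda>a b. S' b \<otimes>\<^bsub>H\<^esub> a) h) = antipode H (counit H h \<odot>\<^bsub>H\<^esub> \<one>\<^bsub>H\<^esub>)"
    by (simp add: h sw_antipode_left antipode_smult antipode_one counit_closed)
qed (simp_all add: h counit_closed sw_closed module_H S'_closed)

text \<open>Since \<open>h\<^sub>2 S\<inverse>(h\<^sub>1) = \<epsilon>(h)\<close>, the map \<open>h \<otimes> v \<mapsto> h\<^sub>1 v \<otimes> h\<^sub>2\<close> is invertible. Cancelling it
  replaces every use of the compatibility of \<open>S\<inverse>\<close> with the comultiplication.\<close>

lemma cancel_action_expand:
  assumes V: "k_left_module k H V act" and W: "module k W"
    and F1: "\<And>v. v \<in> carrier V \<Longrightarrow> lin k H W (\<lambda>h. F h v)"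
    and F2: "\<And>h. h \<in> carrier H \<Longrightarrow> lin k V W (F h)"
    and h: "h \<in> carrier H" and v: "v \<in> carrier V"
  shows "F h v = sw W (\<lambda>a b. sw W (\<lambda>c d. F d (act c (act (S' a) v))) b) h"
proof -
  interpret V: k_left_module k H V act by fact
  interpret VM: module k V by (rule V.MM.module_axioms)
  have mV: "module k V" by (rule V.MM.module_axioms)
  note [simp] = V.lact_closed linD(1)[OF F2] counit_closed S'_closed
  have lF: "lin k M W (\<lambda>x. F (\<phi> x) v)" if "lin k M H \<phi>" "v \<in> carrier V" for M v \<phi>
    by (rule lin_comp[OF F1 that(1)]) (rule that)
  have lF': "lin k M W (\<lambda>x. F h (\<phi> x))" if "lin k M V \<phi>" "h \<in> carrier H" for M h \<phi>
    by (rule lin_comp[OF F2 that(1)]) (rule that)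
  note lin = lin_H lin_S' lF lF' lin_module_l[OF V] lin_module_r[OF V]
  have "F h v = sw W (\<lambda>a b. counit H a \<odot>\<^bsub>W\<^esub> F b v) h"
    by (rule sw_counit_left[OF W F1[OF v] h, symmetric])
  also have "\<dots> = sw W (\<lambda>a b. F b (act (sw H (\<lambda>p q. q \<otimes>\<^bsub>H\<^esub> S' p) a) v)) h"
    using v linD(3)[OF F2]
    by (intro sw_cong h) (simp add: sw_S'_left V.lact_smult V.lact_one)
  also have "\<dots> = sw W (\<lambda>a b. sw W (\<lambda>p q. F b (act (q \<otimes>\<^bsub>H\<^esub> S' p) v)) a) h"
    using v by (intro sw_cong h sw_hom module_H W lin) simp_all
  also have "\<dots> = sw W (\<lambda>a b. sw W (\<lambda>p q. F b (act q (act (S' p) v))) a) h"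
    using v by (intro sw_cong h) (simp_all add: V.lact_mult)
  also have "\<dots> = sw W (\<lambda>a b. sw W (\<lambda>c d. F d (act c (act (S' a) v))) b) h"
    using v by (intro sw_coassoc h W lin) simp_all
  finally show ?thesis .
qed

text \<open>In the expansion of \<open>F h v\<close> the inner sum is the assumed one, taken at h_2
  and the vector \<open>S'\<close>(h_1) v; hence F enters only through such sums.\<close>

lemma cancel_action:
  assumes V: "k_left_module k H V act" and W: "module k W"
    and "\<And>v. v \<in> carrier V \<Longrightarrow> lin k H W (\<lambda>h. F h v)" "\<And>h. h \<in> carrier H \<Longrightarrow> lin k V W (F h)"
    and "\<And>v. v \<in> carrier V \<Longrightarrow> lin k H W (\<lambda>h. F' h v)" "\<And>h. h \<in> carrier H \<Longrightarrow> lin k V W (F' h)"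
    and eq: "\<And>h v. \<lbrakk>h \<in> carrier H; v \<in> carrier V\<rbrakk>
      \<Longrightarrow> sw W (\<lambda>a b. F b (act a v)) h = sw W (\<lambda>a b. F' b (act a v)) h"
    and h: "h \<in> carrier H" and v: "v \<in> carrier V"
  shows "F h v = F' h v"
proof -
  interpret V: k_left_module k H V act by fact
  have "F h v = sw W (\<lambda>a b. sw W (\<lambda>c d. F d (act c (act (S' a) v))) b) h"
    by (rule cancel_action_expand[OF V W assms(3,4) h v])
  also have "\<dots> = sw W (\<lambda>a b. sw W (\<lambda>c d. F' d (act c (act (S' a) v))) b) h"
    using v by (intro sw_cong h eq) (simp_all add: V.lact_closed S'_closed)
  also have "\<dots> = F' h v"
    by (rule cancel_action_expand[OF V W assms(5,6) h v, symmetric])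
  finally show ?thesis .
qed

end

section \<open>The smash product and its modules\<close>

text \<open>The module algebra is assumed as a fact about \<open>R\<close> instead of being extended
  as a locale: over one H the development is used with both A and the left dual in place of
  \<open>R\<close>.\<close>

locale smash_product = hopf_algebra k H
  for k :: "('k, 'x) ring_scheme" and H :: "('k, 'h, 'y) hopf_scheme" +
  fixes R :: "('k, 'r, 'z) module_scheme" and hR :: "'h \<Rightarrow> 'r \<Rightarrow> 'r"
  assumes module_algebra: "module_algebra k H R hR"
begin

lemma algebra_R: "k_algebra k R"
  by (rule module_algebra.axioms(2)[OF module_algebra])

lemma module_R: "module k R"
  by (rule k_algebra.axioms(1)[OF algebra_R])

lemma action_R: "k_left_module k H R hR"
  by (rule module_algebra.axioms(3)[OF module_algebra])

lemma left_module_R: "left_module H R hR"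
  using action_R by (simp add: k_left_module_def)

sublocale RR: ring R
  by (rule k_algebra.axioms(2)[OF algebra_R])

sublocale kR: module k R
  by (rule module_R)

lemma hR_closed [simp]: "\<lbrakk>h \<in> carrier H; a \<in> carrier R\<rbrakk> \<Longrightarrow> hR h a \<in> carrier R"
  by (rule left_module.lact_closed[OF left_module_R])

lemma hR_mult: "\<lbrakk>g \<in> carrier H; h \<in> carrier H; a \<in> carrier R\<rbrakk> \<Longrightarrow> hR (g \<otimes>\<^bsub>H\<^esub> h) a = hR g (hR h a)"
  by (rule left_module.lact_mult[OF left_module_R])

lemma hR_unit: "a \<in> carrier R \<Longrightarrow> hR \<one>\<^bsub>H\<^esub> a = a"
  by (rule left_module.lact_one[OF left_module_R])

lemma hR_one: "h \<in> carrier H \<Longrightarrow> hR h \<one>\<^bsub>R\<^esub> = counit H h \<odot>\<^bsub>R\<^esub> \<one>\<^bsub>R\<^esub>"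
  by (rule module_algebra.hact_one[OF module_algebra])

lemmas lin_R = lin_H lin_mult_l[OF algebra_R] lin_mult_r[OF algebra_R]
  lin_module_l[OF action_R] lin_module_r[OF action_R]

lemma hR_prod: "\<lbrakk>h \<in> carrier H; a \<in> carrier R; b \<in> carrier R\<rbrakk>
    \<Longrightarrow> hR h (a \<otimes>\<^bsub>R\<^esub> b) = sw R (\<lambda>p q. hR p a \<otimes>\<^bsub>R\<^esub> hR q b) h"
  by (subst module_algebra.hact_mult[OF module_algebra], assumption+,
      intro sw_tensor_lift module_R bilI lin_R) simp_all

abbreviation B where "B \<equiv> op_smash k H R hR"

sublocale RH: tensor_pair k R "\<lambda>a \<kappa>. \<kappa> \<odot>\<^bsub>R\<^esub> a" H "\<lambda>\<kappa> h. \<kappa> \<odot>\<^bsub>H\<^esub> h"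
  by (rule tensor_pair_module[OF module_R module_H])

lemma B_carrier [simp]: "carrier B = carrier RH.T"
  and B_add: "ring.add B = ring.add RH.T"
  and B_zero: "\<zero>\<^bsub>B\<^esub> = \<zero>\<^bsub>RH.T\<^esub>"
  and B_one: "\<one>\<^bsub>B\<^esub> = RH.pure \<one>\<^bsub>R\<^esub> \<one>\<^bsub>H\<^esub>"
  by (simp_all add: op_smash_def Let_def)

lemma B_smult: "smult B \<kappa> = tensor_lift RH.T (\<lambda>a h. RH.pure (\<kappa> \<odot>\<^bsub>R\<^esub> a) h)"
  by (simp add: op_smash_def Let_def)

lemma smult_comm_R: "\<lbrakk>\<kappa> \<in> carrier k; m \<in> carrier R; a \<in> carrier k\<rbrakk>
    \<Longrightarrow> a \<odot>\<^bsub>R\<^esub> (\<kappa> \<odot>\<^bsub>R\<^esub> m) = \<kappa> \<odot>\<^bsub>R\<^esub> (a \<odot>\<^bsub>R\<^esub> m)"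
  by (simp add: kR.smult_assoc1[symmetric] R.m_comm)

lemma module_B: "module k B"
  by (rule RH.tensor_module(1)[OF module_R refl refl smult_comm_R B_carrier B_add B_zero B_smult])

lemma smult_pure: "\<lbrakk>\<kappa> \<in> carrier k; a \<in> carrier R; h \<in> carrier H\<rbrakk>
    \<Longrightarrow> \<kappa> \<odot>\<^bsub>B\<^esub> RH.pure a h = RH.pure (\<kappa> \<odot>\<^bsub>R\<^esub> a) h"
  by (rule RH.tensor_module(2)[OF module_R refl refl smult_comm_R B_carrier B_add B_zero B_smult])

sublocale kB: module k B
  by (rule module_B)

lemma B_tsum: "tsum RH.T f X = tsum B f X"
  by (rule tsum_record_cong) (simp_all add: B_add B_zero)

lemma pure_closed [simp]: "\<lbrakk>a \<in> carrier R; h \<in> carrier H\<rbrakk> \<Longrightarrow> RH.pure a h \<in> carrier RH.T"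
  by (rule RH.pure_closed)

lemma lin_pure_l: "\<lbrakk>lin k V R \<phi>; h \<in> carrier H\<rbrakk> \<Longrightarrow> lin k V B (\<lambda>x. RH.pure (\<phi> x) h)"
  by (simp add: lin_def add_hom_def RH.pure_add_l B_add smult_pure)

lemma lin_pure_r: "\<lbrakk>a \<in> carrier R; lin k V H \<phi>\<rbrakk> \<Longrightarrow> lin k V B (\<lambda>x. RH.pure a (\<phi> x))"
  by (simp add: lin_def add_hom_def RH.pure_add_r B_add smult_pure RH.pure_balanced)

lemmas lin_B = lin_R lin_pure_l lin_pure_r

lemma bil_balanced_RH: "bil k R H G f \<Longrightarrow> RH.balanced G f"
  by (rule bil_balanced[OF module_R module_H])

abbreviation pure_mult where
  "pure_mult \<equiv> \<lambda>a h b g. sw B (\<lambda>h\<^sub>1 h\<^sub>2. RH.pure (hR h\<^sub>2 b \<otimes>\<^bsub>R\<^esub> a) (h\<^sub>1 \<otimes>\<^bsub>H\<^esub> g)) h"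

lemma lin_pure_mult:
  assumes "a \<in> carrier R" "h \<in> carrier H" "b \<in> carrier R" "g \<in> carrier H"
  shows "lin k R B (\<lambda>a. pure_mult a h b g)" "lin k H B (\<lambda>h. pure_mult a h b g)"
    "lin k R B (\<lambda>b. pure_mult a h b g)" "lin k H B (\<lambda>g. pure_mult a h b g)"
  using assms by (intro lin_sw_param lin_sw_arg bilI module_B lin_B; simp)+

lemma bil_pure_mult: "\<lbrakk>a \<in> carrier R; h \<in> carrier H\<rbrakk> \<Longrightarrow> bil k R H B (pure_mult a h)"
  by (intro bilI lin_pure_mult)

lemma bil_pure_mult': "Y \<in> carrier RH.T \<Longrightarrow> bil k R H B (\<lambda>a h. tsum B (pure_mult a h) Y)"
  by (intro bilI RH.lin_tsum_param[where f = "\<lambda>h b g. pure_mult _ h b g"]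
      RH.lin_tsum_param[where f = "\<lambda>a b g. pure_mult a _ b g"] module_B lin_pure_mult)

lemma balanced_cong: "(\<And>m n. \<lbrakk>m \<in> carrier R; n \<in> carrier H\<rbrakk> \<Longrightarrow> f m n = g m n)
    \<Longrightarrow> RH.balanced G f \<longleftrightarrow> RH.balanced G g"
  by (simp add: RH.balanced_def add_hom_def)

lemma balanced_B: "RH.balanced B f \<longleftrightarrow> RH.balanced RH.T f"
  by (simp add: RH.balanced_def add_hom_def B_add)

text \<open>Each of the three nested lifts in \<open>op_smash\<close> has a meaning only for a
  balanced map. They are resolved from the inside, because balancedness of the map under an outer
  lift is checked on the finite sum that the inner lift has become.\<close>

lemma B_mult:
  assumes "X \<in> carrier RH.T" "Y \<in> carrier RH.T"
  shows "X \<otimes>\<^bsub>B\<^esub> Y = tsum B (\<lambda>a h. tsum B (pure_mult a h) Y) X"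
proof -
  let ?p = "\<lambda>a b g h\<^sub>1 h\<^sub>2. RH.pure (hR h\<^sub>2 b \<otimes>\<^bsub>R\<^esub> a) (h\<^sub>1 \<otimes>\<^bsub>H\<^esub> g)"
  let ?l = "\<lambda>a h b g. tensor_lift RH.T (?p a b g) (comult H h)"
  have 1: "?l a h b g = pure_mult a h b g"
    if "a \<in> carrier R" "h \<in> carrier H" "b \<in> carrier R" "g \<in> carrier H" for a h b g
  proof -
    interpret HH: tensor_pair k H "\<lambda>h \<kappa>. \<kappa> \<odot>\<^bsub>H\<^esub> h" H "\<lambda>\<kappa> h. \<kappa> \<odot>\<^bsub>H\<^esub> h" by (rule tensor_pair_H)
    have "HH.balanced B (?p a b g)"
      using that by (intro bil_balanced_H bilI lin_B) simp_all
    then have "HH.balanced RH.T (?p a b g)"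
      by (simp add: HH.balanced_def add_hom_def B_add)
    then show ?thesis
      unfolding B_tsum[symmetric]
      using that by (intro HH.tensor_lift_tsum RH.tensor_group comult_closed)
  qed
  have 2: "tensor_lift RH.T (?l a h) Y = tsum B (pure_mult a h) Y"
    if "a \<in> carrier R" "h \<in> carrier H" for a h
  proof -
    have "RH.balanced RH.T (?l a h)"
      using bil_balanced_RH[OF bil_pure_mult[OF that]] that
      by (simp add: balanced_B 1 cong: balanced_cong)
    then have "tensor_lift RH.T (?l a h) Y = tsum RH.T (?l a h) Y"
      by (intro RH.tensor_lift_tsum RH.tensor_group assms)
    also have "\<dots> = tsum B (pure_mult a h) Y"
      unfolding B_tsum by (intro RH.tsum_cong assms 1 that)
    finally show ?thesis .
  qed
  have "RH.balanced RH.T (\<lambda>a h. tensor_lift RH.T (?l a h) Y)"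
    using bil_balanced_RH[OF bil_pure_mult'[OF assms(2)]]
    by (simp add: balanced_B 2 cong: balanced_cong)
  then have "tensor_lift RH.T (\<lambda>a h. tensor_lift RH.T (?l a h) Y) X
      = tsum RH.T (\<lambda>a h. tensor_lift RH.T (?l a h) Y) X"
    by (intro RH.tensor_lift_tsum RH.tensor_group assms)
  also have "\<dots> = tsum B (\<lambda>a h. tsum B (pure_mult a h) Y) X"
    unfolding B_tsum by (intro RH.tsum_cong assms 2)
  finally show ?thesis
    by (simp add: op_smash_def Let_def)
qed

lemma abelian_group_B: "abelian_group B"
  by (rule kB.M.abelian_group_axioms)

lemma B_closed [simp]: "\<lbrakk>X \<in> carrier RH.T; Y \<in> carrier RH.T\<rbrakk> \<Longrightarrow> X \<otimes>\<^bsub>B\<^esub> Y \<in> carrier RH.T"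
  using RH.tsum_closed[OF abelian_group_B, of X "\<lambda>a h. tsum B (pure_mult a h) Y"]
    bilD(3)[OF bil_pure_mult'] by (simp add: B_mult)

lemma B_mult_add_l: "\<lbrakk>X \<in> carrier RH.T; Y \<in> carrier RH.T; Z \<in> carrier RH.T\<rbrakk>
    \<Longrightarrow> (X \<oplus>\<^bsub>B\<^esub> Y) \<otimes>\<^bsub>B\<^esub> Z = X \<otimes>\<^bsub>B\<^esub> Z \<oplus>\<^bsub>B\<^esub> Y \<otimes>\<^bsub>B\<^esub> Z"
  using RH.tsum_tensor_add[OF abelian_group_B bil_balanced_RH[OF bil_pure_mult'], of Z X Y]
    kB.M.a_closed[of X Y] by (simp add: B_mult B_add)

lemma tsum_bil_add: "\<lbrakk>module k G; bil k R H G f; X \<in> carrier RH.T; Y \<in> carrier RH.T\<rbrakk>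
    \<Longrightarrow> tsum G f (X \<oplus>\<^bsub>B\<^esub> Y) = tsum G f X \<oplus>\<^bsub>G\<^esub> tsum G f Y"
  unfolding B_add by (intro RH.tsum_tensor_add bil_balanced_RH module_abelian_group)

lemma tsum_bil_pure: "\<lbrakk>module k G; bil k R H G f; a \<in> carrier R; h \<in> carrier H\<rbrakk>
    \<Longrightarrow> tsum G f (RH.pure a h) = f a h"
  by (intro RH.tsum_pure_tensor bil_balanced_RH module_abelian_group)

lemma tsum_bil_closed: "\<lbrakk>module k G; bil k R H G f; X \<in> carrier RH.T\<rbrakk> \<Longrightarrow> tsum G f X \<in> carrier G"
  by (rule RH.tsum_closed) (auto simp: module_abelian_group dest: bilD(3))

lemma B_mult_add_r:
  assumes "X \<in> carrier RH.T" "Y \<in> carrier RH.T" "Z \<in> carrier RH.T"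
  shows "X \<otimes>\<^bsub>B\<^esub> (Y \<oplus>\<^bsub>B\<^esub> Z) = X \<otimes>\<^bsub>B\<^esub> Y \<oplus>\<^bsub>B\<^esub> X \<otimes>\<^bsub>B\<^esub> Z"
proof -
  have "tsum B (\<lambda>a h. tsum B (pure_mult a h) (Y \<oplus>\<^bsub>B\<^esub> Z)) X
      = tsum B (\<lambda>a h. tsum B (pure_mult a h) Y \<oplus>\<^bsub>B\<^esub> tsum B (pure_mult a h) Z) X"
    using assms by (intro RH.tsum_cong tsum_bil_add module_B bil_pure_mult)
  also have "\<dots> = tsum B (\<lambda>a h. tsum B (pure_mult a h) Y) X \<oplus>\<^bsub>B\<^esub> tsum B (\<lambda>a h. tsum B (pure_mult a h) Z) X"
    using assms by (intro RH.tsum_add abelian_group_B tsum_bil_closed module_B bil_pure_mult)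
  finally show ?thesis
    using assms kB.M.a_closed[of Y Z] by (simp add: B_mult)
qed

lemma B_mult_pure: "\<lbrakk>a \<in> carrier R; h \<in> carrier H; b \<in> carrier R; g \<in> carrier H\<rbrakk>
    \<Longrightarrow> RH.pure a h \<otimes>\<^bsub>B\<^esub> RH.pure b g = pure_mult a h b g"
  by (simp add: B_mult tsum_bil_pure module_B bil_pure_mult bil_pure_mult')

text \<open>Reduction to pure tensors, applied below to one variable at a time in identities that
  are additive in each variable.\<close>

lemma B_ext:
  assumes "module k G" "\<And>X. X \<in> carrier RH.T \<Longrightarrow> \<phi> X \<in> carrier G" "\<And>X. X \<in> carrier RH.T \<Longrightarrow> \<psi> X \<in> carrier G"
    "\<And>X Y. \<lbrakk>X \<in> carrier RH.T; Y \<in> carrier RH.T\<rbrakk> \<Longrightarrow> \<phi> (X \<oplus>\<^bsub>B\<^esub> Y) = \<phi> X \<oplus>\<^bsub>G\<^esub> \<phi> Y"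
    "\<And>X Y. \<lbrakk>X \<in> carrier RH.T; Y \<in> carrier RH.T\<rbrakk> \<Longrightarrow> \<psi> (X \<oplus>\<^bsub>B\<^esub> Y) = \<psi> X \<oplus>\<^bsub>G\<^esub> \<psi> Y"
    "\<And>a h. \<lbrakk>a \<in> carrier R; h \<in> carrier H\<rbrakk> \<Longrightarrow> \<phi> (RH.pure a h) = \<psi> (RH.pure a h)"
    "X \<in> carrier RH.T"
  shows "\<phi> X = \<psi> X"
  by (rule RH.tensor_ext[where \<phi> = \<phi> and \<psi> = \<psi>, OF module_abelian_group[OF assms(1)] _ _ assms(6,7)])
    (use assms(2-5) in \<open>simp_all add: add_hom_def B_add\<close>)

lemma B_add_closed [simp]: "\<lbrakk>X \<in> carrier RH.T; Y \<in> carrier RH.T\<rbrakk> \<Longrightarrow> X \<oplus>\<^bsub>B\<^esub> Y \<in> carrier RH.T"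
  using kB.M.a_closed[of X Y] by simp

lemma B_smult_closed [simp]: "\<lbrakk>\<kappa> \<in> carrier k; Y \<in> carrier RH.T\<rbrakk> \<Longrightarrow> \<kappa> \<odot>\<^bsub>B\<^esub> Y \<in> carrier RH.T"
  using kB.smult_closed[of \<kappa> Y] by simp

lemma B_smult_add: "\<lbrakk>\<kappa> \<in> carrier k; X \<in> carrier RH.T; Y \<in> carrier RH.T\<rbrakk>
    \<Longrightarrow> \<kappa> \<odot>\<^bsub>B\<^esub> (X \<oplus>\<^bsub>B\<^esub> Y) = \<kappa> \<odot>\<^bsub>B\<^esub> X \<oplus>\<^bsub>B\<^esub> \<kappa> \<odot>\<^bsub>B\<^esub> Y"
  using kB.smult_r_distr[of \<kappa> X Y] by simp

lemma B_smult_mult_l: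
  assumes "\<kappa> \<in> carrier k" "X \<in> carrier RH.T" "Y \<in> carrier RH.T"
  shows "(\<kappa> \<odot>\<^bsub>B\<^esub> X) \<otimes>\<^bsub>B\<^esub> Y = \<kappa> \<odot>\<^bsub>B\<^esub> (X \<otimes>\<^bsub>B\<^esub> Y)"
proof (rule B_ext[where \<phi> = "\<lambda>X. (\<kappa> \<odot>\<^bsub>B\<^esub> X) \<otimes>\<^bsub>B\<^esub> Y"
      and \<psi> = "\<lambda>X. \<kappa> \<odot>\<^bsub>B\<^esub> (X \<otimes>\<^bsub>B\<^esub> Y)", OF module_B _ _ _ _ _ assms(2)])
  fix a h assume ah: "a \<in> carrier R" "h \<in> carrier H"
  show "(\<kappa> \<odot>\<^bsub>B\<^esub> RH.pure a h) \<otimes>\<^bsub>B\<^esub> Y = \<kappa> \<odot>\<^bsub>B\<^esub> (RH.pure a h \<otimes>\<^bsub>B\<^esub> Y)"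
  proof (rule B_ext[where \<phi> = "\<lambda>Y. (\<kappa> \<odot>\<^bsub>B\<^esub> RH.pure a h) \<otimes>\<^bsub>B\<^esub> Y"
      and \<psi> = "\<lambda>Y. \<kappa> \<odot>\<^bsub>B\<^esub> (RH.pure a h \<otimes>\<^bsub>B\<^esub> Y)", OF module_B _ _ _ _ _ assms(3)])
    fix b g assume "b \<in> carrier R" "g \<in> carrier H"
    with ah assms(1) show "(\<kappa> \<odot>\<^bsub>B\<^esub> RH.pure a h) \<otimes>\<^bsub>B\<^esub> RH.pure b g = \<kappa> \<odot>\<^bsub>B\<^esub> (RH.pure a h \<otimes>\<^bsub>B\<^esub> RH.pure b g)"
      using linD(3)[OF lin_pure_mult(1)[of a h b g]] by (simp add: smult_pure B_mult_pure)
  qed (use ah assms in \<open>simp_all add: B_mult_add_r B_smult_add\<close>)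
qed (use assms in \<open>simp_all add: B_mult_add_l B_smult_add\<close>)

lemma B_smult_mult_r:
  assumes "\<kappa> \<in> carrier k" "X \<in> carrier RH.T" "Y \<in> carrier RH.T"
  shows "X \<otimes>\<^bsub>B\<^esub> (\<kappa> \<odot>\<^bsub>B\<^esub> Y) = \<kappa> \<odot>\<^bsub>B\<^esub> (X \<otimes>\<^bsub>B\<^esub> Y)"
proof (rule B_ext[where \<phi> = "\<lambda>X. X \<otimes>\<^bsub>B\<^esub> (\<kappa> \<odot>\<^bsub>B\<^esub> Y)"
      and \<psi> = "\<lambda>X. \<kappa> \<odot>\<^bsub>B\<^esub> (X \<otimes>\<^bsub>B\<^esub> Y)", OF module_B _ _ _ _ _ assms(2)])
  fix a h assume ah: "a \<in> carrier R" "h \<in> carrier H"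
  show "RH.pure a h \<otimes>\<^bsub>B\<^esub> (\<kappa> \<odot>\<^bsub>B\<^esub> Y) = \<kappa> \<odot>\<^bsub>B\<^esub> (RH.pure a h \<otimes>\<^bsub>B\<^esub> Y)"
  proof (rule B_ext[where \<phi> = "\<lambda>Y. RH.pure a h \<otimes>\<^bsub>B\<^esub> (\<kappa> \<odot>\<^bsub>B\<^esub> Y)"
      and \<psi> = "\<lambda>Y. \<kappa> \<odot>\<^bsub>B\<^esub> (RH.pure a h \<otimes>\<^bsub>B\<^esub> Y)", OF module_B _ _ _ _ _ assms(3)])
    fix b g assume "b \<in> carrier R" "g \<in> carrier H"
    with ah assms(1) show "RH.pure a h \<otimes>\<^bsub>B\<^esub> (\<kappa> \<odot>\<^bsub>B\<^esub> RH.pure b g) = \<kappa> \<odot>\<^bsub>B\<^esub> (RH.pure a h \<otimes>\<^bsub>B\<^esub> RH.pure b g)"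
      using linD(3)[OF lin_pure_mult(3)[of a h b g]] by (simp add: smult_pure B_mult_pure)
  qed (use ah assms in \<open>simp_all add: B_mult_add_r B_smult_add\<close>)
qed (use assms in \<open>simp_all add: B_mult_add_l B_smult_add\<close>)

lemma lin_B_mult_l: "\<lbrakk>lin k V B \<phi>; Y \<in> carrier RH.T\<rbrakk> \<Longrightarrow> lin k V B (\<lambda>x. \<phi> x \<otimes>\<^bsub>B\<^esub> Y)"
  by (simp add: lin_def add_hom_def B_mult_add_l B_smult_mult_l)

lemma lin_B_mult_r: "\<lbrakk>Y \<in> carrier RH.T; lin k V B \<phi>\<rbrakk> \<Longrightarrow> lin k V B (\<lambda>x. Y \<otimes>\<^bsub>B\<^esub> \<phi> x)"
  by (simp add: lin_def add_hom_def B_mult_add_r B_smult_mult_r)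

text \<open>Both bracketings equal (h_2 h'_2 a'') (h_3 a') a # h_1 h'_1 h''. From the left this
  comes from multiplicativity of \<Delta> on h_1 h', from the right from the action of h_2 on the
  product (h'_2 a'') a'; coassociativity in h matches the numbering.\<close>

lemma B_assoc_pure:
  assumes "a \<in> carrier R" "h \<in> carrier H" "a' \<in> carrier R" "h' \<in> carrier H" "a'' \<in> carrier R" "h'' \<in> carrier H"
  shows "(RH.pure a h \<otimes>\<^bsub>B\<^esub> RH.pure a' h') \<otimes>\<^bsub>B\<^esub> RH.pure a'' h''
    = RH.pure a h \<otimes>\<^bsub>B\<^esub> (RH.pure a' h' \<otimes>\<^bsub>B\<^esub> RH.pure a'' h'')"
proof -
  note [simp] = assms
  let ?p = "\<lambda>h\<^sub>1 h\<^sub>2 h\<^sub>3 h'\<^sub>1 h'\<^sub>2. RH.pure (hR h\<^sub>2 (hR h'\<^sub>2 a'') \<otimes>\<^bsub>R\<^esub> (hR h\<^sub>3 a' \<otimes>\<^bsub>R\<^esub> a)) (h\<^sub>1 \<otimes>\<^bsub>H\<^esub> (h'\<^sub>1 \<otimes>\<^bsub>H\<^esub> h''))"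
  have "(RH.pure a h \<otimes>\<^bsub>B\<^esub> RH.pure a' h') \<otimes>\<^bsub>B\<^esub> RH.pure a'' h''
      = sw B (\<lambda>h\<^sub>1 h\<^sub>2. RH.pure (hR h\<^sub>2 a' \<otimes>\<^bsub>R\<^esub> a) (h\<^sub>1 \<otimes>\<^bsub>H\<^esub> h') \<otimes>\<^bsub>B\<^esub> RH.pure a'' h'') h"
    by (subst B_mult_pure, simp_all, intro sw_hom[OF module_B module_B] lin_B_mult_l lin_id) simp_all
  also have "\<dots> = sw B (\<lambda>h\<^sub>1 h\<^sub>2. pure_mult (hR h\<^sub>2 a' \<otimes>\<^bsub>R\<^esub> a) (h\<^sub>1 \<otimes>\<^bsub>H\<^esub> h') a'' h'') h"
    by (intro sw_cong B_mult_pure) simp_all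
  also have "\<dots> = sw B (\<lambda>h\<^sub>1 h\<^sub>2. sw B (\<lambda>p q. sw B (\<lambda>h'\<^sub>1 h'\<^sub>2.
      RH.pure (hR (q \<otimes>\<^bsub>H\<^esub> h'\<^sub>2) a'' \<otimes>\<^bsub>R\<^esub> (hR h\<^sub>2 a' \<otimes>\<^bsub>R\<^esub> a)) (p \<otimes>\<^bsub>H\<^esub> h'\<^sub>1 \<otimes>\<^bsub>H\<^esub> h'')) h') h\<^sub>1) h"
    by (intro sw_cong sw_mult module_B bilI lin_B) simp_all
  also have "\<dots> = sw B (\<lambda>h\<^sub>1 h\<^sub>2. sw B (\<lambda>p q. sw B (\<lambda>h'\<^sub>1 h'\<^sub>2. ?p p q h\<^sub>2 h'\<^sub>1 h'\<^sub>2) h') h\<^sub>1) h"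
    by (intro sw_cong) (simp_all add: hR_mult A.m_assoc)
  also have "\<dots> = sw B (\<lambda>h\<^sub>1 h\<^sub>2. sw B (\<lambda>p q. sw B (\<lambda>h'\<^sub>1 h'\<^sub>2. ?p h\<^sub>1 p q h'\<^sub>1 h'\<^sub>2) h') h\<^sub>2) h"
    by (intro sw_coassoc module_B lin_sw_param lin_B) simp_all
  also have "\<dots> = sw B (\<lambda>h\<^sub>1 h\<^sub>2. sw B (\<lambda>h'\<^sub>1 h'\<^sub>2. sw B (\<lambda>p q. ?p h\<^sub>1 p q h'\<^sub>1 h'\<^sub>2) h\<^sub>2) h') h"
    by (intro sw_cong sw_swap module_B) simp_all
  also have "\<dots> = sw B (\<lambda>h'\<^sub>1 h'\<^sub>2. sw B (\<lambda>h\<^sub>1 h\<^sub>2. sw B (\<lambda>p q. ?p h\<^sub>1 p q h'\<^sub>1 h'\<^sub>2) h\<^sub>2) h) h'"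
    by (intro sw_swap module_B) (use sw_closed[OF module_B] in simp_all)
  also have "\<dots> = sw B (\<lambda>h'\<^sub>1 h'\<^sub>2. pure_mult a h (hR h'\<^sub>2 a'' \<otimes>\<^bsub>R\<^esub> a') (h'\<^sub>1 \<otimes>\<^bsub>H\<^esub> h'')) h'"
  proof (intro sw_cong)
    fix h'\<^sub>1 h'\<^sub>2 h\<^sub>1 h\<^sub>2 assume [simp]: "h'\<^sub>1 \<in> carrier H" "h'\<^sub>2 \<in> carrier H" "h\<^sub>1 \<in> carrier H" "h\<^sub>2 \<in> carrier H"
    have "sw B (\<lambda>p q. ?p h\<^sub>1 p q h'\<^sub>1 h'\<^sub>2) h\<^sub>2
        = sw B (\<lambda>p q. RH.pure (hR p (hR h'\<^sub>2 a'') \<otimes>\<^bsub>R\<^esub> hR q a' \<otimes>\<^bsub>R\<^esub> a) (h\<^sub>1 \<otimes>\<^bsub>H\<^esub> (h'\<^sub>1 \<otimes>\<^bsub>H\<^esub> h''))) h\<^sub>2"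
      by (intro sw_cong) (simp_all add: RR.m_assoc)
    also have "\<dots> = RH.pure (sw R (\<lambda>p q. hR p (hR h'\<^sub>2 a'') \<otimes>\<^bsub>R\<^esub> hR q a') h\<^sub>2 \<otimes>\<^bsub>R\<^esub> a) (h\<^sub>1 \<otimes>\<^bsub>H\<^esub> (h'\<^sub>1 \<otimes>\<^bsub>H\<^esub> h''))"
      by (intro sw_hom[symmetric] module_B module_R lin_B) simp_all
    finally show "sw B (\<lambda>p q. ?p h\<^sub>1 p q h'\<^sub>1 h'\<^sub>2) h\<^sub>2
        = RH.pure (hR h\<^sub>2 (hR h'\<^sub>2 a'' \<otimes>\<^bsub>R\<^esub> a') \<otimes>\<^bsub>R\<^esub> a) (h\<^sub>1 \<otimes>\<^bsub>H\<^esub> (h'\<^sub>1 \<otimes>\<^bsub>H\<^esub> h''))"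
      by (simp add: hR_prod)
  qed simp_all
  also have "\<dots> = sw B (\<lambda>h'\<^sub>1 h'\<^sub>2. RH.pure a h \<otimes>\<^bsub>B\<^esub> RH.pure (hR h'\<^sub>2 a'' \<otimes>\<^bsub>R\<^esub> a') (h'\<^sub>1 \<otimes>\<^bsub>H\<^esub> h'')) h'"
    by (intro sw_cong B_mult_pure[symmetric]) simp_all
  also have "\<dots> = RH.pure a h \<otimes>\<^bsub>B\<^esub> pure_mult a' h' a'' h''"
    by (intro sw_hom[symmetric] module_B lin_B_mult_r lin_id) simp_all
  finally show ?thesis unfolding B_mult_pure[OF assms(3-6)] .
qed

lemma B_assoc:
  assumes "X \<in> carrier RH.T" "Y \<in> carrier RH.T" "Z \<in> carrier RH.T"
  shows "(X \<otimes>\<^bsub>B\<^esub> Y) \<otimes>\<^bsub>B\<^esub> Z = X \<otimes>\<^bsub>B\<^esub> (Y \<otimes>\<^bsub>B\<^esub> Z)"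
proof (rule B_ext[where \<phi> = "\<lambda>X. (X \<otimes>\<^bsub>B\<^esub> Y) \<otimes>\<^bsub>B\<^esub> Z" and \<psi> = "\<lambda>X. X \<otimes>\<^bsub>B\<^esub> (Y \<otimes>\<^bsub>B\<^esub> Z)", OF module_B _ _ _ _ _ assms(1)])
  fix a h assume [simp]: "a \<in> carrier R" "h \<in> carrier H"
  show "(RH.pure a h \<otimes>\<^bsub>B\<^esub> Y) \<otimes>\<^bsub>B\<^esub> Z = RH.pure a h \<otimes>\<^bsub>B\<^esub> (Y \<otimes>\<^bsub>B\<^esub> Z)"
  proof (rule B_ext[where \<phi> = "\<lambda>Y. (RH.pure a h \<otimes>\<^bsub>B\<^esub> Y) \<otimes>\<^bsub>B\<^esub> Z" and \<psi> = "\<lambda>Y. RH.pure a h \<otimes>\<^bsub>B\<^esub> (Y \<otimes>\<^bsub>B\<^esub> Z)",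
        OF module_B _ _ _ _ _ assms(2)])
    fix a' h' assume [simp]: "a' \<in> carrier R" "h' \<in> carrier H"
    show "(RH.pure a h \<otimes>\<^bsub>B\<^esub> RH.pure a' h') \<otimes>\<^bsub>B\<^esub> Z = RH.pure a h \<otimes>\<^bsub>B\<^esub> (RH.pure a' h' \<otimes>\<^bsub>B\<^esub> Z)"
      by (rule B_ext[where \<phi> = "\<lambda>Z. (RH.pure a h \<otimes>\<^bsub>B\<^esub> RH.pure a' h') \<otimes>\<^bsub>B\<^esub> Z"
          and \<psi> = "\<lambda>Z. RH.pure a h \<otimes>\<^bsub>B\<^esub> (RH.pure a' h' \<otimes>\<^bsub>B\<^esub> Z)", OF module_B _ _ _ _ _ assms(3)])
        (simp_all add: B_mult_add_r B_assoc_pure)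
  qed (simp_all add: assms B_mult_add_l B_mult_add_r)
qed (simp_all add: assms B_mult_add_l)

lemma B_one_l:
  assumes "X \<in> carrier RH.T"
  shows "\<one>\<^bsub>B\<^esub> \<otimes>\<^bsub>B\<^esub> X = X"
proof (rule B_ext[where \<phi> = "\<lambda>X. \<one>\<^bsub>B\<^esub> \<otimes>\<^bsub>B\<^esub> X" and \<psi> = "\<lambda>X. X", OF module_B _ _ _ _ _ assms])
  fix a h assume "a \<in> carrier R" "h \<in> carrier H"
  moreover from this have "sw B (\<lambda>h\<^sub>1 h\<^sub>2. RH.pure (hR h\<^sub>2 a \<otimes>\<^bsub>R\<^esub> \<one>\<^bsub>R\<^esub>) (h\<^sub>1 \<otimes>\<^bsub>H\<^esub> h)) \<one>\<^bsub>H\<^esub>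
      = RH.pure (hR \<one>\<^bsub>H\<^esub> a \<otimes>\<^bsub>R\<^esub> \<one>\<^bsub>R\<^esub>) (\<one>\<^bsub>H\<^esub> \<otimes>\<^bsub>H\<^esub> h)"
    by (intro sw_one module_B bilI lin_B) simp_all
  ultimately show "\<one>\<^bsub>B\<^esub> \<otimes>\<^bsub>B\<^esub> RH.pure a h = RH.pure a h"
    by (simp add: B_one B_mult_pure hR_unit)
qed (use assms in \<open>simp_all add: B_mult_add_r B_one\<close>)

text \<open>The factor h_2.1 is the scalar \<epsilon>(h_2), which the counit axiom absorbs into
  h_1.\<close>

lemma B_one_r:
  assumes "X \<in> carrier RH.T"
  shows "X \<otimes>\<^bsub>B\<^esub> \<one>\<^bsub>B\<^esub> = X"
proof (rule B_ext[where \<phi> = "\<lambda>X. X \<otimes>\<^bsub>B\<^esub> \<one>\<^bsub>B\<^esub>" and \<psi> = "\<lambda>X. X", OF module_B _ _ _ _ _ assms])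
  fix a h assume ah: "a \<in> carrier R" "h \<in> carrier H"
  have "sw B (\<lambda>h\<^sub>1 h\<^sub>2. RH.pure (hR h\<^sub>2 \<one>\<^bsub>R\<^esub> \<otimes>\<^bsub>R\<^esub> a) (h\<^sub>1 \<otimes>\<^bsub>H\<^esub> \<one>\<^bsub>H\<^esub>)) h
      = sw B (\<lambda>h\<^sub>1 h\<^sub>2. counit H h\<^sub>2 \<odot>\<^bsub>B\<^esub> RH.pure a h\<^sub>1) h"
    using ah by (intro sw_cong)
      (simp_all add: hR_one k_algebra.smult_mult_l[OF algebra_R] counit_closed smult_pure)
  also have "\<dots> = RH.pure a h"
    using ah by (intro sw_counit_right module_B lin_B)
  finally show "RH.pure a h \<otimes>\<^bsub>B\<^esub> \<one>\<^bsub>B\<^esub> = RH.pure a h"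
    using ah by (simp add: B_one B_mult_pure)
qed (use assms in \<open>simp_all add: B_mult_add_l B_one\<close>)

lemma op_smash_algebra: "k_algebra k B"
proof (intro k_algebra.intro k_algebra_axioms.intro module_B)
  show "ring B"
    by (intro ringI abelian_group_B monoidI)
      (simp_all add: B_assoc B_one_l B_one_r B_mult_add_l B_mult_add_r, simp add: B_one)
qed (simp_all add: B_smult_mult_l B_smult_mult_r)

end

section \<open>Left-right modules as modules over the smash product\<close>

locale smash_module = smash_product k H R hR
  for k :: "('k, 'x) ring_scheme" and H :: "('k, 'h, 'y) hopf_scheme"
  and R :: "('k, 'r, 'z) module_scheme" and hR :: "'h \<Rightarrow> 'r \<Rightarrow> 'r" +
  fixes M :: "('k, 'm, 'w) module_scheme" and hM :: "'h \<Rightarrow> 'm \<Rightarrow> 'm" and rM :: "'m \<Rightarrow> 'r \<Rightarrow> 'm"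
  assumes left_right: "left_right_module k H R hR M hM rM"
begin

lemma action_M: "k_left_module k H M hM"
  by (rule left_right_module.axioms(2)[OF left_right])

lemma right_M: "k_right_module k R M rM"
  by (rule left_right_module.axioms(3)[OF left_right])

lemma left_module_M: "left_module H M hM"
  using action_M by (simp add: k_left_module_def)

lemma right_module_M: "right_module R M rM"
  using right_M by (simp add: k_right_module_def)

lemma module_M: "module k M"
  using action_M by (simp add: k_left_module_def)

sublocale kM: module k M
  by (rule module_M)

lemma hM_closed [simp]: "\<lbrakk>h \<in> carrier H; m \<in> carrier M\<rbrakk> \<Longrightarrow> hM h m \<in> carrier M"
  by (rule left_module.lact_closed[OF left_module_M])

lemma hM_mult: "\<lbrakk>g \<in> carrier H; h \<in> carrier H; m \<in> carrier M\<rbrakk> \<Longrightarrow> hM (g \<otimes>\<^bsub>H\<^esub> h) m = hM g (hM h m)"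
  by (rule left_module.lact_mult[OF left_module_M])

lemma rM_closed [simp]: "\<lbrakk>m \<in> carrier M; a \<in> carrier R\<rbrakk> \<Longrightarrow> rM m a \<in> carrier M"
  by (rule right_module.ract_closed[OF right_module_M])

lemma rM_mult: "\<lbrakk>m \<in> carrier M; a \<in> carrier R; b \<in> carrier R\<rbrakk> \<Longrightarrow> rM m (a \<otimes>\<^bsub>R\<^esub> b) = rM (rM m a) b"
  by (rule right_module.ract_mult[OF right_module_M])

lemmas lin_M = lin_R lin_module_l[OF action_M] lin_module_r[OF action_M]
  lin_right_module_l[OF right_M] lin_right_module_r[OF right_M]

lemma hM_ract: "\<lbrakk>h \<in> carrier H; m \<in> carrier M; a \<in> carrier R\<rbrakk>
    \<Longrightarrow> hM h (rM m a) = sw M (\<lambda>p q. rM (hM p m) (hR q a)) h"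
  by (subst left_right_module.hact_ract[OF left_right], assumption+,
      intro sw_tensor_lift module_M bilI lin_M) simp_all

abbreviation act where "act \<equiv> op_smash_action M hM rM"

lemma bil_act: "m \<in> carrier M \<Longrightarrow> bil k R H M (\<lambda>a h. rM (hM h m) a)"
  by (intro bilI lin_M) simp_all

lemma act_tsum: "\<lbrakk>X \<in> carrier RH.T; m \<in> carrier M\<rbrakk> \<Longrightarrow> act X m = tsum M (\<lambda>a h. rM (hM h m) a) X"
  unfolding op_smash_action_def
  by (intro RH.tensor_lift_tsum bil_balanced_RH bil_act module_abelian_group module_M)

lemma act_pure: "\<lbrakk>a \<in> carrier R; h \<in> carrier H; m \<in> carrier M\<rbrakk> \<Longrightarrow> act (RH.pure a h) m = rM (hM h m) a"
  by (simp add: act_tsum tsum_bil_pure bil_act module_M)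

lemma act_closed [simp]: "\<lbrakk>X \<in> carrier RH.T; m \<in> carrier M\<rbrakk> \<Longrightarrow> act X m \<in> carrier M"
  by (simp add: act_tsum tsum_bil_closed bil_act module_M)

lemma act_add_l: "\<lbrakk>X \<in> carrier RH.T; Y \<in> carrier RH.T; m \<in> carrier M\<rbrakk>
    \<Longrightarrow> act (X \<oplus>\<^bsub>B\<^esub> Y) m = act X m \<oplus>\<^bsub>M\<^esub> act Y m"
  by (simp add: act_tsum tsum_bil_add bil_act module_M)

lemma lin_act_r: "X \<in> carrier RH.T \<Longrightarrow> lin k M M (act X)"
  by (rule lin_cong[OF module_M act_tsum], assumption+,
      intro RH.lin_tsum_param module_M lin_M) simp_all

lemma act_smult: 
  assumes "\<kappa> \<in> carrier k" "X \<in> carrier RH.T" "m \<in> carrier M"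
  shows "act (\<kappa> \<odot>\<^bsub>B\<^esub> X) m = \<kappa> \<odot>\<^bsub>M\<^esub> act X m"
proof (rule B_ext[where \<phi> = "\<lambda>X. act (\<kappa> \<odot>\<^bsub>B\<^esub> X) m"
      and \<psi> = "\<lambda>X. \<kappa> \<odot>\<^bsub>M\<^esub> act X m", OF module_M _ _ _ _ _ assms(2)])
  fix a h assume "a \<in> carrier R" "h \<in> carrier H"
  then show "act (\<kappa> \<odot>\<^bsub>B\<^esub> RH.pure a h) m = \<kappa> \<odot>\<^bsub>M\<^esub> act (RH.pure a h) m"
    using assms k_right_module.ract_smult[OF right_M] by (simp add: smult_pure act_pure)
qed (use assms in \<open>simp_all add: B_smult_add act_add_l kM.smult_r_distr\<close>)

text \<open>On pure tensors both sides are (h_1 (g m)) (h_2 b) followed by a: the product rule of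
  the smash product is the compatibility of the H-action with the right action, read
  backwards.\<close>

lemma act_mult:
  assumes "X \<in> carrier RH.T" "Y \<in> carrier RH.T" "m \<in> carrier M"
  shows "act (X \<otimes>\<^bsub>B\<^esub> Y) m = act X (act Y m)"
proof (rule B_ext[where \<phi> = "\<lambda>X. act (X \<otimes>\<^bsub>B\<^esub> Y) m"
      and \<psi> = "\<lambda>X. act X (act Y m)", OF module_M _ _ _ _ _ assms(1)])
  fix a h assume ah: "a \<in> carrier R" "h \<in> carrier H"
  show "act (RH.pure a h \<otimes>\<^bsub>B\<^esub> Y) m = act (RH.pure a h) (act Y m)"
  proof (rule B_ext[where \<phi> = "\<lambda>Y. act (RH.pure a h \<otimes>\<^bsub>B\<^esub> Y) m"
      and \<psi> = "\<lambda>Y. act (RH.pure a h) (act Y m)", OF module_M _ _ _ _ _ assms(2)])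
    fix b g assume bg: "b \<in> carrier R" "g \<in> carrier H"
    note [simp] = ah bg assms(3)
    have lin: "lin k B M (\<lambda>X. act X m)"
      by (rule linI) (simp_all add: act_add_l act_smult)
    have "act (pure_mult a h b g) m
        = sw M (\<lambda>h\<^sub>1 h\<^sub>2. act (RH.pure (hR h\<^sub>2 b \<otimes>\<^bsub>R\<^esub> a) (h\<^sub>1 \<otimes>\<^bsub>H\<^esub> g)) m) h"
      by (intro sw_hom[OF module_B module_M lin]) simp_all
    also have "\<dots> = sw M (\<lambda>h\<^sub>1 h\<^sub>2. rM (rM (hM h\<^sub>1 (hM g m)) (hR h\<^sub>2 b)) a) h"
      by (intro sw_cong) (simp_all add: act_pure hM_mult rM_mult)
    also have "\<dots> = rM (sw M (\<lambda>h\<^sub>1 h\<^sub>2. rM (hM h\<^sub>1 (hM g m)) (hR h\<^sub>2 b)) h) a"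
      by (intro sw_hom[symmetric] module_M lin_M) simp_all
    finally show "act (RH.pure a h \<otimes>\<^bsub>B\<^esub> RH.pure b g) m = act (RH.pure a h) (act (RH.pure b g) m)"
      by (simp add: B_mult_pure act_pure hM_ract)
  qed (use ah assms linD(2)[OF lin_act_r] in \<open>simp_all add: B_mult_add_r act_add_l\<close>)
qed (use assms in \<open>simp_all add: B_mult_add_l act_add_l\<close>)

lemma op_smash_module: "k_left_module k B M act"
proof (intro k_left_module.intro k_left_module_axioms.intro left_module.intro left_module_axioms.intro)
  show "act \<one>\<^bsub>B\<^esub> m = m" if "m \<in> carrier M" for m
    using that left_module.lact_one[OF left_module_M] right_module.ract_one[OF right_module_M]
    by (simp add: B_one act_pure)
qed (use linD(2)[OF lin_act_r] op_smash_algebra in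
  \<open>simp_all add: module_M act_add_l act_mult act_smult k_algebra_def kM.M.abelian_group_axioms\<close>)

end

section \<open>The left dual of an equivariant coring\<close>

locale equivariant_coring = bij_hopf_algebra k H
  for k :: "('k, 'x) ring_scheme" and H :: "('k, 'h, 'y) hopf_scheme" +
  fixes A :: "('k, 'a, 'z) module_scheme" and hA :: "'h \<Rightarrow> 'a \<Rightarrow> 'a"
    and C :: "('k, 'c, 'w) module_scheme" and hC :: "'h \<Rightarrow> 'c \<Rightarrow> 'c"
    and l :: "'a \<Rightarrow> 'c \<Rightarrow> 'c" and r :: "'c \<Rightarrow> 'a \<Rightarrow> 'c"
    and \<Delta> :: "'c \<Rightarrow> ('c, 'c) tensor" and \<epsilon> :: "'c \<Rightarrow> 'a"
  assumes HA_coring: "HA_coring k H A hA C hC l r \<Delta> \<epsilon>"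
begin

lemma HA_bimodule: "HA_bimodule k H A hA C hC l r"
  using HA_coring by (simp add: HA_coring_def)

lemma left_right_C: "left_right_module k H A hA C hC r"
  using HA_bimodule by (simp add: HA_bimodule_def)

lemma left_A_C: "k_left_module k A C l"
  using HA_bimodule by (simp add: HA_bimodule_def k_bimodule_def)

lemma module_algebra_A: "module_algebra k H A hA"
  using left_right_C by (simp add: left_right_module_def)

sublocale Cs: smash_module k H A hA C hC r
  by (intro smash_module.intro smash_product.intro smash_product_axioms.intro
      smash_module_axioms.intro hopf_algebra_axioms module_algebra_A left_right_C)

sublocale cor: coring A C l r \<Delta> \<epsilon>
  using HA_coring by (simp add: HA_coring_def)

lemmas module_A = Cs.module_R
lemmas module_C = Cs.module_M
lemmas lin_C = Cs.lin_M lin_module_l[OF left_A_C] lin_module_r[OF left_A_C]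

lemmas [simp] = cor.lact_closed cor.counit_closed

lemma hC_lact: "\<lbrakk>h \<in> carrier H; a \<in> carrier A; c \<in> carrier C\<rbrakk>
    \<Longrightarrow> hC h (l a c) = sw C (\<lambda>p q. l (hA p a) (hC q c)) h"
  by (subst HA_bimodule.hact_lact[OF HA_bimodule], assumption+,
      intro sw_tensor_lift module_C bilI lin_C) simp_all

lemma smult_C: "\<lbrakk>\<kappa> \<in> carrier k; c \<in> carrier C\<rbrakk> \<Longrightarrow> \<kappa> \<odot>\<^bsub>C\<^esub> c = l (\<kappa> \<odot>\<^bsub>A\<^esub> \<one>\<^bsub>A\<^esub>) c"
  by (simp add: k_left_module.lact_smult[OF left_A_C] cor.lact_one)

lemma counit_hact: "\<lbrakk>h \<in> carrier H; c \<in> carrier C\<rbrakk> \<Longrightarrow> \<epsilon> (hC h c) = hA h (\<epsilon> c)"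
  by (rule HA_coring.counit_hact[OF HA_coring])

end

text \<open>M stays general because two instances occur: M = C for the H-linearity of \<Delta>, and
  M = A for the H-linearity of the coaction.\<close>

locale diagonal = equivariant_coring k H A hA C hC l r \<Delta> \<epsilon>
  for k :: "('k, 'x) ring_scheme" and H :: "('k, 'h, 'y) hopf_scheme"
  and A :: "('k, 'a, 'z) module_scheme" and hA :: "'h \<Rightarrow> 'a \<Rightarrow> 'a"
  and C :: "('k, 'c, 'w) module_scheme" and hC :: "'h \<Rightarrow> 'c \<Rightarrow> 'c"
  and l :: "'a \<Rightarrow> 'c \<Rightarrow> 'c" and r :: "'c \<Rightarrow> 'a \<Rightarrow> 'c"
  and \<Delta> :: "'c \<Rightarrow> ('c, 'c) tensor" and \<epsilon> :: "'c \<Rightarrow> 'a" +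
  fixes M :: "('k, 'm, 'v) module_scheme" and hM :: "'h \<Rightarrow> 'm \<Rightarrow> 'm" and rM :: "'m \<Rightarrow> 'a \<Rightarrow> 'm"
  assumes left_right_M: "left_right_module k H A hA M hM rM"
begin

sublocale Ms: smash_module k H A hA M hM rM
  by (intro smash_module.intro smash_module_axioms.intro Cs.smash_product_axioms left_right_M)

sublocale MC: tensor_pair A M rM C l
  by (intro tensor_pair.intro tensor_pair_axioms.intro Ms.kM.M.abelian_group_axioms
      Cs.kM.M.abelian_group_axioms) simp_all

text \<open>\<open>M \<otimes>\<^sub>A C\<close> with its \<open>k\<close>-module structure, which makes it a legitimate target for \<open>sw_coassoc\<close>.\<close>

definition P :: "('k, ('m, 'c) tensor) module" where
  "P = \<lparr>carrier = carrier MC.T, monoid.mult = undefined, monoid.one = undefined,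
     ring.zero = \<zero>\<^bsub>MC.T\<^esub>, ring.add = ring.add MC.T,
     smult = (\<lambda>\<kappa>. tensor_lift MC.T (\<lambda>m c. MC.pure (\<kappa> \<odot>\<^bsub>M\<^esub> m) c))\<rparr>"

lemma P_simps: "carrier P = carrier MC.T" "ring.add P = ring.add MC.T" "\<zero>\<^bsub>P\<^esub> = \<zero>\<^bsub>MC.T\<^esub>"
  "smult P \<kappa> = tensor_lift MC.T (\<lambda>m c. MC.pure (\<kappa> \<odot>\<^bsub>M\<^esub> m) c)"
  by (simp_all add: P_def)

lemma smult_rM: "\<lbrakk>\<kappa> \<in> carrier k; m \<in> carrier M; a \<in> carrier A\<rbrakk> \<Longrightarrow> rM (\<kappa> \<odot>\<^bsub>M\<^esub> m) a = \<kappa> \<odot>\<^bsub>M\<^esub> rM m a"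
  by (rule k_right_module_smult[OF Ms.right_M])

lemma module_P: "module k P"
  by (rule MC.tensor_module(1)[OF Ms.module_M refl refl smult_rM P_simps])

lemma smult_pure: "\<lbrakk>\<kappa> \<in> carrier k; m \<in> carrier M; c \<in> carrier C\<rbrakk>
    \<Longrightarrow> \<kappa> \<odot>\<^bsub>P\<^esub> MC.pure m c = MC.pure (\<kappa> \<odot>\<^bsub>M\<^esub> m) c"
  by (rule MC.tensor_module(2)[OF Ms.module_M refl refl smult_rM P_simps])

lemma P_tsum: "tsum MC.T f X = tsum P f X"
  by (rule tsum_record_cong) (simp_all add: P_simps)

lemma pure_smult_r:
  assumes "\<kappa> \<in> carrier k" "m \<in> carrier M" "c \<in> carrier C"
  shows "MC.pure m (\<kappa> \<odot>\<^bsub>C\<^esub> c) = MC.pure (\<kappa> \<odot>\<^bsub>M\<^esub> m) c"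
proof -
  have "rM m (\<kappa> \<odot>\<^bsub>A\<^esub> \<one>\<^bsub>A\<^esub>) = \<kappa> \<odot>\<^bsub>M\<^esub> m"
    using assms by (simp add: k_right_module.ract_smult[OF Ms.right_M] right_module.ract_one[OF Ms.right_module_M])
  then show ?thesis
    using assms MC.pure_balanced[of m "\<kappa> \<odot>\<^bsub>A\<^esub> \<one>\<^bsub>A\<^esub>" c] by (simp add: smult_C)
qed

lemma lin_pure_l: "\<lbrakk>lin k V M \<phi>; c \<in> carrier C\<rbrakk> \<Longrightarrow> lin k V P (\<lambda>x. MC.pure (\<phi> x) c)"
  by (simp add: lin_def add_hom_def MC.pure_add_l P_simps(1,2) smult_pure MC.pure_closed)

lemma lin_pure_r: "\<lbrakk>m \<in> carrier M; lin k V C \<phi>\<rbrakk> \<Longrightarrow> lin k V P (\<lambda>x. MC.pure m (\<phi> x))"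
  by (simp add: lin_def add_hom_def MC.pure_add_r P_simps(1,2) smult_pure pure_smult_r MC.pure_closed)

lemmas lin_P = lin_C Ms.lin_M lin_pure_l lin_pure_r

lemma pure_closed_P [simp]: "\<lbrakk>m \<in> carrier M; c \<in> carrier C\<rbrakk> \<Longrightarrow> MC.pure m c \<in> carrier P"
  by (simp add: P_simps(1) MC.pure_closed)

abbreviation diag_pure where
  "diag_pure \<equiv> \<lambda>h m c. sw P (\<lambda>h\<^sub>1 h\<^sub>2. MC.pure (hM h\<^sub>1 m) (hC h\<^sub>2 c)) h"

text \<open>The diagonal action descends to M \<otimes> C over A: h_1 (m a) \<otimes> h_2 c and h_1
  m \<otimes> h_2 (a c) both unfold to three consecutive parts of h acting on m, a and c, and the
  part acting on a crosses the tensor sign.\<close>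

lemma diag_pure_ract:
  assumes "h \<in> carrier H" "m \<in> carrier M" "a \<in> carrier A" "c \<in> carrier C"
  shows "diag_pure h (rM m a) c = diag_pure h m (l a c)"
proof -
  note [simp] = assms
  have "diag_pure h (rM m a) c
      = sw P (\<lambda>h\<^sub>1 h\<^sub>2. MC.pure (sw M (\<lambda>p q. rM (hM p m) (hA q a)) h\<^sub>1) (hC h\<^sub>2 c)) h"
    by (intro sw_cong) (simp_all add: Ms.hM_ract)
  also have "\<dots> = sw P (\<lambda>h\<^sub>1 h\<^sub>2. sw P (\<lambda>p q. MC.pure (rM (hM p m) (hA q a)) (hC h\<^sub>2 c)) h\<^sub>1) h"
    by (intro sw_cong sw_hom Ms.module_M module_P lin_P) simp_all
  also have "\<dots> = sw P (\<lambda>h\<^sub>1 h\<^sub>2. sw P (\<lambda>p q. MC.pure (hM p m) (l (hA q a) (hC h\<^sub>2 c))) h\<^sub>1) h"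
    by (intro sw_cong MC.pure_balanced) simp_all
  also have "\<dots> = sw P (\<lambda>h\<^sub>1 h\<^sub>2. sw P (\<lambda>p q. MC.pure (hM h\<^sub>1 m) (l (hA p a) (hC q c))) h\<^sub>2) h"
    by (intro sw_coassoc module_P lin_P) simp_all
  also have "\<dots> = sw P (\<lambda>h\<^sub>1 h\<^sub>2. MC.pure (hM h\<^sub>1 m) (sw C (\<lambda>p q. l (hA p a) (hC q c)) h\<^sub>2)) h"
    by (intro sw_cong sw_hom[symmetric] module_C module_P lin_P) simp_all
  also have "\<dots> = diag_pure h m (l a c)"
    by (intro sw_cong) (simp_all add: hC_lact)
  finally show ?thesis .
qed

lemma bil_diag_pure: "h \<in> carrier H \<Longrightarrow> bil k M C P (diag_pure h)"
  by (intro bilI lin_sw_param module_P lin_P) simp_all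

lemma balanced_diag_pure: "h \<in> carrier H \<Longrightarrow> MC.balanced MC.T (diag_pure h)"
  using bil_diag_pure[of h] diag_pure_ract
  by (simp add: MC.balanced_def bil_def lin_def add_hom_def P_simps(1,2))

lemma diag_inner:
  assumes "h \<in> carrier H" "m \<in> carrier M" "c \<in> carrier C"
  shows "tensor_lift MC.T (\<lambda>h\<^sub>1 h\<^sub>2. MC.pure (hM h\<^sub>1 m) (hC h\<^sub>2 c)) (comult H h) = diag_pure h m c"
proof -
  interpret HH: tensor_pair k H "\<lambda>h \<kappa>. \<kappa> \<odot>\<^bsub>H\<^esub> h" H "\<lambda>\<kappa> h. \<kappa> \<odot>\<^bsub>H\<^esub> h" by (rule tensor_pair_H)
  have "HH.balanced P (\<lambda>h\<^sub>1 h\<^sub>2. MC.pure (hM h\<^sub>1 m) (hC h\<^sub>2 c))"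
    using assms by (intro bil_balanced_H bilI lin_P) simp_all
  then have "HH.balanced MC.T (\<lambda>h\<^sub>1 h\<^sub>2. MC.pure (hM h\<^sub>1 m) (hC h\<^sub>2 c))"
    by (simp add: HH.balanced_def add_hom_def P_simps(1,2))
  then show ?thesis
    unfolding P_tsum[symmetric] using assms
    by (intro HH.tensor_lift_tsum MC.tensor_group comult_closed)
qed

lemma diagonal_action_tsum:
  assumes "h \<in> carrier H" "X \<in> carrier MC.T"
  shows "diagonal_action H A M hM rM C hC l h X = tsum MC.T (diag_pure h) X"
proof -
  let ?g = "\<lambda>m c. tensor_lift MC.T (\<lambda>h\<^sub>1 h\<^sub>2. MC.pure (hM h\<^sub>1 m) (hC h\<^sub>2 c)) (comult H h)"
  have "MC.balanced MC.T ?g"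
    using balanced_diag_pure[OF assms(1)] assms(1)
    by (simp add: MC.balanced_def add_hom_def diag_inner)
  then have "diagonal_action H A M hM rM C hC l h X = tsum MC.T ?g X"
    unfolding diagonal_action_def by (intro MC.tensor_lift_tsum MC.tensor_group assms)
  also have "\<dots> = tsum MC.T (diag_pure h) X"
    by (intro MC.tsum_cong assms diag_inner)
  finally show ?thesis .
qed

lemma diagonal_action_pure:
  "\<lbrakk>h \<in> carrier H; m \<in> carrier M; c \<in> carrier C\<rbrakk>
    \<Longrightarrow> diagonal_action H A M hM rM C hC l h (MC.pure m c) = diag_pure h m c"
  by (simp add: diagonal_action_tsum MC.pure_closed MC.tsum_pure_tensor MC.tensor_group balanced_diag_pure)

lemma tsum_diagonal_action:
  assumes "abelian_group G" "MC.balanced G f" "h \<in> carrier H" "X \<in> carrier MC.T"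
  shows "tsum G f (diagonal_action H A M hM rM C hC l h X)
    = tsum G (\<lambda>m c. sw G (\<lambda>h\<^sub>1 h\<^sub>2. f (hM h\<^sub>1 m) (hC h\<^sub>2 c)) h) X"
proof -
  interpret HH: tensor_pair k H "\<lambda>h \<kappa>. \<kappa> \<odot>\<^bsub>H\<^esub> h" H "\<lambda>\<kappa> h. \<kappa> \<odot>\<^bsub>H\<^esub> h" by (rule tensor_pair_H)
  note hom = MC.tsum_add_hom[OF assms(1,2)]
  have "tsum G f (tsum MC.T (diag_pure h) X) = tsum G (\<lambda>m c. tsum G f (diag_pure h m c)) X"
    using assms MC.balancedD(1)[OF balanced_diag_pure]
    by (intro MC.tsum_hom[OF _ _ hom] MC.tensor_group)
  also have "\<dots> = tsum G (\<lambda>m c. sw G (\<lambda>h\<^sub>1 h\<^sub>2. f (hM h\<^sub>1 m) (hC h\<^sub>2 c)) h) X"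
  proof (intro MC.tsum_cong assms)
    fix m c assume mc: "m \<in> carrier M" "c \<in> carrier C"
    have "tsum G f (diag_pure h m c) = sw G (\<lambda>h\<^sub>1 h\<^sub>2. tsum G f (MC.pure (hM h\<^sub>1 m) (hC h\<^sub>2 c))) h"
      unfolding P_tsum[symmetric] using assms mc
      by (intro HH.tsum_hom[OF _ _ hom] MC.tensor_group comult_closed MC.pure_closed) simp_all
    also have "\<dots> = sw G (\<lambda>h\<^sub>1 h\<^sub>2. f (hM h\<^sub>1 m) (hC h\<^sub>2 c)) h"
      using assms mc by (intro sw_cong MC.tsum_pure_tensor) simp_all
    finally show "tsum G f (diag_pure h m c) = sw G (\<lambda>h\<^sub>1 h\<^sub>2. f (hM h\<^sub>1 m) (hC h\<^sub>2 c)) h" .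
  qed
  finally show ?thesis using assms by (simp add: diagonal_action_tsum)
qed

end

section \<open>The left dual as a k-algebra\<close>

context equivariant_coring
begin

text \<open>H-linearity of \<Delta>, read through a balanced map; the diagonal action is that of the
  instance M = C.\<close>

lemma tsum_comult_hact:
  assumes "abelian_group G" "tensor_pair.balanced A C r C l G f" "h \<in> carrier H" "c \<in> carrier C"
  shows "tsum G f (\<Delta> (hC h c)) = tsum G (\<lambda>c\<^sub>1 c\<^sub>2. sw G (\<lambda>h\<^sub>1 h\<^sub>2. f (hC h\<^sub>1 c\<^sub>1) (hC h\<^sub>2 c\<^sub>2)) h) (\<Delta> c)"
proof -
  interpret D: diagonal k H A hA C hC l r \<Delta> \<epsilon> C hC r
    by (intro diagonal.intro diagonal_axioms.intro equivariant_coring_axioms left_right_C)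
  show ?thesis
    unfolding HA_coring.comult_hact[OF HA_coring assms(3,4)]
    by (intro D.tsum_diagonal_action assms cor.comult_closed)
qed

abbreviation D where "D \<equiv> left_dual A C l r \<Delta> \<epsilon>"
abbreviation Dh where "Dh \<equiv> left_dual_hact H A hA C hC"

interpretation CC: tensor_pair A C r C l
  by (rule cor.tensor_pair_coring)

lemma dual_closed [simp]: "\<lbrakk>f \<in> carrier D; c \<in> carrier C\<rbrakk> \<Longrightarrow> f c \<in> carrier A"
  and dual_add: "\<lbrakk>f \<in> carrier D; c \<in> carrier C; d \<in> carrier C\<rbrakk> \<Longrightarrow> f (c \<oplus>\<^bsub>C\<^esub> d) = f c \<oplus>\<^bsub>A\<^esub> f d"
  and dual_lact: "\<lbrakk>f \<in> carrier D; a \<in> carrier A; c \<in> carrier C\<rbrakk> \<Longrightarrow> f (l a c) = a \<otimes>\<^bsub>A\<^esub> f c"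
  by (auto simp: left_dual_def)

lemma dualI:
  assumes "\<And>c. c \<in> carrier C \<Longrightarrow> f c \<in> carrier A"
    "\<And>c d. \<lbrakk>c \<in> carrier C; d \<in> carrier C\<rbrakk> \<Longrightarrow> f (c \<oplus>\<^bsub>C\<^esub> d) = f c \<oplus>\<^bsub>A\<^esub> f d"
    "\<And>a c. \<lbrakk>a \<in> carrier A; c \<in> carrier C\<rbrakk> \<Longrightarrow> f (l a c) = a \<otimes>\<^bsub>A\<^esub> f c"
  shows "(\<lambda>c\<in>carrier C. f c) \<in> carrier D"
  using assms by (auto simp: left_dual_def)

lemma dual_eqI:
  assumes "f \<in> carrier D" "g \<in> carrier D" "\<And>c. c \<in> carrier C \<Longrightarrow> f c = g c"
  shows "f = g"
  using assms by (auto simp: left_dual_def intro: PiE_ext)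

lemma dual_apply:
  assumes "c \<in> carrier C"
  shows "(f \<oplus>\<^bsub>D\<^esub> g) c = f c \<oplus>\<^bsub>A\<^esub> g c" "\<zero>\<^bsub>D\<^esub> c = \<zero>\<^bsub>A\<^esub>" "\<one>\<^bsub>D\<^esub> c = \<epsilon> c" "(\<kappa> \<odot>\<^bsub>D\<^esub> f) c = \<kappa> \<odot>\<^bsub>A\<^esub> f c"
  using assms by (simp_all add: left_dual_def)

text \<open>Scalars act on C through \<kappa> 1 in A, so a left A-linear map is also
  k-linear.\<close>

lemma dual_smult: "\<lbrakk>f \<in> carrier D; \<kappa> \<in> carrier k; c \<in> carrier C\<rbrakk> \<Longrightarrow> f (\<kappa> \<odot>\<^bsub>C\<^esub> c) = \<kappa> \<odot>\<^bsub>A\<^esub> f c"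
  by (simp add: smult_C dual_lact k_algebra.smult_mult_l[OF Cs.algebra_R])

lemma lin_dual: "\<lbrakk>f \<in> carrier D; lin k V C \<phi>\<rbrakk> \<Longrightarrow> lin k V A (\<lambda>x. f (\<phi> x))"
  by (simp add: lin_def add_hom_def dual_add dual_smult)

lemma dual_ops_closed:
  shows "\<lbrakk>f \<in> carrier D; g \<in> carrier D\<rbrakk> \<Longrightarrow> f \<oplus>\<^bsub>D\<^esub> g \<in> carrier D"
    and "\<zero>\<^bsub>D\<^esub> \<in> carrier D" and "\<one>\<^bsub>D\<^esub> \<in> carrier D"
    and "\<lbrakk>\<kappa> \<in> carrier k; f \<in> carrier D\<rbrakk> \<Longrightarrow> \<kappa> \<odot>\<^bsub>D\<^esub> f \<in> carrier D"
proof -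
  show "f \<oplus>\<^bsub>D\<^esub> g \<in> carrier D" if "f \<in> carrier D" "g \<in> carrier D"
  proof -
    have "(\<lambda>c\<in>carrier C. f c \<oplus>\<^bsub>A\<^esub> g c) \<in> carrier D"
      using that by (intro dualI) (simp_all add: dual_add dual_lact Cs.RR.r_distr Cs.RR.a_ac)
    then show ?thesis by (simp add: left_dual_def)
  qed
  have "(\<lambda>c\<in>carrier C. \<zero>\<^bsub>A\<^esub>) \<in> carrier D"
    by (intro dualI) simp_all
  then show "\<zero>\<^bsub>D\<^esub> \<in> carrier D" by (simp add: left_dual_def)
  have "(\<lambda>c\<in>carrier C. \<epsilon> c) \<in> carrier D"
    by (intro dualI) (simp_all add: cor.counit_add cor.counit_lact)
  then show "\<one>\<^bsub>D\<^esub> \<in> carrier D" by (simp add: left_dual_def)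
  show "\<kappa> \<odot>\<^bsub>D\<^esub> f \<in> carrier D" if "\<kappa> \<in> carrier k" "f \<in> carrier D"
  proof -
    have "(\<lambda>c\<in>carrier C. \<kappa> \<odot>\<^bsub>A\<^esub> f c) \<in> carrier D"
      using that by (intro dualI)
        (simp_all add: dual_add dual_lact Cs.kR.smult_r_distr k_algebra.smult_mult_r[OF Cs.algebra_R])
    then show ?thesis by (simp add: left_dual_def)
  qed
qed

lemma module_D: "module k D"
proof (rule moduleI)
  show "cring k" by (rule R.is_cring)
  show "abelian_group D"
  proof (rule abelian_groupI)
    fix f assume f: "f \<in> carrier D"
    have "(\<lambda>c\<in>carrier C. \<ominus>\<^bsub>A\<^esub> f c) \<in> carrier D"
      using f by (intro dualI) (simp_all add: dual_add dual_lact Cs.RR.minus_add Cs.RR.r_minus Cs.RR.a_comm)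
    moreover have "(\<lambda>c\<in>carrier C. \<ominus>\<^bsub>A\<^esub> f c) \<oplus>\<^bsub>D\<^esub> f = \<zero>\<^bsub>D\<^esub>"
      using f calculation
      by (intro dual_eqI dual_ops_closed) (simp_all add: dual_apply Cs.RR.l_neg)
    ultimately show "\<exists>g\<in>carrier D. g \<oplus>\<^bsub>D\<^esub> f = \<zero>\<^bsub>D\<^esub>" by blast
  qed (auto intro!: dual_eqI dual_ops_closed simp: dual_apply Cs.RR.a_ac)
qed (auto intro!: dual_eqI dual_ops_closed
    simp: dual_apply Cs.kR.smult_l_distr Cs.kR.smult_r_distr Cs.kR.smult_assoc1)

text \<open>Left A-linearity of f is what makes the product well defined: (c_1 a) f(c_2) = c_1 (a
  f(c_2)) = c_1 f(a c_2).\<close>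

lemma balanced_dual_mult:
  assumes "f \<in> carrier D" "g \<in> carrier D"
  shows "CC.balanced A (\<lambda>c\<^sub>1 c\<^sub>2. g (r c\<^sub>1 (f c\<^sub>2)))"
  using assms
  by (intro CC.balancedI)
    (simp_all add: cor.ract_add_l cor.ract_add_r cor.ract_mult[symmetric] dual_add dual_lact)

lemma abelian_group_A: "abelian_group A"
  by (rule Cs.RR.abelian_group_axioms)

lemma dual_mult_apply:
  assumes "f \<in> carrier D" "g \<in> carrier D" "c \<in> carrier C"
  shows "(f \<otimes>\<^bsub>D\<^esub> g) c = tsum A (\<lambda>c\<^sub>1 c\<^sub>2. g (r c\<^sub>1 (f c\<^sub>2))) (\<Delta> c)"
proof -
  have "(f \<otimes>\<^bsub>D\<^esub> g) c = tensor_lift A (\<lambda>c\<^sub>1 c\<^sub>2. g (r c\<^sub>1 (f c\<^sub>2))) (\<Delta> c)"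
    using assms(3) by (simp add: left_dual_def)
  then show ?thesis
    using CC.tensor_lift_tsum[OF abelian_group_A balanced_dual_mult cor.comult_closed, OF assms] by simp
qed

lemma tsum_\<Delta>_closed: "\<lbrakk>module k G; c \<in> carrier C;
    \<And>c\<^sub>1 c\<^sub>2. \<lbrakk>c\<^sub>1 \<in> carrier C; c\<^sub>2 \<in> carrier C\<rbrakk> \<Longrightarrow> f c\<^sub>1 c\<^sub>2 \<in> carrier G\<rbrakk> \<Longrightarrow> tsum G f (\<Delta> c) \<in> carrier G"
  by (rule CC.tsum_closed) (simp_all add: module_abelian_group cor.comult_closed)

lemma tsum_\<Delta>_cong: "\<lbrakk>c \<in> carrier C; \<And>c\<^sub>1 c\<^sub>2. \<lbrakk>c\<^sub>1 \<in> carrier C; c\<^sub>2 \<in> carrier C\<rbrakk> \<Longrightarrow> f c\<^sub>1 c\<^sub>2 = g c\<^sub>1 c\<^sub>2\<rbrakk>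
    \<Longrightarrow> tsum G f (\<Delta> c) = tsum G g (\<Delta> c)"
  by (rule CC.tsum_cong) (simp_all add: cor.comult_closed)

lemma tsum_\<Delta>_hom: "\<lbrakk>module k G; module k G'; lin k G G' \<phi>; c \<in> carrier C;
    \<And>c\<^sub>1 c\<^sub>2. \<lbrakk>c\<^sub>1 \<in> carrier C; c\<^sub>2 \<in> carrier C\<rbrakk> \<Longrightarrow> f c\<^sub>1 c\<^sub>2 \<in> carrier G\<rbrakk>
    \<Longrightarrow> \<phi> (tsum G f (\<Delta> c)) = tsum G' (\<lambda>c\<^sub>1 c\<^sub>2. \<phi> (f c\<^sub>1 c\<^sub>2)) (\<Delta> c)"
  by (rule CC.tsum_hom) (simp_all add: module_abelian_group linD(4) cor.comult_closed)

lemma dual_mult_closed: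
  assumes "f \<in> carrier D" "g \<in> carrier D"
  shows "f \<otimes>\<^bsub>D\<^esub> g \<in> carrier D"
proof -
  let ?m = "\<lambda>c\<^sub>1 c\<^sub>2. g (r c\<^sub>1 (f c\<^sub>2))"
  note b = balanced_dual_mult[OF assms]
  have "(\<lambda>c\<in>carrier C. tsum A ?m (\<Delta> c)) \<in> carrier D"
  proof (rule dualI)
    show "tsum A ?m (\<Delta> c) \<in> carrier A" if "c \<in> carrier C" for c
      using that assms by (intro tsum_\<Delta>_closed module_A) simp_all
    show "tsum A ?m (\<Delta> (c \<oplus>\<^bsub>C\<^esub> d)) = tsum A ?m (\<Delta> c) \<oplus>\<^bsub>A\<^esub> tsum A ?m (\<Delta> d)"
      if "c \<in> carrier C" "d \<in> carrier C" for c d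
      using that by (intro cor.tsum_comult_add abelian_group_A b)
    show "tsum A ?m (\<Delta> (l a c)) = a \<otimes>\<^bsub>A\<^esub> tsum A ?m (\<Delta> c)" if ac: "a \<in> carrier A" "c \<in> carrier C" for a c
    proof -
      have "tsum A ?m (\<Delta> (l a c)) = tsum A (\<lambda>c\<^sub>1 c\<^sub>2. ?m (l a c\<^sub>1) c\<^sub>2) (\<Delta> c)"
        using ac by (intro cor.tsum_comult_lact abelian_group_A b)
      also have "\<dots> = tsum A (\<lambda>c\<^sub>1 c\<^sub>2. a \<otimes>\<^bsub>A\<^esub> ?m c\<^sub>1 c\<^sub>2) (\<Delta> c)"
        using ac assms by (intro tsum_\<Delta>_cong) (simp_all add: cor.bimodule_assoc dual_lact)
      also have "\<dots> = a \<otimes>\<^bsub>A\<^esub> tsum A ?m (\<Delta> c)"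
        using ac assms by (intro tsum_\<Delta>_hom[symmetric] module_A lin_C) simp_all
      finally show ?thesis .
    qed
  qed
  moreover have "(\<lambda>c\<in>carrier C. tsum A ?m (\<Delta> c)) = f \<otimes>\<^bsub>D\<^esub> g"
    unfolding restrict_def
    by (rule ext) (use assms in \<open>simp add: dual_mult_apply, simp add: left_dual_def\<close>)
  ultimately show ?thesis by simp
qed

text \<open>Both sides are h(c_1 g(c_2 f(c_3))). On the right, \<open>g \<otimes> h\<close> is
  evaluated at c_1 f(c_2), where right A-linearity of \<Delta> places the coefficient on the last
  factor.\<close>

lemma dual_assoc:
  assumes fgh: "f \<in> carrier D" "g \<in> carrier D" "h \<in> carrier D"
  shows "(f \<otimes>\<^bsub>D\<^esub> g) \<otimes>\<^bsub>D\<^esub> h = f \<otimes>\<^bsub>D\<^esub> (g \<otimes>\<^bsub>D\<^esub> h)"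
proof (rule dual_eqI)
  interpret T3: tensor_triple A C r C l r C l by (rule cor.tensor_triple_coring)
  fix c assume c: "c \<in> carrier C"
  let ?t = "\<lambda>c\<^sub>1 c\<^sub>2 c\<^sub>3. h (r c\<^sub>1 (g (r c\<^sub>2 (f c\<^sub>3))))"
  note [simp] = fgh c
  have tri: "T3.tri_balanced A ?t"
    unfolding T3.tri_balanced_def
    by (intro conjI ballI CC.balancedI)
      (simp_all add: cor.ract_add_l cor.ract_add_r cor.ract_mult[symmetric] dual_add dual_lact cor.bimodule_assoc)
  have "((f \<otimes>\<^bsub>D\<^esub> g) \<otimes>\<^bsub>D\<^esub> h) c = tsum A (\<lambda>c\<^sub>1 c\<^sub>2. h (r c\<^sub>1 ((f \<otimes>\<^bsub>D\<^esub> g) c\<^sub>2))) (\<Delta> c)"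
    by (intro dual_mult_apply dual_mult_closed fgh c)
  also have "\<dots> = tsum A (\<lambda>c\<^sub>1 c\<^sub>2. h (r c\<^sub>1 (tsum A (\<lambda>p q. g (r p (f q))) (\<Delta> c\<^sub>2)))) (\<Delta> c)"
    by (intro tsum_\<Delta>_cong) (simp_all add: dual_mult_apply)
  also have "\<dots> = tsum A (\<lambda>c\<^sub>1 c\<^sub>2. tsum A (\<lambda>p q. ?t c\<^sub>1 p q) (\<Delta> c\<^sub>2)) (\<Delta> c)"
    by (intro tsum_\<Delta>_cong tsum_\<Delta>_hom module_A lin_dual[OF fgh(3)] lin_C) simp_all
  also have "\<dots> = tsum A (\<lambda>c\<^sub>1 c\<^sub>2. tsum A (\<lambda>p q. ?t p q c\<^sub>2) (\<Delta> c\<^sub>1)) (\<Delta> c)"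
    by (rule cor.coassoc_tsum[OF abelian_group_A tri c, symmetric])
  also have "\<dots> = tsum A (\<lambda>c\<^sub>1 c\<^sub>2. tsum A (\<lambda>p q. h (r p (g q))) (\<Delta> (r c\<^sub>1 (f c\<^sub>2)))) (\<Delta> c)"
    by (intro tsum_\<Delta>_cong cor.tsum_comult_ract[symmetric] abelian_group_A balanced_dual_mult) simp_all
  also have "\<dots> = tsum A (\<lambda>c\<^sub>1 c\<^sub>2. (g \<otimes>\<^bsub>D\<^esub> h) (r c\<^sub>1 (f c\<^sub>2))) (\<Delta> c)"
    by (intro tsum_\<Delta>_cong) (simp_all add: dual_mult_apply)
  also have "\<dots> = (f \<otimes>\<^bsub>D\<^esub> (g \<otimes>\<^bsub>D\<^esub> h)) c"
    by (intro dual_mult_apply[symmetric] dual_mult_closed fgh c)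
  finally show "((f \<otimes>\<^bsub>D\<^esub> g) \<otimes>\<^bsub>D\<^esub> h) c = (f \<otimes>\<^bsub>D\<^esub> (g \<otimes>\<^bsub>D\<^esub> h)) c" .
qed (intro dual_mult_closed fgh)+

lemma dual_one_l:
  assumes g: "g \<in> carrier D"
  shows "\<one>\<^bsub>D\<^esub> \<otimes>\<^bsub>D\<^esub> g = g"
proof (rule dual_eqI)
  fix c assume c: "c \<in> carrier C"
  have "(\<one>\<^bsub>D\<^esub> \<otimes>\<^bsub>D\<^esub> g) c = tsum A (\<lambda>c\<^sub>1 c\<^sub>2. g (r c\<^sub>1 (\<one>\<^bsub>D\<^esub> c\<^sub>2))) (\<Delta> c)"
    by (intro dual_mult_apply g c dual_ops_closed)
  also have "\<dots> = tsum A (\<lambda>c\<^sub>1 c\<^sub>2. g (r c\<^sub>1 (\<epsilon> c\<^sub>2))) (\<Delta> c)"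
    by (intro tsum_\<Delta>_cong c) (simp add: dual_apply)
  also have "\<dots> = g (tsum C (\<lambda>c\<^sub>1 c\<^sub>2. r c\<^sub>1 (\<epsilon> c\<^sub>2)) (\<Delta> c))"
    using c by (intro tsum_\<Delta>_hom[symmetric] module_A module_C lin_dual[OF g] lin_id) simp_all
  finally show "(\<one>\<^bsub>D\<^esub> \<otimes>\<^bsub>D\<^esub> g) c = g c" by (simp add: cor.tsum_counit_right c)
qed (intro dual_mult_closed dual_ops_closed g)+

lemma dual_one_r:
  assumes f: "f \<in> carrier D"
  shows "f \<otimes>\<^bsub>D\<^esub> \<one>\<^bsub>D\<^esub> = f"
proof (rule dual_eqI)
  fix c assume c: "c \<in> carrier C"
  have "(f \<otimes>\<^bsub>D\<^esub> \<one>\<^bsub>D\<^esub>) c = tsum A (\<lambda>c\<^sub>1 c\<^sub>2. \<one>\<^bsub>D\<^esub> (r c\<^sub>1 (f c\<^sub>2))) (\<Delta> c)"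
    by (intro dual_mult_apply f c dual_ops_closed)
  \<comment> \<open>\<epsilon>(c_1 f(c_2)) = \<epsilon>(c_1) f(c_2), and left A-linearity moves the
    coefficient inside f, ready for the left counit axiom.\<close>
  also have "\<dots> = tsum A (\<lambda>c\<^sub>1 c\<^sub>2. f (l (\<epsilon> c\<^sub>1) c\<^sub>2)) (\<Delta> c)"
    using f by (intro tsum_\<Delta>_cong c) (simp add: dual_apply cor.counit_ract dual_lact)
  also have "\<dots> = f (tsum C (\<lambda>c\<^sub>1 c\<^sub>2. l (\<epsilon> c\<^sub>1) c\<^sub>2) (\<Delta> c))"
    using c by (intro tsum_\<Delta>_hom[symmetric] module_A module_C lin_dual[OF f] lin_id) simp_all
  finally show "(f \<otimes>\<^bsub>D\<^esub> \<one>\<^bsub>D\<^esub>) c = f c" by (simp add: cor.tsum_counit_left c)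
qed (intro dual_mult_closed dual_ops_closed f)+

lemma dual_algebra: "k_algebra k D"
proof (intro k_algebra.intro k_algebra_axioms.intro module_D)
  have cl: "tsum A (\<lambda>c\<^sub>1 c\<^sub>2. g (r c\<^sub>1 (f c\<^sub>2))) (\<Delta> c) \<in> carrier A"
    if "f \<in> carrier D" "g \<in> carrier D" "c \<in> carrier C" for f g c
    using that by (intro tsum_\<Delta>_closed module_A) simp_all
  show "ring D"
  proof (intro ringI module_abelian_group[OF module_D] monoidI)
    fix f g h assume fgh: "f \<in> carrier D" "g \<in> carrier D" "h \<in> carrier D"
    show "(f \<oplus>\<^bsub>D\<^esub> g) \<otimes>\<^bsub>D\<^esub> h = f \<otimes>\<^bsub>D\<^esub> h \<oplus>\<^bsub>D\<^esub> g \<otimes>\<^bsub>D\<^esub> h"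
    proof (rule dual_eqI)
      fix c assume c: "c \<in> carrier C"
      have "tsum A (\<lambda>c\<^sub>1 c\<^sub>2. h (r c\<^sub>1 ((f \<oplus>\<^bsub>D\<^esub> g) c\<^sub>2))) (\<Delta> c)
          = tsum A (\<lambda>c\<^sub>1 c\<^sub>2. h (r c\<^sub>1 (f c\<^sub>2)) \<oplus>\<^bsub>A\<^esub> h (r c\<^sub>1 (g c\<^sub>2))) (\<Delta> c)"
        using fgh by (intro tsum_\<Delta>_cong c) (simp add: dual_apply cor.ract_add_r dual_add)
      then show "((f \<oplus>\<^bsub>D\<^esub> g) \<otimes>\<^bsub>D\<^esub> h) c = (f \<otimes>\<^bsub>D\<^esub> h \<oplus>\<^bsub>D\<^esub> g \<otimes>\<^bsub>D\<^esub> h) c"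
        using fgh c by (simp add: dual_mult_apply dual_ops_closed dual_apply CC.tsum_add
            abelian_group_A cor.comult_closed)
    qed (simp_all add: fgh dual_mult_closed dual_ops_closed)
    show "h \<otimes>\<^bsub>D\<^esub> (f \<oplus>\<^bsub>D\<^esub> g) = h \<otimes>\<^bsub>D\<^esub> f \<oplus>\<^bsub>D\<^esub> h \<otimes>\<^bsub>D\<^esub> g"
    proof (rule dual_eqI)
      fix c assume c: "c \<in> carrier C"
      have "tsum A (\<lambda>c\<^sub>1 c\<^sub>2. (f \<oplus>\<^bsub>D\<^esub> g) (r c\<^sub>1 (h c\<^sub>2))) (\<Delta> c)
          = tsum A (\<lambda>c\<^sub>1 c\<^sub>2. f (r c\<^sub>1 (h c\<^sub>2)) \<oplus>\<^bsub>A\<^esub> g (r c\<^sub>1 (h c\<^sub>2))) (\<Delta> c)"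
        using fgh by (intro tsum_\<Delta>_cong c) (simp add: dual_apply)
      then show "(h \<otimes>\<^bsub>D\<^esub> (f \<oplus>\<^bsub>D\<^esub> g)) c = (h \<otimes>\<^bsub>D\<^esub> f \<oplus>\<^bsub>D\<^esub> h \<otimes>\<^bsub>D\<^esub> g) c"
        using fgh c by (simp add: dual_mult_apply dual_ops_closed dual_apply CC.tsum_add
            abelian_group_A cor.comult_closed)
    qed (simp_all add: fgh dual_mult_closed dual_ops_closed)
  qed (simp_all add: dual_assoc dual_one_l dual_one_r dual_mult_closed dual_ops_closed)
  fix \<kappa> f g assume fg: "\<kappa> \<in> carrier k" "f \<in> carrier D" "g \<in> carrier D"
  have R: "k_right_module k A C r" by (rule Cs.right_M)
  show "(\<kappa> \<odot>\<^bsub>D\<^esub> f) \<otimes>\<^bsub>D\<^esub> g = \<kappa> \<odot>\<^bsub>D\<^esub> (f \<otimes>\<^bsub>D\<^esub> g)"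
  proof (rule dual_eqI)
    fix c assume c: "c \<in> carrier C"
    have "tsum A (\<lambda>c\<^sub>1 c\<^sub>2. g (r c\<^sub>1 ((\<kappa> \<odot>\<^bsub>D\<^esub> f) c\<^sub>2))) (\<Delta> c) = tsum A (\<lambda>c\<^sub>1 c\<^sub>2. \<kappa> \<odot>\<^bsub>A\<^esub> g (r c\<^sub>1 (f c\<^sub>2))) (\<Delta> c)"
      using fg by (intro tsum_\<Delta>_cong c) (simp add: dual_apply k_right_module.ract_smult[OF R] dual_smult)
    also have "\<dots> = \<kappa> \<odot>\<^bsub>A\<^esub> tsum A (\<lambda>c\<^sub>1 c\<^sub>2. g (r c\<^sub>1 (f c\<^sub>2))) (\<Delta> c)"
      using fg c by (intro tsum_\<Delta>_hom[symmetric] module_A lin_smult lin_id) simp_all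
    finally show "((\<kappa> \<odot>\<^bsub>D\<^esub> f) \<otimes>\<^bsub>D\<^esub> g) c = (\<kappa> \<odot>\<^bsub>D\<^esub> (f \<otimes>\<^bsub>D\<^esub> g)) c"
      using fg c by (simp add: dual_mult_apply dual_ops_closed dual_apply)
  qed (simp_all add: fg dual_mult_closed dual_ops_closed)
  show "f \<otimes>\<^bsub>D\<^esub> (\<kappa> \<odot>\<^bsub>D\<^esub> g) = \<kappa> \<odot>\<^bsub>D\<^esub> (f \<otimes>\<^bsub>D\<^esub> g)"
  proof (rule dual_eqI)
    fix c assume c: "c \<in> carrier C"
    have "tsum A (\<lambda>c\<^sub>1 c\<^sub>2. (\<kappa> \<odot>\<^bsub>D\<^esub> g) (r c\<^sub>1 (f c\<^sub>2))) (\<Delta> c) = tsum A (\<lambda>c\<^sub>1 c\<^sub>2. \<kappa> \<odot>\<^bsub>A\<^esub> g (r c\<^sub>1 (f c\<^sub>2))) (\<Delta> c)"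
      using fg by (intro tsum_\<Delta>_cong c) (simp add: dual_apply)
    also have "\<dots> = \<kappa> \<odot>\<^bsub>A\<^esub> tsum A (\<lambda>c\<^sub>1 c\<^sub>2. g (r c\<^sub>1 (f c\<^sub>2))) (\<Delta> c)"
      using fg c by (intro tsum_\<Delta>_hom[symmetric] module_A lin_smult lin_id) simp_all
    finally show "(f \<otimes>\<^bsub>D\<^esub> (\<kappa> \<odot>\<^bsub>D\<^esub> g)) c = (\<kappa> \<odot>\<^bsub>D\<^esub> (f \<otimes>\<^bsub>D\<^esub> g)) c"
      using fg c by (simp add: dual_mult_apply dual_ops_closed dual_apply)
  qed (simp_all add: fg dual_mult_closed dual_ops_closed)
qed

end

section \<open>The H-module algebra structure of the left dual\<close>

context equivariant_coring
begin

lemmas [simp] = S'_closed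

lemma hC_one_smult: "\<lbrakk>\<kappa> \<in> carrier k; c \<in> carrier C\<rbrakk> \<Longrightarrow> hC (\<kappa> \<odot>\<^bsub>H\<^esub> \<one>\<^bsub>H\<^esub>) c = \<kappa> \<odot>\<^bsub>C\<^esub> c"
  by (simp add: k_left_module.lact_smult[OF Cs.action_M] left_module.lact_one[OF Cs.left_module_M])

lemma hA_one_smult: "\<lbrakk>\<kappa> \<in> carrier k; a \<in> carrier A\<rbrakk> \<Longrightarrow> hA (\<kappa> \<odot>\<^bsub>H\<^esub> \<one>\<^bsub>H\<^esub>) a = \<kappa> \<odot>\<^bsub>A\<^esub> a"
  by (simp add: k_left_module.lact_smult[OF Cs.action_R] Cs.hR_unit)

lemma hA_smult: "\<lbrakk>\<kappa> \<in> carrier k; h \<in> carrier H; a \<in> carrier A\<rbrakk> \<Longrightarrow> hA h (\<kappa> \<odot>\<^bsub>A\<^esub> a) = \<kappa> \<odot>\<^bsub>A\<^esub> hA h a"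
  by (rule k_left_module_smult[OF Cs.action_R])

lemma Dh_apply:
  assumes "f \<in> carrier D" "h \<in> carrier H" "c \<in> carrier C"
  shows "Dh h f c = sw A (\<lambda>a b. hA b (f (hC (S' a) c))) h"
proof -
  have "Dh h f c = tensor_lift A (\<lambda>a b. hA b (f (hC (S' a) c))) (comult H h)"
    using assms(3) by (simp add: left_dual_hact_def)
  also have "\<dots> = sw A (\<lambda>a b. hA b (f (hC (S' a) c))) h"
    using assms by (intro sw_tensor_lift module_A bilI lin_C lin_S' lin_dual[OF assms(1)]) simp_all
  finally show ?thesis .
qed

lemma Dh_apply_closed [simp]: "\<lbrakk>f \<in> carrier D; h \<in> carrier H; c \<in> carrier C\<rbrakk> \<Longrightarrow> Dh h f c \<in> carrier A"
  by (simp add: Dh_apply sw_closed module_A)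

lemma lin_Dh_h:
  assumes "f \<in> carrier D" "c \<in> carrier C" "lin k V H \<phi>"
  shows "lin k V A (\<lambda>x. Dh (\<phi> x) f c)"
proof (rule lin_comp[OF _ assms(3), of A "\<lambda>h. Dh h f c"])
  show "lin k H A (\<lambda>h. Dh h f c)"
    by (rule lin_cong[OF module_H Dh_apply], use assms in simp_all)
      (intro lin_sw module_A bilI lin_C lin_S' lin_dual[OF assms(1)]; use assms in simp)
qed

lemma lin_Dh_c:
  assumes "f \<in> carrier D" "h \<in> carrier H" "lin k V C \<phi>"
  shows "lin k V A (\<lambda>x. Dh h f (\<phi> x))"
proof (rule lin_comp[OF _ assms(3), of A "Dh h f"])
  show "lin k C A (Dh h f)"
    by (rule lin_cong[OF module_C Dh_apply], use assms in simp_all)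
      (intro lin_sw_param module_A lin_C lin_S' lin_dual[OF assms(1)]; use assms in simp)
qed

lemmas lin_Dh = lin_C lin_S' lin_Dh_h lin_Dh_c

text \<open>By \<open>cancel_action\<close>, the family \<open>h \<mapsto> Dh h f\<close> is determined by the next identity; all further
  properties of the action on the dual are derived from it.\<close>

lemma sw_Dh:
  assumes "f \<in> carrier D" "h \<in> carrier H" "c \<in> carrier C"
  shows "sw A (\<lambda>a b. Dh b f (hC a c)) h = hA h (f c)"
proof -
  note [simp] = assms
  note lin = lin_C lin_S' lin_dual[OF assms(1)]
  have "sw A (\<lambda>a b. Dh b f (hC a c)) h
      = sw A (\<lambda>a b. sw A (\<lambda>p q. hA q (f (hC (S' p \<otimes>\<^bsub>H\<^esub> a) c))) b) h"
    by (intro sw_cong) (simp_all add: Dh_apply Cs.hM_mult cong: sw_cong)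
  also have "\<dots> = sw A (\<lambda>a b. sw A (\<lambda>p q. hA b (f (hC (S' q \<otimes>\<^bsub>H\<^esub> p) c))) a) h"
    by (intro sw_coassoc[symmetric] module_A lin) simp_all
  \<comment> \<open>After regrouping, the inner sum contains \<open>S'\<close> of the second part
    times the first part of \<open>a\<close>, which is the counit of \<open>a\<close>.\<close>
  also have "\<dots> = sw A (\<lambda>a b. hA b (f (hC (sw H (\<lambda>p q. S' q \<otimes>\<^bsub>H\<^esub> p) a) c))) h"
    by (intro sw_cong sw_hom[symmetric] module_A module_H lin) simp_all
  also have "\<dots> = sw A (\<lambda>a b. counit H a \<odot>\<^bsub>A\<^esub> hA b (f c)) h"
    by (intro sw_cong) (simp_all add: sw_S'_right counit_closed hC_one_smult dual_smult hA_smult)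
  also have "\<dots> = hA h (f c)"
    by (intro sw_counit_left module_A lin) simp_all
  finally show ?thesis .
qed

text \<open>Two nested cancellations, the outer one on C and the inner one on A. Once both c and a
  carry their parts of h, the last part acts on f evaluated at h_1 (a c), so \<open>sw_Dh\<close>
  gives h.(a f(c)) = (h_1 a) (h_2 f(c)), where linearity of f itself has been used.\<close>

lemma Dh_lact:
  assumes f: "f \<in> carrier D" and h: "h \<in> carrier H" and a: "a \<in> carrier A" and c: "c \<in> carrier C"
  shows "Dh h f (l a c) = a \<otimes>\<^bsub>A\<^esub> Dh h f c"
proof (rule cancel_action[OF Cs.action_M module_A, where F = "\<lambda>h c. Dh h f (l a c)"
      and F' = "\<lambda>h c. a \<otimes>\<^bsub>A\<^esub> Dh h f c", OF _ _ _ _ _ h c])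
  note [simp] = f a
  fix h c assume [simp]: "h \<in> carrier H" "c \<in> carrier C"
  have "sw A (\<lambda>p q. Dh q f (l a (hC p c))) h = a \<otimes>\<^bsub>A\<^esub> hA h (f c)"
  proof (rule cancel_action[OF Cs.action_R module_A, where F = "\<lambda>h a. sw A (\<lambda>p q. Dh q f (l a (hC p c))) h"
        and F' = "\<lambda>h a. a \<otimes>\<^bsub>A\<^esub> hA h (f c)"])
    fix h a assume [simp]: "h \<in> carrier H" "a \<in> carrier A"
    have "sw A (\<lambda>u v. sw A (\<lambda>p q. Dh q f (l (hA u a) (hC p c))) v) h
        = sw A (\<lambda>u v. sw A (\<lambda>p q. Dh v f (l (hA p a) (hC q c))) u) h"
      by (intro sw_coassoc[symmetric] module_A lin_Dh) simp_all
    also have "\<dots> = sw A (\<lambda>u v. Dh v f (sw C (\<lambda>p q. l (hA p a) (hC q c)) u)) h"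
      by (intro sw_cong sw_hom[symmetric] module_A module_C lin_Dh) simp_all
    also have "\<dots> = sw A (\<lambda>u v. Dh v f (hC u (l a c))) h"
      by (intro sw_cong) (simp_all add: hC_lact)
    also have "\<dots> = sw A (\<lambda>u v. hA u a \<otimes>\<^bsub>A\<^esub> hA v (f c)) h"
      by (simp add: sw_Dh dual_lact Cs.hR_prod)
    finally show "sw A (\<lambda>u v. sw A (\<lambda>p q. Dh q f (l (hA u a) (hC p c))) v) h
      = sw A (\<lambda>u v. hA u a \<otimes>\<^bsub>A\<^esub> hA v (f c)) h" .
  qed ((intro lin_sw lin_sw_param bilI module_A lin_Dh; simp)+, simp_all)
  also have "\<dots> = sw A (\<lambda>p q. a \<otimes>\<^bsub>A\<^esub> Dh q f (hC p c)) h"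
    by (subst sw_Dh[symmetric], simp_all, intro sw_hom module_A lin_C) simp_all
  finally show "sw A (\<lambda>p q. Dh q f (l a (hC p c))) h = sw A (\<lambda>p q. a \<otimes>\<^bsub>A\<^esub> Dh q f (hC p c)) h" .
qed (intro lin_Dh; use f a in simp)+

lemma Dh_closed [simp]:
  assumes "f \<in> carrier D" "h \<in> carrier H"
  shows "Dh h f \<in> carrier D"
proof -
  have "(\<lambda>c\<in>carrier C. Dh h f c) \<in> carrier D"
    using assms linD(2)[OF lin_Dh_c[OF assms lin_id]] by (intro dualI) (simp_all add: Dh_lact)
  moreover have "(\<lambda>c\<in>carrier C. Dh h f c) = Dh h f"
    by (rule ext) (simp add: left_dual_hact_def)
  ultimately show ?thesis by simp
qed

lemma lin_Dh_fun: "f \<in> carrier D \<Longrightarrow> lin k H D (\<lambda>h. Dh h f)"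
  using linD(2,3)[OF lin_Dh_h[OF _ _ lin_id]]
  by (intro linI dual_eqI) (simp_all add: dual_ops_closed dual_apply)

text \<open>Computed from the defining formula: \<open>S'\<close> reverses products, so c is first
  acted on by \<open>S'\<close>(g_1) and then by \<open>S'\<close>(h_1), as in the iterated
  action.\<close>

lemma Dh_mult:
  assumes "f \<in> carrier D" "g \<in> carrier H" "h \<in> carrier H"
  shows "Dh (g \<otimes>\<^bsub>H\<^esub> h) f = Dh g (Dh h f)"
proof (rule dual_eqI)
  note [simp] = assms
  note lin = lin_C lin_S' lin_dual[OF assms(1)]
  fix c assume [simp]: "c \<in> carrier C"
  have "Dh (g \<otimes>\<^bsub>H\<^esub> h) f c
      = sw A (\<lambda>a b. sw A (\<lambda>p q. hA (b \<otimes>\<^bsub>H\<^esub> q) (f (hC (S' (a \<otimes>\<^bsub>H\<^esub> p)) c))) h) g"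
    by (subst Dh_apply, simp_all, intro sw_mult module_A bilI lin) simp_all
  also have "\<dots> = sw A (\<lambda>a b. sw A (\<lambda>p q. hA b (hA q (f (hC (S' p) (hC (S' a) c))))) h) g"
    by (intro sw_cong) (simp_all add: Cs.hR_mult Cs.hM_mult S'_mult)
  also have "\<dots> = sw A (\<lambda>a b. hA b (Dh h f (hC (S' a) c))) g"
    by (intro sw_cong, simp, subst Dh_apply, simp_all,
        intro sw_hom[symmetric] module_A lin) simp_all
  also have "\<dots> = Dh g (Dh h f) c"
    by (simp add: Dh_apply[of "Dh h f"])
  finally show "Dh (g \<otimes>\<^bsub>H\<^esub> h) f c = Dh g (Dh h f) c" .
qed (simp_all add: assms)

lemma Dh_unit:
  assumes f: "f \<in> carrier D"
  shows "Dh \<one>\<^bsub>H\<^esub> f = f"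
proof (rule dual_eqI)
  fix c assume c: "c \<in> carrier C"
  have "Dh \<one>\<^bsub>H\<^esub> f c = hA \<one>\<^bsub>H\<^esub> (f (hC (S' \<one>\<^bsub>H\<^esub>) c))"
    using f c by (subst Dh_apply, simp_all, intro sw_one module_A bilI lin_C lin_S' lin_dual[OF f]) simp_all
  then show "Dh \<one>\<^bsub>H\<^esub> f c = f c"
    using f c by (simp add: S'_one Cs.hR_unit left_module.lact_one[OF Cs.left_module_M])
qed (simp_all add: f)

lemma Dh_add_r:
  assumes "f \<in> carrier D" "g \<in> carrier D" "h \<in> carrier H"
  shows "Dh h (f \<oplus>\<^bsub>D\<^esub> g) = Dh h f \<oplus>\<^bsub>D\<^esub> Dh h g"
proof (rule dual_eqI)
  interpret HH: tensor_pair k H "\<lambda>h \<kappa>. \<kappa> \<odot>\<^bsub>H\<^esub> h" H "\<lambda>\<kappa> h. \<kappa> \<odot>\<^bsub>H\<^esub> h" by (rule tensor_pair_H)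
  note [simp] = assms dual_ops_closed(1)
  fix c assume [simp]: "c \<in> carrier C"
  have "Dh h (f \<oplus>\<^bsub>D\<^esub> g) c = sw A (\<lambda>a b. hA b (f (hC (S' a) c)) \<oplus>\<^bsub>A\<^esub> hA b (g (hC (S' a) c))) h"
    by (subst Dh_apply, simp_all, intro sw_cong)
      (simp_all add: dual_apply left_module.lact_add_r[OF Cs.left_module_R])
  also have "\<dots> = (Dh h f \<oplus>\<^bsub>D\<^esub> Dh h g) c"
    by (simp add: dual_apply Dh_apply, intro HH.tsum_add abelian_group_A comult_closed) simp_all
  finally show "Dh h (f \<oplus>\<^bsub>D\<^esub> g) c = (Dh h f \<oplus>\<^bsub>D\<^esub> Dh h g) c" .
qed (simp_all add: assms dual_ops_closed)

lemma dual_action: "k_left_module k H D Dh"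
proof (intro k_left_module.intro k_left_module_axioms.intro left_module.intro left_module_axioms.intro)
  show "ring H" by (rule A.ring_axioms)
  show "abelian_group D" by (rule module_abelian_group[OF module_D])
qed (use linD(2,3)[OF lin_Dh_fun] in
  \<open>simp_all add: k_algebra_H module_D Dh_mult Dh_unit Dh_add_r\<close>)

text \<open>H-linearity of the counit of C turns h_2 \<epsilon>(\<open>S'\<close>(h_1) c) into h_2
  \<open>S'\<close>(h_1) acting on \<epsilon>(c), and h_2 \<open>S'\<close>(h_1) is a
  scalar.\<close>

lemma Dh_one:
  assumes h: "h \<in> carrier H"
  shows "Dh h \<one>\<^bsub>D\<^esub> = counit H h \<odot>\<^bsub>D\<^esub> \<one>\<^bsub>D\<^esub>"
proof (rule dual_eqI)
  note [simp] = h dual_ops_closed(3) counit_closed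
  fix c assume [simp]: "c \<in> carrier C"
  have "Dh h \<one>\<^bsub>D\<^esub> c = sw A (\<lambda>a b. hA (b \<otimes>\<^bsub>H\<^esub> S' a) (\<epsilon> c)) h"
    by (subst Dh_apply, simp_all, intro sw_cong) (simp_all add: dual_apply counit_hact Cs.hR_mult)
  also have "\<dots> = hA (sw H (\<lambda>a b. b \<otimes>\<^bsub>H\<^esub> S' a) h) (\<epsilon> c)"
    by (intro sw_hom[symmetric] module_A module_H lin_C) simp_all
  finally show "Dh h \<one>\<^bsub>D\<^esub> c = (counit H h \<odot>\<^bsub>D\<^esub> \<one>\<^bsub>D\<^esub>) c"
    by (simp add: sw_S'_left hA_one_smult dual_apply)
qed (simp_all add: h dual_ops_closed counit_closed)

lemma tsum_\<Delta>_swap: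
  assumes "module k G" "c \<in> carrier C" "h \<in> carrier H"
    "\<And>a b c\<^sub>1 c\<^sub>2. \<lbrakk>a \<in> carrier H; b \<in> carrier H; c\<^sub>1 \<in> carrier C; c\<^sub>2 \<in> carrier C\<rbrakk> \<Longrightarrow> f a b c\<^sub>1 c\<^sub>2 \<in> carrier G"
  shows "sw G (\<lambda>a b. tsum G (\<lambda>c\<^sub>1 c\<^sub>2. f a b c\<^sub>1 c\<^sub>2) (\<Delta> c)) h = tsum G (\<lambda>c\<^sub>1 c\<^sub>2. sw G (\<lambda>a b. f a b c\<^sub>1 c\<^sub>2) h) (\<Delta> c)"
  unfolding tsum_def
  using assms tensor_pair.trep_mem[OF tensor_pair_H comult_closed]
    tensor_pair.trep_mem[OF cor.tensor_pair_coring cor.comult_closed]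
  by (intro abelian_group.lsum_swap[OF module_abelian_group]) auto

lemma lin_dual_mult_apply:
  assumes "f \<in> carrier D" "g \<in> carrier D" "c \<in> carrier C" "h \<in> carrier H"
  shows "lin k H A (\<lambda>a. (Dh a f \<otimes>\<^bsub>D\<^esub> Dh h g) c)" "lin k H A (\<lambda>b. (Dh h f \<otimes>\<^bsub>D\<^esub> Dh b g) c)"
proof -
  have ev: "lin k D A (\<lambda>f. f c)"
    using assms(3) by (intro linI) (simp_all add: dual_apply)
  show "lin k H A (\<lambda>a. (Dh a f \<otimes>\<^bsub>D\<^esub> Dh h g) c)"
    using assms by (intro lin_comp[OF ev] lin_mult_l[OF dual_algebra] lin_Dh_fun Dh_closed)
  show "lin k H A (\<lambda>b. (Dh h f \<otimes>\<^bsub>D\<^esub> Dh b g) c)"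
    using assms by (intro lin_comp[OF ev] lin_mult_r[OF dual_algebra] lin_Dh_fun Dh_closed)
qed

text \<open>After cancellation c is replaced by h_1 c, and H-linearity of \<Delta> distributes four
  consecutive parts of h over c_1, c_2, f and g. The parts at c_2 and f combine by
  \<open>sw_Dh\<close> into an action on f(c_2), then those at c_1 and f(c_2) into one on c_1
  f(c_2), and a last use of \<open>sw_Dh\<close>, for g, leaves h.(g(c_1 f(c_2))).\<close>

lemma Dh_prod_apply:
  assumes fg: "f \<in> carrier D" "g \<in> carrier D" and h: "h \<in> carrier H" and c: "c \<in> carrier C"
  shows "Dh h (f \<otimes>\<^bsub>D\<^esub> g) c = sw A (\<lambda>a b. (Dh a f \<otimes>\<^bsub>D\<^esub> Dh b g) c) h"
proof (rule cancel_action[OF Cs.action_M module_A, where F = "\<lambda>h c. Dh h (f \<otimes>\<^bsub>D\<^esub> g) c"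
      and F' = "\<lambda>h c. sw A (\<lambda>a b. (Dh a f \<otimes>\<^bsub>D\<^esub> Dh b g) c) h", OF _ _ _ _ _ h c])
  note [simp] = fg dual_mult_closed
  note lin = lin_Dh lin_dual[OF fg(1)] lin_dual[OF fg(2)]
  show "lin k C A (\<lambda>c. sw A (\<lambda>a b. (Dh a f \<otimes>\<^bsub>D\<^esub> Dh b g) c) h)" if "h \<in> carrier H" for h
    using that by (intro lin_sw_param module_A lin_dual lin_id) simp_all
  show "lin k H A (\<lambda>h. sw A (\<lambda>a b. (Dh a f \<otimes>\<^bsub>D\<^esub> Dh b g) c) h)" if "c \<in> carrier C" for c
    using that by (intro lin_sw module_A bilI lin_dual_mult_apply) simp_all
  show "lin k C A (\<lambda>c. Dh h (f \<otimes>\<^bsub>D\<^esub> g) c)" if "h \<in> carrier H" for h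
    using that by (intro lin_Dh) simp_all
  show "lin k H A (\<lambda>h. Dh h (f \<otimes>\<^bsub>D\<^esub> g) c)" if "c \<in> carrier C" for c
    using that by (intro lin_Dh) simp_all
  fix h c assume [simp]: "h \<in> carrier H" "c \<in> carrier C"
  let ?q = "\<lambda>c\<^sub>1 c\<^sub>2 s t p q. Dh q g (r (hC s c\<^sub>1) (Dh p f (hC t c\<^sub>2)))"
  have inner: "sw A (\<lambda>a b. sw A (\<lambda>p q. sw A (\<lambda>s t. ?q c\<^sub>1 c\<^sub>2 s t p q) a) b) h = hA h (g (r c\<^sub>1 (f c\<^sub>2)))"
    if [simp]: "c\<^sub>1 \<in> carrier C" "c\<^sub>2 \<in> carrier C" for c\<^sub>1 c\<^sub>2
  proof -
    have "sw A (\<lambda>a b. sw A (\<lambda>p q. sw A (\<lambda>s t. ?q c\<^sub>1 c\<^sub>2 s t p q) a) b) h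
        = sw A (\<lambda>a b. sw A (\<lambda>s t. sw A (\<lambda>p q. ?q c\<^sub>1 c\<^sub>2 s t p q) b) a) h"
      by (intro sw_cong sw_swap module_A) simp_all
    \<comment> \<open>Two coassociativity moves bring the second and third of the four parts, those
      at c_2 and f, into one inner sum.\<close>
    also have "\<dots> = sw A (\<lambda>a b. sw A (\<lambda>s t. sw A (\<lambda>p q. ?q c\<^sub>1 c\<^sub>2 a s p q) t) b) h"
      by (intro sw_coassoc module_A lin_sw_param lin_sw bilI lin) simp_all
    also have "\<dots> = sw A (\<lambda>a b. sw A (\<lambda>s t. sw A (\<lambda>p q. ?q c\<^sub>1 c\<^sub>2 a p q t) s) b) h"
      by (intro sw_cong sw_coassoc[symmetric] module_A lin) simp_all
    also have "\<dots> = sw A (\<lambda>a b. sw A (\<lambda>s t. Dh t g (r (hC a c\<^sub>1) (sw A (\<lambda>p q. Dh q f (hC p c\<^sub>2)) s))) b) h"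
      by (intro sw_cong sw_hom[symmetric] module_A lin) simp_all
    also have "\<dots> = sw A (\<lambda>a b. sw A (\<lambda>s t. Dh t g (r (hC a c\<^sub>1) (hA s (f c\<^sub>2)))) b) h"
      by (intro sw_cong) (simp_all add: sw_Dh)
    also have "\<dots> = sw A (\<lambda>a b. sw A (\<lambda>s t. Dh b g (r (hC s c\<^sub>1) (hA t (f c\<^sub>2)))) a) h"
      by (intro sw_coassoc[symmetric] module_A lin) simp_all
    also have "\<dots> = sw A (\<lambda>a b. Dh b g (sw C (\<lambda>s t. r (hC s c\<^sub>1) (hA t (f c\<^sub>2))) a)) h"
      by (intro sw_cong sw_hom[symmetric] module_A module_C lin) simp_all
    also have "\<dots> = sw A (\<lambda>a b. Dh b g (hC a (r c\<^sub>1 (f c\<^sub>2)))) h"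
      by (intro sw_cong) (simp_all add: Cs.hM_ract)
    also have "\<dots> = hA h (g (r c\<^sub>1 (f c\<^sub>2)))"
      by (simp add: sw_Dh)
    finally show ?thesis .
  qed
  have "sw A (\<lambda>a b. sw A (\<lambda>p q. (Dh p f \<otimes>\<^bsub>D\<^esub> Dh q g) (hC a c)) b) h
      = sw A (\<lambda>a b. sw A (\<lambda>p q. tsum A (\<lambda>c\<^sub>1 c\<^sub>2. sw A (\<lambda>s t. ?q c\<^sub>1 c\<^sub>2 s t p q) a) (\<Delta> c)) b) h"
    by (intro sw_cong, simp_all add: dual_mult_apply,
        intro tsum_comult_hact abelian_group_A balanced_dual_mult) simp_all
  also have "\<dots> = sw A (\<lambda>a b. tsum A (\<lambda>c\<^sub>1 c\<^sub>2. sw A (\<lambda>p q. sw A (\<lambda>s t. ?q c\<^sub>1 c\<^sub>2 s t p q) a) b) (\<Delta> c)) h"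
    by (intro sw_cong tsum_\<Delta>_swap module_A) (simp_all add: sw_closed module_A)
  also have "\<dots> = tsum A (\<lambda>c\<^sub>1 c\<^sub>2. sw A (\<lambda>a b. sw A (\<lambda>p q. sw A (\<lambda>s t. ?q c\<^sub>1 c\<^sub>2 s t p q) a) b) h) (\<Delta> c)"
    by (intro tsum_\<Delta>_swap module_A) (simp_all add: sw_closed module_A)
  also have "\<dots> = tsum A (\<lambda>c\<^sub>1 c\<^sub>2. hA h (g (r c\<^sub>1 (f c\<^sub>2)))) (\<Delta> c)"
    by (intro tsum_\<Delta>_cong inner) simp_all
  also have "\<dots> = hA h (tsum A (\<lambda>c\<^sub>1 c\<^sub>2. g (r c\<^sub>1 (f c\<^sub>2))) (\<Delta> c))"
    by (intro tsum_\<Delta>_hom[symmetric] module_A lin_C) simp_all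
  also have "\<dots> = sw A (\<lambda>a b. Dh b (f \<otimes>\<^bsub>D\<^esub> g) (hC a c)) h"
    by (simp add: sw_Dh dual_mult_apply)
  finally show "sw A (\<lambda>a b. Dh b (f \<otimes>\<^bsub>D\<^esub> g) (hC a c)) h
    = sw A (\<lambda>a b. sw A (\<lambda>p q. (Dh p f \<otimes>\<^bsub>D\<^esub> Dh q g) (hC a c)) b) h" by simp
qed

lemma sw_dual_apply:
  assumes "h \<in> carrier H" "c \<in> carrier C"
    "\<And>a b. \<lbrakk>a \<in> carrier H; b \<in> carrier H\<rbrakk> \<Longrightarrow> F a b \<in> carrier D"
  shows "(sw D F h) c = sw A (\<lambda>a b. F a b c) h"
proof -
  have "lin k D A (\<lambda>f. f c)"
    using assms(2) by (intro linI) (simp_all add: dual_apply)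
  from sw_hom[OF module_D module_A this assms(1,3)] show ?thesis .
qed

lemma dual_module_algebra: "module_algebra k H D Dh"
proof (intro module_algebra.intro module_algebra_axioms.intro hopf_algebra_axioms dual_algebra dual_action Dh_one)
  fix h f g assume fgh: "h \<in> carrier H" "f \<in> carrier D" "g \<in> carrier D"
  have "tensor_lift D (\<lambda>a b. Dh a f \<otimes>\<^bsub>D\<^esub> Dh b g) (comult H h) = sw D (\<lambda>a b. Dh a f \<otimes>\<^bsub>D\<^esub> Dh b g) h"
    using fgh by (intro sw_tensor_lift module_D bilI lin_mult_l[OF dual_algebra]
        lin_mult_r[OF dual_algebra] lin_Dh_fun Dh_closed)
  also have "\<dots> = Dh h (f \<otimes>\<^bsub>D\<^esub> g)"
    using fgh by (intro dual_eqI)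
      (simp_all add: sw_closed module_D dual_mult_closed sw_dual_apply Dh_prod_apply)
  finally show "Dh h (f \<otimes>\<^bsub>D\<^esub> g) = tensor_lift D (\<lambda>a b. Dh a f \<otimes>\<^bsub>D\<^esub> Dh b g) (comult H h)" by simp
qed

end

section \<open>The comodule of a grouplike element\<close>

locale grouplike_coring = equivariant_coring k H A hA C hC l r \<Delta> \<epsilon>
  for k :: "('k, 'x) ring_scheme" and H :: "('k, 'h, 'y) hopf_scheme"
  and A :: "('k, 'a, 'z) module_scheme" and hA :: "'h \<Rightarrow> 'a \<Rightarrow> 'a"
  and C :: "('k, 'c, 'w) module_scheme" and hC :: "'h \<Rightarrow> 'c \<Rightarrow> 'c"
  and l :: "'a \<Rightarrow> 'c \<Rightarrow> 'c" and r :: "'c \<Rightarrow> 'a \<Rightarrow> 'c"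
  and \<Delta> :: "'c \<Rightarrow> ('c, 'c) tensor" and \<epsilon> :: "'c \<Rightarrow> 'a" +
  fixes x :: 'c
  assumes grouplike: "H_grouplike k H A hA C hC l r \<Delta> \<epsilon> x"
begin

lemma x_closed [simp]: "x \<in> carrier C"
  by (rule H_grouplike.grouplike_closed[OF grouplike])

lemma comult_x: "\<Delta> x = pure_tensor A C r C l x x"
  by (rule H_grouplike.grouplike_comult[OF grouplike])

lemma counit_x: "\<epsilon> x = \<one>\<^bsub>A\<^esub>"
  by (rule H_grouplike.grouplike_counit[OF grouplike])

lemma hC_x: "h \<in> carrier H \<Longrightarrow> hC h x = counit H h \<odot>\<^bsub>C\<^esub> x"
  by (rule H_grouplike.grouplike_hact[OF grouplike])

lemma hC_x_ract:
  assumes "h \<in> carrier H" "a \<in> carrier A"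
  shows "hC h (r x a) = r x (hA h a)"
proof -
  have "hC h (r x a) = sw C (\<lambda>p q. counit H p \<odot>\<^bsub>C\<^esub> r x (hA q a)) h"
    using assms
    by (simp add: Cs.hM_ract)
      (intro sw_cong, simp_all add: hC_x counit_closed k_right_module_smult[OF Cs.right_M])
  also have "\<dots> = r x (hA h a)"
    using assms by (intro sw_counit_left module_C lin_C) simp_all
  finally show ?thesis .
qed

lemma comult_x_ract: "a \<in> carrier A \<Longrightarrow> \<Delta> (r x a) = pure_tensor A C r C l x (r x a)"
proof -
  interpret T3: tensor_triple A C r C l r C l by (rule cor.tensor_triple_coring)
  assume "a \<in> carrier A"
  then show ?thesis using T3.rMN_pure[of x x a] by (simp add: cor.comult_ract comult_x)
qed

text \<open>Since \<Delta>(x a) = x \<otimes> x a, evaluating a product at x a means acting by f and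
  then by g. This is associativity of the right action on A.\<close>

lemma dual_mult_x:
  assumes "f \<in> carrier D" "g \<in> carrier D" "a \<in> carrier A"
  shows "(f \<otimes>\<^bsub>D\<^esub> g) (r x a) = g (r x (f (r x a)))"
  using assms tensor_pair.tsum_pure_tensor[OF cor.tensor_pair_coring abelian_group_A balanced_dual_mult[OF assms(1,2)]]
  by (simp add: dual_mult_apply comult_x_ract)

lemma dual_right_module: "k_right_module k D A (\<lambda>a f. f (r x a))"
proof (intro k_right_module.intro k_right_module_axioms.intro right_module.intro right_module_axioms.intro)
  show "ring D" by (rule k_algebra.axioms(2)[OF dual_algebra])
  show "\<one>\<^bsub>D\<^esub> (r x a) = a" if "a \<in> carrier A" for a
    using that by (simp add: dual_apply cor.counit_ract counit_x)
qed (simp_all add: dual_algebra module_A abelian_group_A dual_apply dual_add cor.ract_add_r dual_mult_x)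

lemma dual_left_right_module: "left_right_module k H D Dh A hA (\<lambda>a f. f (r x a))"
proof (intro left_right_module.intro left_right_module_axioms.intro dual_module_algebra
    Cs.action_R dual_right_module)
  fix h a f assume haf: "h \<in> carrier H" "a \<in> carrier A" "f \<in> carrier D"
  have "tensor_lift A (\<lambda>p q. Dh q f (r x (hA p a))) (comult H h) = sw A (\<lambda>p q. Dh q f (r x (hA p a))) h"
    using haf by (intro sw_tensor_lift module_A bilI lin_Dh) simp_all
  also have "\<dots> = sw A (\<lambda>p q. Dh q f (hC p (r x a))) h"
    using haf by (intro sw_cong) (simp_all add: hC_x_ract)
  also have "\<dots> = hA h (f (r x a))"
    using haf by (intro sw_Dh) simp_all
  finally show "hA h (f (r x a)) = tensor_lift A (\<lambda>p q. Dh q f (r x (hA p a))) (comult H h)" by simp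
qed

lemma dual_cyclic: "cyclic_left_module k (op_smash k H D Dh) A (op_smash_action A hA (\<lambda>a f. f (r x a)))"
proof -
  interpret DS: smash_module k H D Dh A hA "\<lambda>a f. f (r x a)"
    by (intro smash_module.intro smash_product.intro smash_product_axioms.intro
        smash_module_axioms.intro hopf_algebra_axioms dual_module_algebra dual_left_right_module)
  have gen: "a \<in> {DS.act b \<one>\<^bsub>A\<^esub> |b. b \<in> carrier DS.B}" if a: "a \<in> carrier A" for a
  proof -
    let ?f = "\<lambda>c\<in>carrier C. \<epsilon> c \<otimes>\<^bsub>A\<^esub> a"
    have f: "?f \<in> carrier D"
      using a by (intro dualI)
        (simp_all add: cor.counit_add cor.counit_lact Cs.RR.l_distr Cs.RR.m_assoc)
    \<comment> \<open>The unit of H acts trivially and x 1 = x, so this element sends 1 to the value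
      of \<open>?f\<close> at x.\<close>
    have "DS.act (DS.RH.pure ?f \<one>\<^bsub>H\<^esub>) \<one>\<^bsub>A\<^esub> = a"
      using a f by (simp add: DS.act_pure Cs.hR_unit cor.ract_one counit_x)
    moreover have "DS.RH.pure ?f \<one>\<^bsub>H\<^esub> \<in> carrier DS.B"
      using f by simp
    ultimately show ?thesis by (metis (mono_tags, lifting) mem_Collect_eq)
  qed
  show ?thesis
    unfolding cyclic_left_module_def
  proof (intro conjI bexI[of _ "\<one>\<^bsub>A\<^esub>"] DS.op_smash_module equalityI subsetI gen)
    fix a assume "a \<in> {DS.act b \<one>\<^bsub>A\<^esub> |b. b \<in> carrier DS.B}"
    then show "a \<in> carrier A" by auto
  qed simp_all
qed

section \<open>A as an H-equivariant comodule\<close>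

lemma regular_right_module: "k_right_module k A A (\<lambda>a b. a \<otimes>\<^bsub>A\<^esub> b)"
  by (intro k_right_module.intro k_right_module_axioms.intro right_module.intro right_module_axioms.intro
      Cs.algebra_R module_A Cs.RR.ring_axioms abelian_group_A)
    (simp_all add: Cs.RR.r_distr Cs.RR.l_distr Cs.RR.m_assoc k_algebra.smult_mult_r[OF Cs.algebra_R])

lemma regular_left_right_module: "left_right_module k H A hA A hA (\<lambda>a b. a \<otimes>\<^bsub>A\<^esub> b)"
  by (intro left_right_module.intro left_right_module_axioms.intro module_algebra_A Cs.action_R
      regular_right_module module_algebra.hact_mult[OF module_algebra_A])

abbreviation \<rho> where
  "\<rho> \<equiv> \<lambda>a. pure_tensor A A (\<lambda>a b. a \<otimes>\<^bsub>A\<^esub> b) C l \<one>\<^bsub>A\<^esub> (r x a)"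

text \<open>Coassociativity holds because both sides are 1 \<otimes> x \<otimes> x a: on one side
  \<rho>(1) = 1 \<otimes> x, on the other \<Delta>(x a) = x \<otimes> x a. The counit law is
  \<epsilon>(x a) = \<epsilon>(x) a = a.\<close>

lemma regular_comodule: "right_comodule A C l r \<Delta> \<epsilon> A (\<lambda>a b. a \<otimes>\<^bsub>A\<^esub> b) \<rho>"
proof -
  interpret diagonal k H A hA C hC l r \<Delta> \<epsilon> A hA "\<lambda>a b. a \<otimes>\<^bsub>A\<^esub> b"
    by (intro diagonal.intro diagonal_axioms.intro equivariant_coring_axioms regular_left_right_module)
  interpret T3: tensor_triple A A "\<lambda>a b. a \<otimes>\<^bsub>A\<^esub> b" C l r C l
    by (intro tensor_triple.intro tensor_triple_axioms.intro MC.tensor_pair_axioms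
        cor.tensor_pair_coring cor.lact_add_r cor.ract_add_l cor.bimodule_assoc)
  show ?thesis
  proof (intro right_comodule.intro right_comodule_axioms.intro cor.coring_axioms
      k_right_module.axioms(3)[OF regular_right_module])
    show "\<rho> a \<in> carrier MC.T" if "a \<in> carrier A" for a
      using that by (simp add: MC.pure_closed)
    show "\<rho> (a \<oplus>\<^bsub>A\<^esub> b) = \<rho> a \<oplus>\<^bsub>MC.T\<^esub> \<rho> b" if "a \<in> carrier A" "b \<in> carrier A" for a b
      using that by (simp add: cor.ract_add_r MC.pure_add_r)
    show "\<rho> (a \<otimes>\<^bsub>A\<^esub> b) = tensor_lift MC.T (\<lambda>m c. MC.pure m (r c b)) (\<rho> a)"
      if "a \<in> carrier A" "b \<in> carrier A" for a b
      using that by (simp add: T3.rMN_pure cor.ract_mult)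
    show "tensor_lift A (\<lambda>m c. m \<otimes>\<^bsub>A\<^esub> \<epsilon> c) (\<rho> a) = a" if "a \<in> carrier A" for a
    proof -
      have b: "MC.balanced A (\<lambda>m c. m \<otimes>\<^bsub>A\<^esub> \<epsilon> c)"
        by (intro MC.balancedI)
          (simp_all add: Cs.RR.l_distr Cs.RR.r_distr Cs.RR.m_assoc cor.counit_add cor.counit_lact)
      have "tensor_lift A (\<lambda>m c. m \<otimes>\<^bsub>A\<^esub> \<epsilon> c) (\<rho> a) = tsum A (\<lambda>m c. m \<otimes>\<^bsub>A\<^esub> \<epsilon> c) (\<rho> a)"
        using that by (intro MC.tensor_lift_tsum abelian_group_A b MC.pure_closed) simp_all
      also have "\<dots> = \<one>\<^bsub>A\<^esub> \<otimes>\<^bsub>A\<^esub> \<epsilon> (r x a)"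
        using that by (intro MC.tsum_pure_tensor abelian_group_A b) simp_all
      finally show ?thesis using that by (simp add: cor.counit_ract counit_x)
    qed
    fix a assume a: "a \<in> carrier A"
    \<comment> \<open>Right A-linearity of the coaction lets an element of A cross the outer tensor
      sign.\<close>
    have bl: "MC.balanced T3.L.T (\<lambda>m c. T3.L.pure (\<rho> m) c)"
    proof (intro MC.balancedI)
      fix m b c assume *: "m \<in> carrier A" "b \<in> carrier A" "c \<in> carrier C"
      have "\<rho> (m \<otimes>\<^bsub>A\<^esub> b) = T3.rMN (\<rho> m) b"
        using * by (simp add: T3.rMN_pure cor.ract_mult)
      with * show "T3.L.pure (\<rho> (m \<otimes>\<^bsub>A\<^esub> b)) c = T3.L.pure (\<rho> m) (l b c)"
        by (simp add: T3.L.pure_balanced MC.pure_closed)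
    qed (simp_all add: MC.pure_closed cor.ract_add_r MC.pure_add_r T3.L.pure_closed T3.L.pure_add_l T3.L.pure_add_r)
    have br: "MC.balanced T3.R.T (\<lambda>m c. T3.R.pure m (\<Delta> c))"
      by (intro MC.balancedI)
        (simp_all add: T3.R.pure_closed cor.comult_closed cor.comult_add T3.R.pure_add_l T3.R.pure_add_r
          cor.comult_lact T3.R.pure_balanced)
    have L: "tensor_lift T3.L.T (\<lambda>m c. T3.L.pure (\<rho> m) c) (\<rho> a)
        = T3.L.pure (MC.pure \<one>\<^bsub>A\<^esub> x) (r x a)"
      using a MC.tensor_lift_tsum[OF T3.L.tensor_group bl MC.pure_closed[of "\<one>\<^bsub>A\<^esub>" "r x a"]]
        MC.tsum_pure_tensor[OF T3.L.tensor_group bl, of "\<one>\<^bsub>A\<^esub>" "r x a"]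
      by (simp add: cor.ract_one)
    have R: "tensor_lift T3.R.T (\<lambda>m c. T3.R.pure m (\<Delta> c)) (\<rho> a)
        = T3.R.pure \<one>\<^bsub>A\<^esub> (T3.NP.pure x (r x a))"
      using a MC.tensor_lift_tsum[OF T3.R.tensor_group br MC.pure_closed[of "\<one>\<^bsub>A\<^esub>" "r x a"]]
        MC.tsum_pure_tensor[OF T3.R.tensor_group br, of "\<one>\<^bsub>A\<^esub>" "r x a"]
      by (simp add: comult_x_ract)
    have "T3.assoc (tensor_lift T3.L.T (\<lambda>m c. T3.L.pure (\<rho> m) c) (\<rho> a))
        = tensor_lift T3.R.T (\<lambda>m c. T3.R.pure m (\<Delta> c)) (\<rho> a)"
      unfolding L R using a by (intro T3.assoc_pure_pure) simp_all
    then show "let CC = tensor A C r C l;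
           lCC = (\<lambda>a. tensor_lift CC (\<lambda>c\<^sub>1 c\<^sub>2. pure_tensor A C r C l (l a c\<^sub>1) c\<^sub>2));
           MC = tensor A A (\<lambda>a b. a \<otimes>\<^bsub>A\<^esub> b) C l;
           rMC = (\<lambda>X a. tensor_lift MC (\<lambda>m\<^sub>0 m\<^sub>1. pure_tensor A A (\<lambda>a b. a \<otimes>\<^bsub>A\<^esub> b) C l m\<^sub>0 (r m\<^sub>1 a)) X)
       in tensor_assoc A A (\<lambda>a b. a \<otimes>\<^bsub>A\<^esub> b) C l r C l
            (tensor_lift (tensor A MC rMC C l)
              (\<lambda>m\<^sub>0 m\<^sub>1. pure_tensor A MC rMC C l (\<rho> m\<^sub>0) m\<^sub>1) (\<rho> a)) =
          tensor_lift (tensor A A (\<lambda>a b. a \<otimes>\<^bsub>A\<^esub> b) CC lCC)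
            (\<lambda>m\<^sub>0 m\<^sub>1. pure_tensor A A (\<lambda>a b. a \<otimes>\<^bsub>A\<^esub> b) CC lCC m\<^sub>0 (\<Delta> m\<^sub>1)) (\<rho> a)"
      unfolding Let_def .
  qed
qed

text \<open>In h_1.1 \<otimes> h_2 (x a) the first factor is the scalar \<epsilon>(h_1), which the
  counit absorbs, leaving 1 \<otimes> h (x a); invariance of x then gives 1 \<otimes> x (h a). The
  scalar lives in M \<otimes> C, hence the use of the k-module \<open>P\<close>.\<close>

lemma regular_HC_comodule:
  "right_HC_comodule k H A hA C hC l r \<Delta> \<epsilon> A hA (\<lambda>a b. a \<otimes>\<^bsub>A\<^esub> b) \<rho>"
proof -
  interpret diagonal k H A hA C hC l r \<Delta> \<epsilon> A hA "\<lambda>a b. a \<otimes>\<^bsub>A\<^esub> b"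
    by (intro diagonal.intro diagonal_axioms.intro equivariant_coring_axioms regular_left_right_module)
  show ?thesis
  proof (intro right_HC_comodule.intro right_HC_comodule_axioms.intro HA_coring regular_comodule
      regular_left_right_module)
    fix h a assume ha: "h \<in> carrier H" "a \<in> carrier A"
    have "diag_pure h \<one>\<^bsub>A\<^esub> (r x a) = sw P (\<lambda>p q. counit H p \<odot>\<^bsub>P\<^esub> MC.pure \<one>\<^bsub>A\<^esub> (hC q (r x a))) h"
      using ha by (intro sw_cong) (simp_all add: Cs.hR_one counit_closed smult_pure)
    also have "\<dots> = MC.pure \<one>\<^bsub>A\<^esub> (hC h (r x a))"
      using ha by (intro sw_counit_left module_P lin_P) simp_all
    finally show "\<rho> (hA h a) = diagonal_action H A A hA (\<lambda>a b. a \<otimes>\<^bsub>A\<^esub> b) C hC l h (\<rho> a)"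
      using ha by (simp add: diagonal_action_pure hC_x_ract)
  qed
qed

end

text \<open>The second conjunct states that the right action of the left dual is compatible with H;
  the smash product action in the third conjunct is the one induced by this left-right
  structure.\<close>

theorem lemma4p5:
  fixes k :: "('k, 'x) ring_scheme" and H :: "('k, 'h, 'y) hopf_scheme"
    and A :: "('k, 'a, 'z) module_scheme" and hA :: "'h \<Rightarrow> 'a \<Rightarrow> 'a"
    and C :: "('k, 'c, 'w) module_scheme" and hC :: "'h \<Rightarrow> 'c \<Rightarrow> 'c"
    and l :: "'a \<Rightarrow> 'c \<Rightarrow> 'c" and r :: "'c \<Rightarrow> 'a \<Rightarrow> 'c"
    and \<Delta> :: "'c \<Rightarrow> ('c, 'c) tensor" and \<epsilon> :: "'c \<Rightarrow> 'a" and x :: 'c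
  assumes "cring k"
    and "hopf_algebra k H"
    and "bij_betw (antipode H) (carrier H) (carrier H)"
    and "module_algebra k H A hA"
    and "HA_coring k H A hA C hC l r \<Delta> \<epsilon>"
    and "H_grouplike k H A hA C hC l r \<Delta> \<epsilon> x"
  shows "right_HC_comodule k H A hA C hC l r \<Delta> \<epsilon> A hA (\<lambda>a b. a \<otimes>\<^bsub>A\<^esub> b)
      (\<lambda>a. pure_tensor A A (\<lambda>a b. a \<otimes>\<^bsub>A\<^esub> b) C l \<one>\<^bsub>A\<^esub> (r x a))
    \<and> left_right_module k H (left_dual A C l r \<Delta> \<epsilon>) (left_dual_hact H A hA C hC)
      A hA (\<lambda>a f. f (r x a))
    \<and> cyclic_left_module k
      (op_smash k H (left_dual A C l r \<Delta> \<epsilon>) (left_dual_hact H A hA C hC))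
      A (op_smash_action A hA (\<lambda>a f. f (r x a)))"
proof -
  interpret grouplike_coring k H A hA C hC l r \<Delta> \<epsilon> x
    by (intro grouplike_coring.intro grouplike_coring_axioms.intro equivariant_coring.intro
        equivariant_coring_axioms.intro bij_hopf_algebra.intro bij_hopf_algebra_axioms.intro assms)
  show ?thesis
    by (intro conjI regular_HC_comodule dual_left_right_module dual_cyclic)
qed

end
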